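(* Let $(\mathcal{O},*,n)$ be an Okubo algebra over a field $\mathbb{F}$ of characteristic $3$, and let $g:\mathcal{O}\to\mathbb{F}$, $g(x)=n(x,x*x)$. (1) If $\dim_{\mathbb{F}^3}g(\mathcal{O})=8$, then $(\mathcal{O},*,n)$ contains no idempotents. (2) If $\dim_{\mathbb{F}^3}g(\mathcal{O})=3$, then for each class $[\mathcal{K},a]$ with $a\notin\mathcal{K}^3$ and $g(\mathcal{O})=\mathbb{F}^3(a+\bar a)$, $(\mathcal{O},*,n)$ contains a unique quadratic idempotent $e$ with $\mathrm{cl}(e)=[\mathcal{K},a]$. (3) If $(\mathcal{O},*,n)$ is the split Okubo algebra, then it contains: (a) a unique quaternionic idempotent; (b) a conjugacy class of quadratic idempotents for each isomorphism class of quadratic étale $\mathbb{F}$-algebras (exactly one for each $\mathcal{K}$, consisting of the quadratic idempotents $e$ whose class $\mathrm{cl}(e)$ is of the form $[\mathcal{K},a]$); (c) a unique conjugacy class of singular idempotents.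
   Context: Idempotents are nonzero; conjugacy is under $\mathrm{Aut}(\mathcal{O},*,n)$. $\mathbb{F}$ has characteristic $3$, $\mathbb{F}^3=\{\alpha^3:\alpha\in\mathbb{F}\}$, $\mathcal{K}^3=\{b^3:b\in\mathcal{K}\}$, and $n(x,y)=n(x+y)-n(x)-n(y)$. The map $g$ is semilinear ($g(x+y)=g(x)+g(y)$, $g(\alpha x)=\alpha^3g(x)$), so $g(\mathcal{O})$ is an $\mathbb{F}^3$-subspace of $\mathbb{F}$; $\mathbb{F}^3(\alpha)$ is the subfield generated by $\mathbb{F}^3$ and $\alpha$. A Hurwitz algebra is a unital composition algebra $(\mathcal{C},\cdot,n)$ (nonsingular multiplicative norm; dimension $2$: quadratic étale, $4$: quaternion, $8$: Cayley), with $\bar x=n(x,1)1-x$. For an automorphism $\tau$ with $\tau^3=\mathrm{id}$, the Petersson algebra $\mathcal{C}_\tau=(\mathcal{C},*,n)$ has $x*y=\tau(\bar x)\cdot\tau^2(\bar y)$; for $\tau=\mathrm{id}$ it is the para-Hurwitz algebra (para-quadratic, para-quaternion, para-Cayley in dimensions $2,4,8$). The split Cayley algebra has a canonical basis $e_1,e_2,u_i,v_i$ ($i=1,2,3$) where $e_1,e_2$ are orthogonal idempotents with $e_1+e_2=1$, $e_1u_i=u_i=u_ie_2$, $e_2v_i=v_i=v_ie_1$, $e_2u_i=u_ie_1=e_1v_i=v_ie_2=0$, $u_iu_{i+1}=v_{i+2}=-u_{i+1}u_i$, $v_iv_{i+1}=u_{i+2}=-v_{i+1}v_i$ (indices mod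 $3$), $u_i^2=v_i^2=0$, $u_iv_i=-e_1$, $v_iu_i=-e_2$, $u_iv_j=v_iu_j=0$ ($i\ne j$). The split Okubo algebra is its Petersson algebra for the automorphism $\tau_{st}$ fixing $e_1,e_2$ with $u_i\mapsto u_{i+1}$, $v_i\mapsto v_{i+1}$; an Okubo algebra is an algebra becoming isomorphic to it after an extension of scalars. An idempotent $f$ of an Okubo algebra is quaternionic if its centralizer $\{x:f*x=x*f\}$ contains a para-quaternion subalgebra; quadratic if the centralizer contains a para-quadratic but no para-quaternion subalgebra; singular otherwise. Pairs: for quadratic étale algebras $\mathcal{K},\mathcal{K}'$ and norm $1$ elements $a\in\mathcal{K}$, $a'\in\mathcal{K}'$, $(\mathcal{K},a)$ and $(\mathcal{K}',a')$ are equivalent if there is an isomorphism $\varphi:\mathcal{K}\to\mathcal{K}'$ with $\varphi(a)\in(\mathcal{K}')^3a'$; the class is $[\mathcal{K},a]$. $\tau_{\mathcal{K},a}$: let $\mathcal{W}$ be a free left $\mathcal{K}$-module with basis $w_1,w_2,w_3$, $\sigma$ the hermitian form on $\mathcal{W}$ (linear in the first variable) with $\sigma(w_i,w_i)=0$, $\sigma(w_i,w_j)=-1$ ($i\ne j$), $\Phi$ the alternating $\mathcal{K}$-trilinear form with $\Phi(w_1,w_2,w_3)=a$, and $x\times y$ defined by $\sigma(z,x\times y)=\Phi(z,x,y)$. Then $\mathcal{K}\oplus\mathcal{W}$, with $\mathcal{K}$ a subalgebra, $b\cdot x$ the module action, $x\cdot b=\bar b\cdot x$, $x\cdot y=-\sigma(x,y)+x\times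 y$ ($b\in\mathcal{K}$, $x,y\in\mathcal{W}$), is a Cayley algebra isomorphic to the split one, and $\tau_{\mathcal{K},a}$ is its automorphism that is the identity on $\mathcal{K}$, $\mathcal{K}$-linear on $\mathcal{W}$, with $w_1\mapsto w_2\mapsto w_3\mapsto w_1$. Class of a quadratic idempotent $e$ of $(\mathcal{O},*,n)$: with $x\cdot y=(e*x)*(y*e)$, $(\mathcal{O},\cdot,n)$ is a split Cayley algebra with unity $e$, and $\tau_e:x\mapsto e*(e*x)$ is an order $3$ automorphism of it, conjugate to some $\tau_{\mathcal{K},a}$; $\mathrm{cl}(e)=[\mathcal{K},a]$ (this is well defined). *)

theory Defs
  imports "HOL-Analysis.Analysis"
begin

section \<open>Algebras with a quadratic form\<close>

text \<open>
  The additive structure of an algebra is that of the ambient type and its scalar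
  multiplication is defined on all of that type; the algebra itself lives on a subspace,
  its carrier, so that subalgebras are algebras of the same kind.
\<close>

record ('f, 'v) nalg =
  carr :: "'v set"
  smul :: "'f \<Rightarrow> 'v \<Rightarrow> 'v"
  mul :: "'v \<Rightarrow> 'v \<Rightarrow> 'v"
  nrm :: "'v \<Rightarrow> 'f"

definition polar :: "('f::field, 'v::ab_group_add) nalg \<Rightarrow> 'v \<Rightarrow> 'v \<Rightarrow> 'f" where
  "polar A x y = nrm A (x + y) - nrm A x - nrm A y"

definition bilinear_mul :: "('f::field, 'v::ab_group_add) nalg \<Rightarrow> bool" where
  "bilinear_mul A \<longleftrightarrow>
     (\<forall>x\<in>carr A. \<forall>y\<in>carr A. mul A x y \<in> carr A) \<and>
     (\<forall>x\<in>carr A. \<forall>y\<in>carr A. \<forall>z\<in>carr A.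
        mul A (x + y) z = mul A x z + mul A y z \<and>
        mul A z (x + y) = mul A z x + mul A z y) \<and>
     (\<forall>c. \<forall>x\<in>carr A. \<forall>y\<in>carr A.
        mul A (smul A c x) y = smul A c (mul A x y) \<and>
        mul A x (smul A c y) = smul A c (mul A x y))"

definition quadratic_nrm :: "('f::field, 'v::ab_group_add) nalg \<Rightarrow> bool" where
  "quadratic_nrm A \<longleftrightarrow>
     (\<forall>c. \<forall>x\<in>carr A. nrm A (smul A c x) = c ^ 2 * nrm A x) \<and>
     (\<forall>x\<in>carr A. \<forall>y\<in>carr A. \<forall>z\<in>carr A.
        polar A (x + y) z = polar A x z + polar A y z) \<and>
     (\<forall>c. \<forall>x\<in>carr A. \<forall>y\<in>carr A. polar A (smul A c x) y = c * polar A x y)"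

definition normed_algebra :: "('f::field, 'v::ab_group_add) nalg \<Rightarrow> bool" where
  "normed_algebra A \<longleftrightarrow>
     vector_space (smul A) \<and> module.subspace (smul A) (carr A) \<and>
     bilinear_mul A \<and> quadratic_nrm A"

definition alg_dim :: "('f::field, 'v::ab_group_add) nalg \<Rightarrow> nat" where
  "alg_dim A = vector_space.dim (smul A) (carr A)"

definition alg_basis :: "('f::field, 'v::ab_group_add) nalg \<Rightarrow> 'v set \<Rightarrow> bool" where
  "alg_basis A B \<longleftrightarrow> \<not> module.dependent (smul A) B \<and> module.span (smul A) B = carr A"

definition subalgebra :: "('f::field, 'v::ab_group_add) nalg \<Rightarrow> 'v set \<Rightarrow> bool" where
  "subalgebra A S \<longleftrightarrow>
     S \<subseteq> carr A \<and> module.subspace (smul A) S \<and> (\<forall>x\<in>S. \<forall>y\<in>S. mul A x y \<in> S)"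

definition alg_iso ::
  "('f::field, 'v::ab_group_add) nalg \<Rightarrow> ('f, 'w::ab_group_add) nalg \<Rightarrow> ('v \<Rightarrow> 'w) \<Rightarrow> bool" where
  "alg_iso A B \<phi> \<longleftrightarrow>
     bij_betw \<phi> (carr A) (carr B) \<and>
     (\<forall>x\<in>carr A. \<forall>y\<in>carr A. \<phi> (x + y) = \<phi> x + \<phi> y) \<and>
     (\<forall>c. \<forall>x\<in>carr A. \<phi> (smul A c x) = smul B c (\<phi> x)) \<and>
     (\<forall>x\<in>carr A. \<forall>y\<in>carr A. \<phi> (mul A x y) = mul B (\<phi> x) (\<phi> y)) \<and>
     (\<forall>x\<in>carr A. nrm B (\<phi> x) = nrm A x)"

definition isomorphic ::
  "('f::field, 'v::ab_group_add) nalg \<Rightarrow> ('f, 'w::ab_group_add) nalg \<Rightarrow> bool" where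
  "isomorphic A B \<longleftrightarrow> (\<exists>\<phi>. alg_iso A B \<phi>)"

section \<open>Hurwitz, Petersson and para-Hurwitz algebras\<close>

definition nonsingular_nrm :: "('f::field, 'v::ab_group_add) nalg \<Rightarrow> bool" where
  "nonsingular_nrm A \<longleftrightarrow> (\<forall>x\<in>carr A. (\<forall>y\<in>carr A. polar A x y = 0) \<longrightarrow> x = 0)"

definition is_unit_of :: "('f::field, 'v::ab_group_add) nalg \<Rightarrow> 'v \<Rightarrow> bool" where
  "is_unit_of A u \<longleftrightarrow> u \<in> carr A \<and> (\<forall>x\<in>carr A. mul A u x = x \<and> mul A x u = x)"

definition unity :: "('f::field, 'v::ab_group_add) nalg \<Rightarrow> 'v" where
  "unity A = (THE u. is_unit_of A u)"

definition hurwitz :: "('f::field, 'v::ab_group_add) nalg \<Rightarrow> bool" where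
  "hurwitz A \<longleftrightarrow>
     normed_algebra A \<and> nonsingular_nrm A \<and>
     (\<forall>x\<in>carr A. \<forall>y\<in>carr A. nrm A (mul A x y) = nrm A x * nrm A y) \<and>
     (\<exists>u. is_unit_of A u)"

definition quadratic_etale :: "('f::field, 'v::ab_group_add) nalg \<Rightarrow> bool" where
  "quadratic_etale A \<longleftrightarrow> hurwitz A \<and> alg_dim A = 2"

definition quaternion_alg :: "('f::field, 'v::ab_group_add) nalg \<Rightarrow> bool" where
  "quaternion_alg A \<longleftrightarrow> hurwitz A \<and> alg_dim A = 4"

definition conjug :: "('f::field, 'v::ab_group_add) nalg \<Rightarrow> 'v \<Rightarrow> 'v" where
  "conjug A x = smul A (polar A x (unity A)) (unity A) - x"

definition petersson ::
  "('f::field, 'v::ab_group_add) nalg \<Rightarrow> ('v \<Rightarrow> 'v) \<Rightarrow> ('f, 'v) nalg" where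
  "petersson C \<tau> = C\<lparr>mul := (\<lambda>x y. mul C (\<tau> (conjug C x)) (\<tau> (\<tau> (conjug C y))))\<rparr>"

definition para_quadratic :: "('f::field, 'v::ab_group_add) nalg \<Rightarrow> bool" where
  "para_quadratic A \<longleftrightarrow>
     (\<exists>H :: ('f, 'v) nalg. quadratic_etale H \<and> isomorphic A (petersson H id))"

definition para_quaternion :: "('f::field, 'v::ab_group_add) nalg \<Rightarrow> bool" where
  "para_quaternion A \<longleftrightarrow>
     (\<exists>H :: ('f, 'v) nalg. quaternion_alg H \<and> isomorphic A (petersson H id))"

section \<open>The split Cayley algebra and Okubo algebras\<close>

text \<open>
  Labels of the canonical basis \<open>e\<^sub>1, e\<^sub>2, u\<^sub>i, v\<^sub>i\<close>. The type \<open>3\<close> is the ring of integers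
  modulo \<open>3\<close>, so index arithmetic is modulo \<open>3\<close>.
\<close>

datatype cayley_ix = CE1 | CE2 | CU "3" | CV "3"

instance cayley_ix :: finite
proof
  have "(UNIV :: cayley_ix set) \<subseteq> {CE1, CE2} \<union> range CU \<union> range CV"
  proof
    fix x :: cayley_ix
    show "x \<in> {CE1, CE2} \<union> range CU \<union> range CV" by (cases x) auto
  qed
  then show "finite (UNIV :: cayley_ix set)"
    by (rule finite_subset) simp
qed

fun cayley_table :: "cayley_ix \<Rightarrow> cayley_ix \<Rightarrow> 'f::field ^ cayley_ix" where
  "cayley_table CE1 CE1 = axis CE1 1"
| "cayley_table CE1 CE2 = 0"
| "cayley_table CE1 (CU i) = axis (CU i) 1"
| "cayley_table CE1 (CV i) = 0"
| "cayley_table CE2 CE1 = 0"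
| "cayley_table CE2 CE2 = axis CE2 1"
| "cayley_table CE2 (CU i) = 0"
| "cayley_table CE2 (CV i) = axis (CV i) 1"
| "cayley_table (CU i) CE1 = 0"
| "cayley_table (CU i) CE2 = axis (CU i) 1"
| "cayley_table (CU i) (CU j) =
     (if j = i + 1 then axis (CV (i + 2)) 1
      else if i = j + 1 then - axis (CV (j + 2)) 1 else 0)"
| "cayley_table (CU i) (CV j) = (if i = j then - axis CE1 1 else 0)"
| "cayley_table (CV i) CE1 = axis (CV i) 1"
| "cayley_table (CV i) CE2 = 0"
| "cayley_table (CV i) (CU j) = (if i = j then - axis CE2 1 else 0)"
| "cayley_table (CV i) (CV j) =
     (if j = i + 1 then axis (CU (i + 2)) 1
      else if i = j + 1 then - axis (CU (j + 2)) 1 else 0)"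

text \<open>
  The norm is the one forced by \<open>x \<cdot> conjug x = n(x) 1\<close>: \<open>e\<^sub>1, e\<^sub>2\<close> and \<open>u\<^sub>i, v\<^sub>i\<close> are
  hyperbolic pairs.
\<close>

definition split_cayley :: "('f::field, 'f ^ cayley_ix) nalg" where
  "split_cayley =
     \<lparr>carr = UNIV,
      smul = (*s),
      mul = (\<lambda>x y. \<Sum>i\<in>UNIV. \<Sum>j\<in>UNIV. (x $ i * y $ j) *s cayley_table i j),
      nrm = (\<lambda>x. x $ CE1 * x $ CE2 + (\<Sum>i\<in>UNIV. x $ CU i * x $ CV i))\<rparr>"

text \<open>
  The linear map fixing \<open>e\<^sub>1, e\<^sub>2\<close> with \<open>u\<^sub>i \<mapsto> u\<^sub>i\<^sub>+\<^sub>1\<close>, \<open>v\<^sub>i \<mapsto> v\<^sub>i\<^sub>+\<^sub>1\<close>; on coordinates the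
  index is therefore shifted by \<open>-1\<close>.
\<close>

definition tau_st :: "'f::field ^ cayley_ix \<Rightarrow> 'f ^ cayley_ix" where
  "tau_st x = (\<chi> k. case k of
     CE1 \<Rightarrow> x $ CE1 | CE2 \<Rightarrow> x $ CE2 | CU i \<Rightarrow> x $ CU (i - 1) | CV i \<Rightarrow> x $ CV (i - 1))"

definition split_okubo :: "('f::field, 'f ^ cayley_ix) nalg" where
  "split_okubo = petersson split_cayley tau_st"

definition field_embedding :: "('f::field \<Rightarrow> 'l::field) \<Rightarrow> bool" where
  "field_embedding h \<longleftrightarrow>
     h 1 = 1 \<and> (\<forall>a b. h (a + b) = h a + h b) \<and> (\<forall>a b. h (a * b) = h a * h b)"

text \<open>
  \<open>B\<close> is the algebra obtained from \<open>A\<close> by extending scalars along the field embedding \<open>h\<close>,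
  with canonical map \<open>\<iota>\<close> (that is, \<open>x \<otimes> c \<mapsto> c \<cdot> \<iota> x\<close> is an isomorphism from the tensor
  product onto \<open>B\<close>): \<open>\<iota>\<close> is \<open>h\<close>-semilinear, respects product and norm, and takes a basis
  of \<open>A\<close> to a basis of \<open>B\<close>.
\<close>

definition scalar_extension ::
  "('f::field \<Rightarrow> 'l::field) \<Rightarrow> ('v \<Rightarrow> 'w) \<Rightarrow>
   ('f, 'v::ab_group_add) nalg \<Rightarrow> ('l, 'w::ab_group_add) nalg \<Rightarrow> bool" where
  "scalar_extension h \<iota> A B \<longleftrightarrow>
     (\<forall>x\<in>carr A. \<forall>y\<in>carr A. \<iota> (x + y) = \<iota> x + \<iota> y) \<and>
     (\<forall>c. \<forall>x\<in>carr A. \<iota> (smul A c x) = smul B (h c) (\<iota> x)) \<and>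
     (\<forall>x\<in>carr A. \<forall>y\<in>carr A. \<iota> (mul A x y) = mul B (\<iota> x) (\<iota> y)) \<and>
     (\<forall>x\<in>carr A. nrm B (\<iota> x) = h (nrm A x)) \<and>
     (\<exists>b. alg_basis A b \<and> inj_on \<iota> b \<and> alg_basis B (\<iota> ` b))"

text \<open>
  \<open>A\<close> becomes isomorphic to the split Okubo algebra after an extension of scalars to (an
  embedding of the base field into) the field \<open>'l\<close>. HOL cannot quantify over the field inside
  the definition; used as a hypothesis with \<open>'l\<close> a type variable, the predicate expresses
  that there is some such field.
\<close>

definition okubo_algebra :: "'l::field itself \<Rightarrow> ('f::field, 'v::ab_group_add) nalg \<Rightarrow> bool" where
  "okubo_algebra _ A \<longleftrightarrow>
     normed_algebra A \<and>
     (\<exists>(h :: 'f \<Rightarrow> 'l) \<iota>. field_embedding h \<and>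
        scalar_extension h \<iota> A (split_okubo :: ('l, 'l ^ cayley_ix) nalg))"

section \<open>Idempotents\<close>

definition idempotent :: "('f::field, 'v::ab_group_add) nalg \<Rightarrow> 'v \<Rightarrow> bool" where
  "idempotent A f \<longleftrightarrow> f \<in> carr A \<and> f \<noteq> 0 \<and> mul A f f = f"

definition centralizer :: "('f::field, 'v::ab_group_add) nalg \<Rightarrow> 'v \<Rightarrow> 'v set" where
  "centralizer A f = {x \<in> carr A. mul A f x = mul A x f}"

definition has_para_quadratic :: "('f::field, 'v::ab_group_add) nalg \<Rightarrow> 'v set \<Rightarrow> bool" where
  "has_para_quadratic A X \<longleftrightarrow>
     (\<exists>S \<subseteq> X. subalgebra A S \<and> para_quadratic (A\<lparr>carr := S\<rparr>))"

definition has_para_quaternion :: "('f::field, 'v::ab_group_add) nalg \<Rightarrow> 'v set \<Rightarrow> bool" where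
  "has_para_quaternion A X \<longleftrightarrow>
     (\<exists>S \<subseteq> X. subalgebra A S \<and> para_quaternion (A\<lparr>carr := S\<rparr>))"

definition quaternionic_idempotent :: "('f::field, 'v::ab_group_add) nalg \<Rightarrow> 'v \<Rightarrow> bool" where
  "quaternionic_idempotent A f \<longleftrightarrow>
     idempotent A f \<and> has_para_quaternion A (centralizer A f)"

definition quadratic_idempotent :: "('f::field, 'v::ab_group_add) nalg \<Rightarrow> 'v \<Rightarrow> bool" where
  "quadratic_idempotent A f \<longleftrightarrow>
     idempotent A f \<and> has_para_quadratic A (centralizer A f) \<and>
     \<not> has_para_quaternion A (centralizer A f)"

definition singular_idempotent :: "('f::field, 'v::ab_group_add) nalg \<Rightarrow> 'v \<Rightarrow> bool" where
  "singular_idempotent A f \<longleftrightarrow>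
     idempotent A f \<and> \<not> quaternionic_idempotent A f \<and> \<not> quadratic_idempotent A f"

definition conj_class :: "('f::field, 'v::ab_group_add) nalg \<Rightarrow> 'v \<Rightarrow> 'v set" where
  "conj_class A e = {\<phi> e | \<phi>. alg_iso A A \<phi>}"

definition cubic_form :: "('f::field, 'v::ab_group_add) nalg \<Rightarrow> 'v \<Rightarrow> 'f" where
  "cubic_form A x = polar A x (mul A x x)"

section \<open>Subfields of cubes\<close>

definition field_cubes :: "'f::field set" where
  "field_cubes = {\<alpha> ^ 3 | \<alpha>. True}"

definition is_subfield :: "'f::field set \<Rightarrow> bool" where
  "is_subfield S \<longleftrightarrow>
     1 \<in> S \<and> (\<forall>x\<in>S. \<forall>y\<in>S. x - y \<in> S \<and> x * y \<in> S) \<and> (\<forall>x\<in>S. inverse x \<in> S)"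

definition cubes_adjoin :: "'f::field \<Rightarrow> 'f set" where
  "cubes_adjoin \<alpha> = is_subfield hull (insert \<alpha> field_cubes)"

text \<open>\<open>V\<close> is a \<open>k\<close>-subspace of dimension \<open>d\<close> of the ambient field.\<close>

definition has_dim_over :: "'f::field set \<Rightarrow> 'f set \<Rightarrow> nat \<Rightarrow> bool" where
  "has_dim_over k V d \<longleftrightarrow>
     (\<exists>B. finite B \<and> card B = d \<and>
        V = {\<Sum>b\<in>B. c b * b | c. \<forall>b\<in>B. c b \<in> k} \<and>
        (\<forall>c. (\<forall>b\<in>B. c b \<in> k) \<and> (\<Sum>b\<in>B. c b * b) = 0 \<longrightarrow> (\<forall>b\<in>B. c b = 0)))"

section \<open>Pairs and the class of a quadratic idempotent\<close>

definition alg_cubes :: "('f::field, 'k::ab_group_add) nalg \<Rightarrow> 'k set" where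
  "alg_cubes K = {mul K b (mul K b b) | b. b \<in> carr K}"

definition etale_pair :: "('f::field, 'k::ab_group_add) nalg \<Rightarrow> 'k \<Rightarrow> bool" where
  "etale_pair K a \<longleftrightarrow> quadratic_etale K \<and> a \<in> carr K \<and> nrm K a = 1"

definition pair_equiv ::
  "('f::field, 'k::ab_group_add) nalg \<Rightarrow> 'k \<Rightarrow> ('f, 'm::ab_group_add) nalg \<Rightarrow> 'm \<Rightarrow> bool" where
  "pair_equiv K a K' a' \<longleftrightarrow>
     (\<exists>\<phi>. alg_iso K K' \<phi> \<and> \<phi> a \<in> {mul K' c a' | c. c \<in> alg_cubes K'})"

definition pair_class ::
  "('f::field, 'k::ab_group_add) nalg \<Rightarrow> 'k \<Rightarrow> (('f, 'k) nalg \<times> 'k) set" where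
  "pair_class K a = {(K', a'). etale_pair K' a' \<and> pair_equiv K a K' a'}"

text \<open>
  The free \<open>K\<close>-module \<open>W\<close> with basis \<open>w\<^sub>1, w\<^sub>2, w\<^sub>3\<close> is \<open>K\<^sup>3\<close>, and \<open>w $ i\<close> is the coordinate
  at \<open>w\<^sub>i\<close>.
\<close>

definition W_carr :: "('f::field, 'k::ab_group_add) nalg \<Rightarrow> ('k ^ 3) set" where
  "W_carr K = {w. \<forall>i. w $ i \<in> carr K}"

definition W_smul :: "('f::field, 'k::ab_group_add) nalg \<Rightarrow> 'k \<Rightarrow> 'k ^ 3 \<Rightarrow> 'k ^ 3" where
  "W_smul K b w = (\<chi> i. mul K b (w $ i))"

definition W_herm :: "('f::field, 'k::ab_group_add) nalg \<Rightarrow> 'k ^ 3 \<Rightarrow> 'k ^ 3 \<Rightarrow> 'k" where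
  "W_herm K x y = - (\<Sum>i\<in>UNIV. \<Sum>j\<in>UNIV - {i}. mul K (x $ i) (conjug K (y $ j)))"

text \<open>The alternating trilinear form with value \<open>a\<close> at \<open>(w\<^sub>1, w\<^sub>2, w\<^sub>3)\<close>: \<open>a\<close> times the determinant.\<close>

definition W_alt ::
  "('f::field, 'k::ab_group_add) nalg \<Rightarrow> 'k \<Rightarrow> 'k ^ 3 \<Rightarrow> 'k ^ 3 \<Rightarrow> 'k ^ 3 \<Rightarrow> 'k" where
  "W_alt K a x y z = mul K a
     (mul K (x $ 1) (mul K (y $ 2) (z $ 3) - mul K (y $ 3) (z $ 2)) +
      mul K (x $ 2) (mul K (y $ 3) (z $ 1) - mul K (y $ 1) (z $ 3)) +
      mul K (x $ 3) (mul K (y $ 1) (z $ 2) - mul K (y $ 2) (z $ 1)))"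

definition W_cross ::
  "('f::field, 'k::ab_group_add) nalg \<Rightarrow> 'k \<Rightarrow> 'k ^ 3 \<Rightarrow> 'k ^ 3 \<Rightarrow> 'k ^ 3" where
  "W_cross K a x y =
     (THE c. c \<in> W_carr K \<and> (\<forall>z\<in>W_carr K. W_herm K z c = W_alt K a z x y))"

text \<open>
  The Cayley algebra on \<open>K \<oplus> W\<close>. Its norm is \<open>n(b + x) = n(b) + \<sigma>(x, x)\<close>, as forced by
  \<open>x \<cdot> conjug x = n(x) 1\<close>; here \<open>\<sigma>(x, x)\<close>, an element of \<open>K\<close>, is a scalar multiple of the unity.
\<close>

definition etale_cayley ::
  "('f::field, 'k::ab_group_add) nalg \<Rightarrow> 'k \<Rightarrow> ('f, 'k \<times> ('k ^ 3)) nalg" where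
  "etale_cayley K a =
     \<lparr>carr = carr K \<times> W_carr K,
      smul = (\<lambda>c (b, x). (smul K c b, \<chi> i. smul K c (x $ i))),
      mul = (\<lambda>(b, x) (c, y).
        (mul K b c - W_herm K x y,
         W_smul K b y + W_smul K (conjug K c) x + W_cross K a x y)),
      nrm = (\<lambda>(b, x). nrm K b + (THE c. smul K c (unity K) = W_herm K x x))\<rparr>"

text \<open>
  The automorphism \<open>\<tau>\<^bsub>K,a\<^esub>\<close>, with \<open>w\<^sub>i \<mapsto> w\<^sub>i\<^sub>+\<^sub>1\<close> (indices modulo \<open>3\<close>). As a map of \<open>K \<oplus> W\<close> it
  does not depend on \<open>a\<close>, which enters through the product of \<open>etale_cayley K a\<close>.
\<close>

definition etale_tau :: "'k \<times> ('k ^ 3) \<Rightarrow> 'k \<times> ('k ^ 3)" where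
  "etale_tau = (\<lambda>(b, x). (b, \<chi> i. x $ (i - 1)))"

definition idem_cayley :: "('f::field, 'v::ab_group_add) nalg \<Rightarrow> 'v \<Rightarrow> ('f, 'v) nalg" where
  "idem_cayley A e = A\<lparr>mul := (\<lambda>x y. mul A (mul A e x) (mul A y e))\<rparr>"

definition idem_tau :: "('f::field, 'v::ab_group_add) nalg \<Rightarrow> 'v \<Rightarrow> 'v \<Rightarrow> 'v" where
  "idem_tau A e x = mul A e (mul A e x)"

text \<open>
  \<open>\<tau>\<^sub>e\<close> and \<open>\<tau>\<^bsub>K,a\<^esub>\<close> are automorphisms of two models of the split Cayley algebra; they are
  conjugate if some isomorphism of the two models carries one to the other.
\<close>

definition tau_conjugate ::
  "('f::field, 'v::ab_group_add) nalg \<Rightarrow> 'v \<Rightarrow> ('f, 'k::ab_group_add) nalg \<Rightarrow> 'k \<Rightarrow> bool" where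
  "tau_conjugate A e K a \<longleftrightarrow>
     (\<exists>\<psi>. alg_iso (idem_cayley A e) (etale_cayley K a) \<psi> \<and>
        (\<forall>x\<in>carr A. \<psi> (idem_tau A e x) = etale_tau (\<psi> x)))"

text \<open>
  The class \<open>[K, a]\<close> of any pair with \<open>\<tau>\<^sub>e\<close> conjugate to \<open>\<tau>\<^bsub>K,a\<^esub>\<close>, as a set of pairs; since it
  is the same for all such pairs, it is rendered as their union.
\<close>

definition idem_class ::
  "('f::field, 'v::ab_group_add) nalg \<Rightarrow> 'v \<Rightarrow> (('f, 'k::ab_group_add) nalg \<times> 'k) set" where
  "idem_class A e = \<Union>{pair_class K a | K a. etale_pair K a \<and> tau_conjugate A e K a}"

text \<open>The quadratic idempotents whose class is of the form \<open>[K, a]\<close> for some \<open>a\<close>.\<close>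

definition quadratic_idempotents_of ::
  "('f::field, 'v::ab_group_add) nalg \<Rightarrow> ('f, 'k::ab_group_add) nalg \<Rightarrow> 'v set" where
  "quadratic_idempotents_of A K =
     {e. quadratic_idempotent A e \<and> (\<exists>a. etale_pair K a \<and> idem_class A e = pair_class K a)}"

end

theory Submission
  imports Defs
begin

text \<open>
  In characteristic \<open>3\<close> the cubic form \<open>g(x) = n(x, x * x)\<close> is additive and
  \<open>g(c x) = c\<^sup>3 g(x)\<close>, so it becomes linear once scalars act on \<open>F\<close> through their cubes. If its
  image has dimension \<open>8\<close> it is injective; but an idempotent \<open>e\<close> gives an isometric automorphism
  \<open>\<tau>\<^sub>e\<close> with \<open>g \<circ> \<tau>\<^sub>e = g\<close>, so \<open>\<tau>\<^sub>e\<close> would be the identity, which forces \<open>g\<close> to vanish on the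
  orthogonal complement of \<open>e\<close>.

  Two isotropic orthogonal elements \<open>x, w\<close> with \<open>w * x = 0\<close> and \<open>g(x), g(w) \<noteq> 0\<close> generate the
  algebra, and its whole multiplication table is determined by \<open>g(x)\<close> and \<open>g(w)\<close>. If \<open>g\<close> has image
  \<open>F\<^sup>3(t)\<close> with \<open>t\<close> not a cube, the pair can be chosen with \<open>g(x) = t\<close> and \<open>g(w) = 1\<close>; hence the
  algebra is the Petersson algebra of \<open>\<tau>\<^bsub>K,a\<^esub>\<close> for every \<open>(K, a)\<close> with \<open>a + conjug a\<close> generating the
  same field, which produces an idempotent of class \<open>[K, a]\<close>. It is unique: idempotents of the same
  class are conjugate, they lie on the orthogonal complement of the kernel of \<open>g\<close>, and automorphisms
  fix that complement pointwise because they preserve \<open>g\<close>.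

  The split Okubo algebra is written on the Cayley-Dickson double of the \<open>2 \<times> 2\<close> matrices, where
  the idempotents are the elements \<open>(1 + p, r)\<close> with \<open>p\<close> nilpotent and the second row of \<open>r\<close> zero.
  Explicit automorphisms bring them to \<open>(1, 0)\<close>, \<open>(1 + \<mu> E\<^sub>1\<^sub>2, 0)\<close> or \<open>(1, E\<^sub>1\<^sub>1)\<close>: the
  quaternionic idempotent, the quadratic ones, whose etale algebra is \<open>F[z] / (z\<^sup>2 + \<mu>)\<close>, and the
  singular ones.
\<close>

section \<open>Symmetric composition algebras of dimension 8 in characteristic 3\<close>

text \<open>An Okubo algebra is given only through a scalar extension. What descends to it are the
  symmetric composition laws
  \<open>(x \<star> y) \<star> x = n(x) y = x \<star> (y \<star> x)\<close>, associativity and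
  nonsingularity of the polar form, and the dimension; the locale \<open>symcomp\<close> collects
  these and everything else is derived from them. Idempotents come from the kernel of
  \<open>g\<close>: if \<open>g(z) = 0\<close> and \<open>n(z) \<noteq> 0\<close>, then
  \<open>z \<star> z\<close> is a multiple of an idempotent. When the image of \<open>g\<close> is
  \<open>F^3(t)\<close> with \<open>t\<close> not a cube, this kernel has dimension 5 and is too
  large to be totally isotropic in a nonsingular quadratic space of dimension 8. The condition that
  \<open>a\<close> is not in \<open>K^3\<close> acts through the trace: an element of norm one is a
  cube in \<open>K\<close> exactly when its trace is a cube in \<open>F\<close>, and otherwise
  \<open>1\<close>, \<open>t\<close>, \<open>t^2\<close>, with \<open>t\<close> the trace, are
  independent over \<open>F^3\<close>. The isomorphism between the Petersson model and the matrix
  model is obtained by recognising in both an isotropic pair with the same values of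
  \<open>g\<close>. It does not show which idempotents correspond; this is recovered from the norm
  on the centralizer and from para-quaternion subalgebras.\<close>

locale normed_alg =
  fixes A :: "('f::field, 'v::ab_group_add) nalg"
  assumes na: "normed_algebra A"
begin

abbreviation mult (infixl "\<star>" 70) where "x \<star> y \<equiv> mul A x y"
abbreviation scal (infixr "\<bullet>\<^sub>s" 75) where "c \<bullet>\<^sub>s x \<equiv> smul A c x"
abbreviation N where "N x \<equiv> nrm A x"
abbreviation B where "B x y \<equiv> polar A x y"
abbreviation C where "C \<equiv> carr A"

sublocale vector_space "smul A"
  using na by (simp add: normed_algebra_def)

lemma subC: "subspace C"
  using na by (simp add: normed_algebra_def)

lemma C_add[simp]: "x \<in> C \<Longrightarrow> y \<in> C \<Longrightarrow> x + y \<in> C"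
  and C_zero[simp]: "0 \<in> C"
  and C_diff[simp]: "x \<in> C \<Longrightarrow> y \<in> C \<Longrightarrow> x - y \<in> C"
  and C_neg[simp]: "x \<in> C \<Longrightarrow> - x \<in> C"
  and C_scal[simp]: "x \<in> C \<Longrightarrow> c \<bullet>\<^sub>s x \<in> C"
  using subC by (auto simp: subspace_add subspace_0 subspace_diff subspace_neg subspace_scale)

text \<open>A vector of \<open>C\<close> outside \<open>span b\<close> would enlarge
  \<open>b\<close> to an independent set of \<open>n + 1\<close> elements inside the span of at most
  \<open>n\<close>. The bound concerns the carrier, as the ambient type may have infinite
  dimension.\<close>

lemma span_eq_carrier:
  assumes S: "finite S" "card S \<le> n" "span S = C"
    and b: "independent b" "b \<subseteq> C" "card b = n"
  shows "span b = C"
proof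
  show "span b \<subseteq> C" using b subC by (intro span_minimal)
  have fin: "finite b" using independent_span_bound[OF S(1) b(1)] b(2) S(3) by simp
  show "C \<subseteq> span b"
  proof (rule ccontr)
    assume "\<not> C \<subseteq> span b"
    then obtain a where a: "a \<in> C" "a \<notin> span b" by auto
    then have "card (insert a b) \<le> card S"
      using independent_span_bound[OF S(1), of "insert a b"] b S(3) independent_insertI by auto
    moreover have "a \<notin> b" using a span_base by auto
    ultimately show False using fin b(3) S(2) by simp
  qed
qed

lemma C_mult[simp]: "x \<in> C \<Longrightarrow> y \<in> C \<Longrightarrow> x \<star> y \<in> C"
  using na by (simp add: normed_algebra_def bilinear_mul_def)

lemma mult_add_left[simp]: "x \<in> C \<Longrightarrow> y \<in> C \<Longrightarrow> z \<in> C \<Longrightarrow> (x + y) \<star> z = x \<star> z + y \<star> z"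
  and mult_add_right[simp]: "x \<in> C \<Longrightarrow> y \<in> C \<Longrightarrow> z \<in> C \<Longrightarrow> z \<star> (x + y) = z \<star> x + z \<star> y"
  and mult_scal_left[simp]: "x \<in> C \<Longrightarrow> y \<in> C \<Longrightarrow> (c \<bullet>\<^sub>s x) \<star> y = c \<bullet>\<^sub>s (x \<star> y)"
  and mult_scal_right[simp]: "x \<in> C \<Longrightarrow> y \<in> C \<Longrightarrow> x \<star> (c \<bullet>\<^sub>s y) = c \<bullet>\<^sub>s (x \<star> y)"
  using na by (simp_all add: normed_algebra_def bilinear_mul_def)

lemma mult_zero_left[simp]: "x \<in> C \<Longrightarrow> 0 \<star> x = 0"
  and mult_zero_right[simp]: "x \<in> C \<Longrightarrow> x \<star> 0 = 0"
  using mult_scal_left[of x x 0] mult_scal_right[of x x 0] by simp_all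

lemma mult_neg_left[simp]: "x \<in> C \<Longrightarrow> y \<in> C \<Longrightarrow> (- x) \<star> y = - (x \<star> y)"
  and mult_neg_right[simp]: "x \<in> C \<Longrightarrow> y \<in> C \<Longrightarrow> x \<star> (- y) = - (x \<star> y)"
  using mult_scal_left[of x y "-1"] mult_scal_right[of x y "-1"] by simp_all

lemma mult_diff_left[simp]: "x \<in> C \<Longrightarrow> y \<in> C \<Longrightarrow> z \<in> C \<Longrightarrow> (x - y) \<star> z = x \<star> z - y \<star> z"
  and mult_diff_right[simp]: "x \<in> C \<Longrightarrow> y \<in> C \<Longrightarrow> z \<in> C \<Longrightarrow> z \<star> (x - y) = z \<star> x - z \<star> y"
  using mult_add_left[of x "- y" z] mult_add_right[of x "- y" z] by simp_all

lemma N_scal[simp]: "x \<in> C \<Longrightarrow> N (c \<bullet>\<^sub>s x) = c^2 * N x"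
  using na by (simp add: normed_algebra_def quadratic_nrm_def)

lemma B_sym: "B x y = B y x"
  by (simp add: polar_def add.commute)

lemma B_add_left[simp]: "x \<in> C \<Longrightarrow> y \<in> C \<Longrightarrow> z \<in> C \<Longrightarrow> B (x + y) z = B x z + B y z"
  and B_scal_left[simp]: "x \<in> C \<Longrightarrow> y \<in> C \<Longrightarrow> B (c \<bullet>\<^sub>s x) y = c * B x y"
  using na by (simp_all add: normed_algebra_def quadratic_nrm_def)

lemma B_add_right[simp]: "x \<in> C \<Longrightarrow> y \<in> C \<Longrightarrow> z \<in> C \<Longrightarrow> B z (x + y) = B z x + B z y"
  and B_scal_right[simp]: "x \<in> C \<Longrightarrow> y \<in> C \<Longrightarrow> B x (c \<bullet>\<^sub>s y) = c * B x y"
  using B_add_left[of x y z] B_scal_left[of y x c] by (simp_all only: B_sym[of z] B_sym[of x "c \<bullet>\<^sub>s y"] B_sym[of x y])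

lemma B_zero_left[simp]: "x \<in> C \<Longrightarrow> B 0 x = 0"
  and B_zero_right[simp]: "x \<in> C \<Longrightarrow> B x 0 = 0"
  using B_scal_left[of x x 0] B_scal_right[of x x 0] by simp_all

lemma B_neg_left[simp]: "x \<in> C \<Longrightarrow> y \<in> C \<Longrightarrow> B (- x) y = - B x y"
  and B_neg_right[simp]: "x \<in> C \<Longrightarrow> y \<in> C \<Longrightarrow> B x (- y) = - B x y"
  using B_scal_left[of x y "-1"] B_scal_right[of x y "-1"] by simp_all

lemma B_diff_left[simp]: "x \<in> C \<Longrightarrow> y \<in> C \<Longrightarrow> z \<in> C \<Longrightarrow> B (x - y) z = B x z - B y z"
  and B_diff_right[simp]: "x \<in> C \<Longrightarrow> y \<in> C \<Longrightarrow> z \<in> C \<Longrightarrow> B z (x - y) = B z x - B z y"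
  using B_add_left[of x "- y" z] B_add_right[of x "- y" z] by simp_all

lemma N_zero[simp]: "N 0 = 0"
  using N_scal[of 0 0] by simp

lemma N_neg[simp]: "x \<in> C \<Longrightarrow> N (- x) = N x"
  using N_scal[of x "-1"] by simp

lemma N_add: "N (x + y) = N x + N y + B x y"
  by (simp add: polar_def)

lemma N_diff: "x \<in> C \<Longrightarrow> y \<in> C \<Longrightarrow> N (x - y) = N x + N y - B x y"
  using N_add[of x "- y"] by simp

lemma B_self: "x \<in> C \<Longrightarrow> B x x = 2 * N x"
  using N_scal[of x "1 + 1"] by (simp only: polar_def scale_left_distrib scale_one power2_eq_square)
    (simp add: algebra_simps)

text \<open>The functional \<open>B d\<close> separates \<open>a\<close> from \<open>S\<close>.
  Independence of a family that has a dual family is proved by going through it with this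
  lemma.\<close>

lemma notin_span: assumes "d \<in> C" "S \<subseteq> C" "\<And>s. s \<in> S \<Longrightarrow> B d s = 0" "B d a \<noteq> 0"
  shows "a \<notin> span S"
proof
  assume "a \<in> span S"
  then have "a \<in> C \<and> B d a = 0"
  proof (induction rule: span_induct_alt)
    case (step c u z) then show ?case using assms by (auto simp: subset_iff)
  qed (use assms in auto)
  then show False using assms by simp
qed

end

text \<open>The assumptions are identities, nondegeneracy and a dimension bound, so that they pass
  through isomorphisms and descend along scalar extensions. Multiplicativity of the norm is a
  consequence, \<open>N_mult\<close>.\<close>

locale symcomp = normed_alg A for A :: "('f::field, 'v::ab_group_add) nalg" +
  assumes char3: "(3::'f) = 0"
    and flexl: "\<And>x y. x \<in> C \<Longrightarrow> y \<in> C \<Longrightarrow> (x \<star> y) \<star> x = N x \<bullet>\<^sub>s y"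
    and flexr: "\<And>x y. x \<in> C \<Longrightarrow> y \<in> C \<Longrightarrow> x \<star> (y \<star> x) = N x \<bullet>\<^sub>s y"
    and assoc: "\<And>x y z. x \<in> C \<Longrightarrow> y \<in> C \<Longrightarrow> z \<in> C \<Longrightarrow> B (x \<star> y) z = B x (y \<star> z)"
    and nonsing: "\<And>x. x \<in> C \<Longrightarrow> (\<And>y. y \<in> C \<Longrightarrow> B x y = 0) \<Longrightarrow> x = 0"
    and dim8: "\<exists>S. finite S \<and> card S \<le> 8 \<and> span S = C"
begin

abbreviation g where "g x \<equiv> cubic_form A x"

lemma two: "(2::'f) = - 1"
  using char3 by (simp add: eq_neg_iff_add_eq_0)

lemma B_N: "x \<in> C \<Longrightarrow> B x x = - N x"
  by (simp add: B_self two)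

lemma triple: "x + (x + (x + y)) = (y::'v)"
proof -
  have "x + (x + (x + y)) = 3 \<bullet>\<^sub>s x + y"
    using scale_left_distrib[of 1 "1+1" x] scale_left_distrib[of 1 "1" x] by (simp add: add.assoc)
  then show ?thesis by (simp add: char3)
qed

lemma triple0: "x + (x + x) = (0::'v)"
  using triple[of x 0] by simp

lemma ftriple: "x + (x + (x + y)) = (y::'f)"
proof -
  have "x + (x + (x + y)) = 3 * x + y" by simp
  then show ?thesis by (simp add: char3)
qed

lemma ftriple0: "x + (x + x) = (0::'f)"
  using ftriple[of x 0] by simp

lemma fneg_double: "- x = x + (x::'f)"
  by (simp only: neg_eq_iff_add_eq_0 ftriple0)

lemma flexl_lin: assumes "x \<in> C" "y \<in> C" "z \<in> C"
  shows "(x \<star> y) \<star> z = B x z \<bullet>\<^sub>s y - (z \<star> y) \<star> x"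
proof -
  have "((x + z) \<star> y) \<star> (x + z) = N (x + z) \<bullet>\<^sub>s y" using assms by (intro flexl) auto
  then show ?thesis using assms flexl[of x y] flexl[of z y]
    by (simp add: N_add scale_left_distrib) (simp add: algebra_simps)
qed

lemma flexr_lin: assumes "x \<in> C" "y \<in> C" "z \<in> C"
  shows "x \<star> (y \<star> z) = B x z \<bullet>\<^sub>s y - z \<star> (y \<star> x)"
proof -
  have "(x + z) \<star> (y \<star> (x + z)) = N (x + z) \<bullet>\<^sub>s y" using assms by (intro flexr) auto
  then show ?thesis using assms flexr[of x y] flexr[of z y]
    by (simp add: N_add scale_left_distrib) (simp add: algebra_simps)
qed

text \<open>The element \<open>((x \<star> y) \<star> x) \<star> (x \<star> y)\<close> is
  \<open>N (x \<star> y)\<close> times \<open>x\<close> by flexibility in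
  \<open>x \<star> y\<close>, and \<open>N x * N y\<close> times \<open>x\<close> by flexibility in
  \<open>x\<close> and then in \<open>y\<close>.\<close>

lemma N_mult: assumes "x \<in> C" "y \<in> C" shows "N (x \<star> y) = N x * N y"
proof (cases "x = 0")
  case False
  have "N (x \<star> y) \<bullet>\<^sub>s x = ((x \<star> y) \<star> x) \<star> (x \<star> y)" using assms by (intro flexl[symmetric]) auto
  also have "\<dots> = (N x * N y) \<bullet>\<^sub>s x" using assms by (simp add: flexl[of x y] flexr[of y x])
  finally show ?thesis using False by simp
qed (use assms in simp)

lemma B_mult_left: assumes "x \<in> C" "y \<in> C" "z \<in> C" shows "B (x \<star> y) (x \<star> z) = N x * B y z"
proof -
  have "B (x \<star> y) (x \<star> z) = N (x \<star> (y + z)) - N (x \<star> y) - N (x \<star> z)"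
    using assms by (simp add: polar_def)
  also have "\<dots> = N x * N (y + z) - N x * N y - N x * N z"
    using assms by (simp only: N_mult C_add)
  finally show ?thesis by (simp add: polar_def right_diff_distrib)
qed

lemma B_mult_right: assumes "x \<in> C" "y \<in> C" "z \<in> C" shows "B (y \<star> x) (z \<star> x) = N x * B y z"
proof -
  have "B (y \<star> x) (z \<star> x) = N ((y + z) \<star> x) - N (y \<star> x) - N (z \<star> x)"
    using assms by (simp add: polar_def)
  also have "\<dots> = N (y + z) * N x - N y * N x - N z * N x"
    using assms by (simp only: N_mult C_add)
  finally show ?thesis by (simp add: polar_def right_diff_distrib mult.commute)
qed

lemma sq_sq: assumes "x \<in> C"
  shows "(x \<star> x) \<star> (x \<star> x) = g x \<bullet>\<^sub>s x - N x \<bullet>\<^sub>s (x \<star> x)"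
  using assms flexl_lin[of x x "x \<star> x"] flexl[of x x] by (simp add: cubic_form_def flexl)

lemma g_scal: "x \<in> C \<Longrightarrow> g (c \<bullet>\<^sub>s x) = c^3 * g x"
  by (simp add: cubic_form_def power3_eq_cube)

text \<open>Each mixed term of \<open>g (x + y)\<close> occurs three times by associativity of the polar form.\<close>

lemma g_add: assumes "x \<in> C" "y \<in> C" shows "g (x + y) = g x + g y"
proof -
  have a: "B x (x \<star> y) = B y (x \<star> x)" if "x \<in> C" "y \<in> C" for x y
    using assoc[of x x y] that B_sym[of y "x \<star> x"] by simp
  have b: "B x (y \<star> x) = B y (x \<star> x)" if "x \<in> C" "y \<in> C" for x y
    using assoc[of x y x] that B_sym[of x "x \<star> y"] a[of x y] by simp
  have "g (x + y) = g x + g y + (B y (x \<star> x) + (B y (x \<star> x) + B y (x \<star> x)))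
    + (B x (y \<star> y) + (B x (y \<star> y) + B x (y \<star> y)))"
    using assms by (simp add: cubic_form_def a[of x y] a[of y x] b[of x y] b[of y x])
  then show ?thesis by (simp only: ftriple0 add_0_right)
qed

lemma g_zero[simp]: "g 0 = 0" by (simp add: cubic_form_def)

lemma g_neg: "x \<in> C \<Longrightarrow> g (- x) = - g x"
  using g_scal[of x "-1"] by simp

lemma g_diff: "x \<in> C \<Longrightarrow> y \<in> C \<Longrightarrow> g (x - y) = g x - g y"
  using g_add[of x "- y"] g_neg[of y] by simp

lemma g_sq: assumes "x \<in> C" shows "g (x \<star> x) = (g x)^2 + (N x)^3"
  using assms by (simp add: cubic_form_def[of A "x \<star> x"] sq_sq B_N N_mult)
    (simp add: cubic_form_def B_sym power2_eq_square power3_eq_cube)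

text \<open>For \<open>g z = 0\<close>, \<open>sq_sq\<close> says that the square of
  \<open>z \<star> z\<close> is \<open>- N z\<close> times \<open>z \<star> z\<close>, and the
  scalar normalizes this factor to one. Contrapositively, without idempotents the norm vanishes on
  the kernel of \<open>g\<close>.\<close>

lemma idem_of_trace_zero: assumes "z \<in> C" "g z = 0" "N z \<noteq> 0"
  shows "idempotent A (- (1 / N z) \<bullet>\<^sub>s (z \<star> z))"
  unfolding idempotent_def
proof (intro conjI)
  have "N (z \<star> z) \<noteq> 0" using assms by (simp add: N_mult)
  then have "z \<star> z \<noteq> 0" by auto
  then show "- (1 / N z) \<bullet>\<^sub>s (z \<star> z) \<noteq> 0" using assms by simp
  show "- (1 / N z) \<bullet>\<^sub>s (z \<star> z) \<star> - (1 / N z) \<bullet>\<^sub>s (z \<star> z) = - (1 / N z) \<bullet>\<^sub>s (z \<star> z)"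
    using assms by (simp add: sq_sq)
qed (use assms in simp)

end

section \<open>Okubo algebras generated by an isotropic pair\<close>

locale okubo_pair = symcomp A for A :: "('f::field, 'v::ab_group_add) nalg" +
  fixes x w :: 'v and \<alpha> \<beta> :: 'f
  assumes xC[simp]: "x \<in> C" and wC[simp]: "w \<in> C"
    and Nx[simp]: "N x = 0" and Nw[simp]: "N w = 0" and Bxw: "B x w = 0"
    and wx[simp]: "w \<star> x = 0" and gx: "g x = \<alpha>" and gw: "g w = \<beta>"
begin

text \<open>With \<open>x\<close> in degree \<open>(1,0)\<close> and \<open>w\<close> in degree
  \<open>(0,1)\<close>, these elements occupy the eight nonzero degrees of a grading by pairs of
  integers modulo 3: every product below is zero or lies in the sum of the degrees, and
  \<open>B\<close> pairs opposite degrees only.\<close>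

definition "y = x \<star> x"
definition "v = w \<star> w"
definition "k = x \<star> w"
definition "l = k \<star> w"
definition "m = x \<star> k"
definition "j = y \<star> v"

lemma yC[simp]: "y \<in> C" and vC[simp]: "v \<in> C" and kC[simp]: "k \<in> C"
  and lC[simp]: "l \<in> C" and mC[simp]: "m \<in> C" and jC[simp]: "j \<in> C"
  by (simp_all add: y_def v_def k_def l_def m_def j_def)

lemma Ny[simp]: "N y = 0" and Nv[simp]: "N v = 0" and Nk[simp]: "N k = 0"
  and Nl[simp]: "N l = 0" and Nm[simp]: "N m = 0" and Nj[simp]: "N j = 0"
  by (simp_all add: y_def v_def k_def l_def m_def j_def N_mult)

lemma xx: "x \<star> x = y" and ww: "w \<star> w = v" and xw: "x \<star> w = k" and kw: "k \<star> w = l"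
  and xk: "x \<star> k = m" and yv: "y \<star> v = j"
  by (simp_all add: y_def v_def k_def l_def m_def j_def)

lemma Bself[simp]: "B x x = 0" "B y y = 0" "B w w = 0" "B v v = 0" "B k k = 0" "B j j = 0"
  "B l l = 0" "B m m = 0"
  by (simp_all add: B_N)

lemma Bxy: "B x y = \<alpha>" and Bwv: "B w v = \<beta>"
  using gx gw by (simp_all add: cubic_form_def xx ww)

lemma xy: "x \<star> y = 0" and yx: "y \<star> x = 0" and wv: "w \<star> v = 0" and vw: "v \<star> w = 0"
  using flexr[of x x] flexl[of x x] flexr[of w w] flexl[of w w] by (simp_all add: xx ww)

lemma yy: "y \<star> y = \<alpha> \<bullet>\<^sub>s x" and vv: "v \<star> v = \<beta> \<bullet>\<^sub>s w"
  using sq_sq[of x] sq_sq[of w] by (simp_all add: xx ww gx gw)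

lemma kx: "k \<star> x = 0" and wk: "w \<star> k = 0"
  using flexl[of x w] flexr[of w x] by (simp_all add: xw)

text \<open>The rest of the table is filled mostly by linearized flexibility: each instance trades a
  product for its mirror image and a value of \<open>B\<close>, and the entries are ordered so that
  the other side is already known.\<close>

lemma wy: "w \<star> y = - m"
  using flexr_lin[of w x x] by (simp add: xw xk xx B_sym[of w x] Bxw)

lemma vx: "v \<star> x = - l"
  using flexl_lin[of w w x] by (simp add: xw kw ww B_sym[of w x] Bxw)

lemma yw: "y \<star> w = 0"
  using flexl_lin[of x x w] by (simp add: xx Bxw)

lemma xv: "x \<star> v = 0"
  using flexr_lin[of x w w] by (simp add: ww Bxw)

lemma Bwy: "B w y = 0"
  using assoc[of w x x] by (simp add: xx)

lemma Bkw: "B k w = 0"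
  using assoc[of w x w] by (simp add: xw B_sym)

lemma Bxv: "B x v = 0"
  using assoc[of x w w] by (simp add: xw ww Bkw)

lemma vy: "v \<star> y = 0"
  using flexl_lin[of w w y] by (simp add: ww Bwy yw)

lemma lx: "l \<star> x = j"
  using flexl_lin[of x x v] by (simp add: xx yv Bxv vx)

lemma Bxk: "B x k = 0"
  using assoc[of x x w] Bwy by (simp add: xx xw B_sym)

lemma ky: "k \<star> y = \<alpha> \<bullet>\<^sub>s w"
  using flexl_lin[of x w y] by (simp add: xw Bxy yw)

lemma xm: "x \<star> m = - \<alpha> \<bullet>\<^sub>s w"
  using flexr_lin[of x x k] by (simp add: xk Bxk xx ky)

lemma xl: "x \<star> l = 0"
  using flexr_lin[of x k w] by (simp add: kw Bxw kx)

lemma Bxl: "B x l = 0"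
  using assoc[of k w x] by (simp add: kw B_sym)

lemma xj: "x \<star> j = 0"
  using flexr_lin[of x y v] by (simp add: yv Bxv yx)

lemma yl: "y \<star> l = - (\<alpha> \<bullet>\<^sub>s v)"
  using flexr_lin[of y v x] by (simp add: vx vy B_sym[of y x] Bxy) (metis add.inverse_inverse)

lemma jx: "j \<star> x = \<alpha> \<bullet>\<^sub>s v"
  using flexl_lin[of l x x] by (simp add: lx xx B_sym[of l x] Bxl yl)

lemma mx: "m \<star> x = 0"
  using flexl[of x k] by (simp add: xk)

lemma wl: "w \<star> l = 0"
  using flexr[of w k] by (simp add: kw)

lemma wm: "w \<star> m = j"
  using flexr_lin[of w w y] by (simp add: wy Bwy ww yv)

lemma vk: "v \<star> k = \<beta> \<bullet>\<^sub>s x"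
  using flexr_lin[of v x w] by (simp add: xw B_sym[of v w] Bwv xv)

lemma lw: "l \<star> w = - \<beta> \<bullet>\<^sub>s x"
  using flexl_lin[of k w w] by (simp add: kw Bkw ww vk)

lemma Bwm: "B w m = 0"
  using assoc[of w x k] by (simp add: xk)

lemma Bkl: "B k l = 0"
  using assoc[of k w k] Bkw by (simp add: kw wk B_sym)

lemma mv: "m \<star> v = - \<beta> \<bullet>\<^sub>s y"
  using flexl_lin[of x k v] by (simp add: xk Bxv vk xx)

lemma wj: "w \<star> j = \<beta> \<bullet>\<^sub>s y"
  using flexr_lin[of w w m] by (simp add: wm Bwm ww mv)

lemma mw: "m \<star> w = 0"
  using flexl[of w y] by (simp add: wy)

lemma jw: "j \<star> w = 0"
  using flexl[of w m] by (simp add: wm)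

lemma yk: "y \<star> k = 0"
  using flexr_lin[of y x w] by (simp add: xw B_sym[of y w] Bwy xy)

lemma Bkj: "B k j = \<alpha> * \<beta>"
  using assoc[of k y v] by (simp add: ky yv Bwv)

lemma Blm: "B l m = \<alpha> * \<beta>"
  using assoc[of k w m] by (simp add: kw wm Bkj)

lemma Bxm: "B x m = 0" using assoc[of x x k] assoc[of y x w]
  by (simp add: xx xk xw yx)

lemma Bxj: "B x j = 0" using assoc[of x y v] by (simp add: yv xy)
lemma Byv: "B y v = 0" using assoc[of x x v] by (simp add: xx xv)
lemma Byk: "B y k = 0" using assoc[of y x w] by (simp add: yx xw)
lemma Byl: "B y l = 0" using assoc[of y k w] by (simp add: yk kw)
lemma Bym: "B y m = 0" using B_mult_left[of x x k] by (simp add: xx xk)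
lemma Byj: "B y j = 0" using assoc[of y y v] by (simp add: yy yv Bxv)
lemma Bwl: "B w l = 0" using assoc[of w k w] by (simp add: kw wk)
lemma Bwj: "B w j = 0" using assoc[of w l x] by (simp add: lx wl)
lemma Bvl: "B v l = 0" using assoc[of w w l] by (simp add: ww wl)
lemma Bvk: "B v k = 0" using assoc[of v x w] Bwl by (simp add: xw vx B_sym)
lemma Bvm: "B v m = 0" using assoc[of v x k] Bkl by (simp add: xk vx B_sym)
lemma Bvj: "B v j = 0" using assoc[of v y v] by (simp add: yv vy)
lemma Bkm: "B k m = 0" using assoc[of k x k] by (simp add: xk kx)
lemma Bjl: "B j l = 0" using assoc[of l x l] by (simp add: lx xl)
lemma Bmj: "B m j = 0" using assoc[of m w m] by (simp add: mw wm)

lemmas Btab = Bxy Bxw Bxv Bxk Bxj Bxl Bxm Bwy Byv Byk Byj Byl Bym Bwv Bkw Bwj Bwl Bwm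
  Bvk Bvj Bvl Bvm Bkj Bkl Bkm Bjl Bmj Blm
lemmas Btab' = Btab[THEN trans[OF B_sym]]

definition cmb :: "'f \<Rightarrow> 'f \<Rightarrow> 'f \<Rightarrow> 'f \<Rightarrow> 'f \<Rightarrow> 'f \<Rightarrow> 'f \<Rightarrow> 'f \<Rightarrow> 'v" where
  "cmb a b c d p q r s = a \<bullet>\<^sub>s x + b \<bullet>\<^sub>s y + c \<bullet>\<^sub>s w + d \<bullet>\<^sub>s v + p \<bullet>\<^sub>s k + q \<bullet>\<^sub>s j + r \<bullet>\<^sub>s l + s \<bullet>\<^sub>s m"

lemma cmbC[simp]: "cmb a b c d p q r s \<in> C" by (simp add: cmb_def)

text \<open>Multiplication of a general element is tabulated for the two generators;
  \<open>okubo_pair_iso\<close> extends compatibility from them to all products.\<close>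

lemma x_cmb: "x \<star> cmb a b c d p q r s = cmb 0 a (- \<alpha> * s) 0 c 0 0 p"
  by (simp add: cmb_def xx xy xw xv xk xj xl xm algebra_simps)

lemma cmb_x: "cmb a b c d p q r s \<star> x = cmb 0 a 0 (\<alpha> * q) 0 r (- d) 0"
  by (simp add: cmb_def xx yx vx kx jx lx mx algebra_simps)

lemma w_cmb: "w \<star> cmb a b c d p q r s = cmb 0 (\<beta> * q) 0 c 0 s 0 (- b)"
  by (simp add: cmb_def wy ww wv wk wj wl wm algebra_simps)

lemma cmb_w: "cmb a b c d p q r s \<star> w = cmb (- \<beta> * r) 0 0 c a 0 p 0"
  by (simp add: cmb_def xw yw ww vw kw jw lw mw algebra_simps)

lemma B_cmb: "B (cmb a b c d p q r s) (cmb a' b' c' d' p' q' r' s') =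
  \<alpha> * (a * b' + b * a') + \<beta> * (c * d' + d * c') + \<alpha> * \<beta> * (p * q' + q * p' + r * s' + s * r')"
  by (simp add: cmb_def Btab Btab' algebra_simps)

lemma N_cmb: "N (cmb a b c d p q r s) = \<alpha> * a * b + \<beta> * c * d + \<alpha> * \<beta> * (p * q + r * s)"
  by (simp add: cmb_def N_add Btab Btab' algebra_simps)

context
  assumes nz: "\<alpha> \<noteq> 0" "\<beta> \<noteq> 0"
begin

text \<open>The family splits into the hyperbolic pairs \<open>x, y\<close> and \<open>w, v\<close>
  and \<open>k, j\<close> and \<open>l, m\<close>, with values \<open>\<alpha>\<close>,
  \<open>\<beta>\<close>, \<open>\<alpha> * \<beta>\<close>, \<open>\<alpha> * \<beta>\<close>;
  pairing with its partner separates each vector from the rest.\<close>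

lemma indep: "independent {x,y,w,v,k,j,l,m}" and card8: "card {x,y,w,v,k,j,l,m} = 8"
proof -
  have a: "x \<notin> span {y,w,v,k,j,l,m}" "y \<notin> span {w,v,k,j,l,m}" "w \<notin> span {v,k,j,l,m}"
    "v \<notin> span {k,j,l,m}" "k \<notin> span {j,l,m}" "j \<notin> span {l,m}" "l \<notin> span {m}" "m \<notin> span {}"
    by (rule notin_span[of y] notin_span[of x] notin_span[of v] notin_span[of w]
       notin_span[of j] notin_span[of k] notin_span[of m] notin_span[of l]; use nz in \<open>auto simp: Btab Btab'\<close>; fail)+
  then have b: "x \<notin> {y,w,v,k,j,l,m}" "y \<notin> {w,v,k,j,l,m}" "w \<notin> {v,k,j,l,m}"
    "v \<notin> {k,j,l,m}" "k \<notin> {j,l,m}" "j \<notin> {l,m}" "l \<notin> {m}"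
    by (meson span_base)+
  show "independent {x,y,w,v,k,j,l,m}"
    using a by (simp only: independent_insert[of _ "{}"] independent_insert b if_False independent_empty) simp
  show "card {x,y,w,v,k,j,l,m} = 8" using b by simp
qed

lemma span8: "span {x,y,w,v,k,j,l,m} = C"
  using dim8 span_eq_carrier[OF _ _ _ indep _ card8] by auto

text \<open>Each coordinate is read off against the hyperbolic partner. What remains of
  \<open>u\<close> is orthogonal to the eight vectors, hence to \<open>C\<close>, hence
  zero.\<close>

lemma ex_cmb: assumes "u \<in> C"
  shows "u = cmb (B y u / \<alpha>) (B x u / \<alpha>) (B v u / \<beta>) (B w u / \<beta>)
    (B j u / (\<alpha> * \<beta>)) (B k u / (\<alpha> * \<beta>)) (B m u / (\<alpha> * \<beta>)) (B l u / (\<alpha> * \<beta>))" (is "u = ?u")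
proof -
  have b: "\<forall>b\<in>{x,y,w,v,k,j,l,m}. B b (u - ?u) = 0"
    using assms nz by (simp add: cmb_def Btab Btab')
  have "B b (u - ?u) = 0" if "b \<in> span {x,y,w,v,k,j,l,m}" for b
  proof -
    from that have "b \<in> C \<and> B b (u - ?u) = 0"
    proof (induction rule: span_induct_alt)
      case (step c s t)
      have s: "s \<in> C" "B s (u - ?u) = 0" using step(1) b by auto
      have "B (c \<bullet>\<^sub>s s + t) (u - ?u) = c * B s (u - ?u) + B t (u - ?u)"
        using step s assms by (simp only: B_add_left B_scal_left C_scal C_diff cmbC)
      then show ?case using step s by simp
    qed (use assms in auto)
    then show ?thesis by simp
  qed
  then have "u - ?u = 0" using assms by (intro nonsing) (simp_all add: span8 B_sym)
  then show ?thesis by simp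
qed

lemma cmb_exE: assumes "u \<in> C" obtains a b c d p q r s where "u = cmb a b c d p q r s"
  using ex_cmb[OF assms] by blast

end

lemma B_gen_cmb:
  "B y (cmb a b c d p q r s) = \<alpha> * a" "B x (cmb a b c d p q r s) = \<alpha> * b"
  "B v (cmb a b c d p q r s) = \<beta> * c" "B w (cmb a b c d p q r s) = \<beta> * d"
  "B j (cmb a b c d p q r s) = \<alpha> * \<beta> * p" "B k (cmb a b c d p q r s) = \<alpha> * \<beta> * q"
  "B m (cmb a b c d p q r s) = \<alpha> * \<beta> * r" "B l (cmb a b c d p q r s) = \<alpha> * \<beta> * s"
  by (simp_all add: cmb_def Btab Btab' algebra_simps)

lemma cmb_add: "cmb a b c d p q r s + cmb a' b' c' d' p' q' r' s' =
  cmb (a + a') (b + b') (c + c') (d + d') (p + p') (q + q') (r + r') (s + s')"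
  by (simp add: cmb_def scale_left_distrib ac_simps)

lemma scal_cmb: "t \<bullet>\<^sub>s cmb a b c d p q r s = cmb (t * a) (t * b) (t * c) (t * d) (t * p) (t * q) (t * r) (t * s)"
  by (simp add: cmb_def scale_right_distrib)

lemma cmb_unit: "cmb 1 0 0 0 0 0 0 0 = x" "cmb 0 0 1 0 0 0 0 0 = w"
  by (simp_all add: cmb_def)

end

section \<open>Isomorphisms of normed algebras, and rigidity of an isotropic pair\<close>

lemma alg_isoD:
  assumes "alg_iso A A' f"
  shows "bij_betw f (carr A) (carr A')"
    and "x \<in> carr A \<Longrightarrow> f x \<in> carr A'"
    and "x \<in> carr A \<Longrightarrow> y \<in> carr A \<Longrightarrow> f (x + y) = f x + f y"
    and "x \<in> carr A \<Longrightarrow> f (smul A c x) = smul A' c (f x)"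
    and "x \<in> carr A \<Longrightarrow> y \<in> carr A \<Longrightarrow> f (mul A x y) = mul A' (f x) (f y)"
    and "x \<in> carr A \<Longrightarrow> nrm A' (f x) = nrm A x"
  using assms bij_betwE[of f "carr A" "carr A'"] by (auto simp: alg_iso_def)

lemma alg_iso_injD: "alg_iso A A' f \<Longrightarrow> x \<in> carr A \<Longrightarrow> y \<in> carr A \<Longrightarrow> f x = f y \<longleftrightarrow> x = y"
  using alg_isoD(1) by (metis bij_betw_def inj_on_eq_iff)

lemma alg_iso_surjE:
  assumes "alg_iso A A' f" "y \<in> carr A'"
  obtains x where "x \<in> carr A" "f x = y"
  using alg_isoD(1)[OF assms(1)] assms(2) by (metis bij_betw_imp_surj_on imageE)

lemma alg_iso_polar:
  assumes "alg_iso A A' f" "normed_algebra A" "x \<in> carr A" "y \<in> carr A"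
  shows "polar A' (f x) (f y) = polar A x y"
proof -
  interpret normed_alg A using assms by unfold_locales
  have "f x + f y = f (x + y)" using assms by (simp add: alg_isoD(3))
  then show ?thesis unfolding polar_def using assms by (simp add: alg_isoD(6)[OF assms(1)])
qed

lemma alg_iso_id: "alg_iso A A (\<lambda>x. x)"
  by (simp add: alg_iso_def bij_betw_def)

lemma alg_iso_comp:
  assumes "alg_iso A A' f" "alg_iso A' A'' h"
  shows "alg_iso A A'' (\<lambda>x. h (f x))"
  unfolding alg_iso_def
  using bij_betw_trans[OF alg_isoD(1)[OF assms(1)] alg_isoD(1)[OF assms(2)]]
  by (simp add: alg_isoD[OF assms(1)] alg_isoD[OF assms(2)] o_def)

lemma alg_iso_inv:
  assumes f: "alg_iso A A' f" and A: "normed_algebra A"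
  shows "alg_iso A' A (inv_into (carr A) f)"
proof -
  interpret normed_alg A using A by unfold_locales
  let ?h = "inv_into (carr A) f"
  have b: "bij_betw ?h (carr A') (carr A)" using alg_isoD(1)[OF f] by (rule bij_betw_inv_into)
  have h: "?h (f x) = x" if "x \<in> carr A" for x
    using that alg_isoD(1)[OF f] by (simp add: bij_betw_def)
  have e: "\<exists>x\<in>carr A. y = f x" if "y \<in> carr A'" for y
    using that alg_iso_surjE[OF f] by metis
  show ?thesis unfolding alg_iso_def
  proof (intro conjI ballI allI)
    fix x y assume "x \<in> carr A'" "y \<in> carr A'"
    then obtain x' y' where "x' \<in> carr A" "x = f x'" "y' \<in> carr A" "y = f y'" using e by metis
    then show "?h (x + y) = ?h x + ?h y" "?h (mul A' x y) = mul A (?h x) (?h y)"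
      using h alg_isoD[OF f] C_add C_mult by metis+
  next
    fix c x assume "x \<in> carr A'"
    then obtain x' where "x' \<in> carr A" "x = f x'" using e by metis
    then show "?h (smul A' c x) = smul A c (?h x)" "nrm A (?h x) = nrm A' x"
      using h alg_isoD[OF f] C_scal by metis+
  qed (rule b)
qed

lemma okubo_pair_iso:
  assumes "okubo_pair A x w \<alpha> \<beta>" "okubo_pair A' x' w' \<alpha> \<beta>" and nz: "\<alpha> \<noteq> 0" "\<beta> \<noteq> 0"
  shows "\<exists>f. alg_iso A A' f"
proof -
  interpret P: okubo_pair A x w \<alpha> \<beta> by fact
  interpret Q: okubo_pair A' x' w' \<alpha> \<beta> by fact
  define f where "f u = Q.cmb (polar A P.y u / \<alpha>) (polar A x u / \<alpha>) (polar A P.v u / \<beta>) (polar A w u / \<beta>)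
    (polar A P.j u / (\<alpha> * \<beta>)) (polar A P.k u / (\<alpha> * \<beta>)) (polar A P.m u / (\<alpha> * \<beta>)) (polar A P.l u / (\<alpha> * \<beta>))" for u
  define h where "h u = P.cmb (polar A' Q.y u / \<alpha>) (polar A' x' u / \<alpha>) (polar A' Q.v u / \<beta>) (polar A' w' u / \<beta>)
    (polar A' Q.j u / (\<alpha> * \<beta>)) (polar A' Q.k u / (\<alpha> * \<beta>)) (polar A' Q.m u / (\<alpha> * \<beta>)) (polar A' Q.l u / (\<alpha> * \<beta>))" for u
  have f: "f (P.cmb a b c d p q r s) = Q.cmb a b c d p q r s" for a b c d p q r s
    unfolding f_def P.B_gen_cmb using nz by simp
  have h: "h (Q.cmb a b c d p q r s) = P.cmb a b c d p q r s" for a b c d p q r s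
    unfolding h_def Q.B_gen_cmb using nz by simp
  note pe = P.cmb_exE[OF nz] and qe = Q.cmb_exE[OF nz]
  have fC: "f u \<in> carr A'" for u by (simp add: f_def)
  have f_add: "f (u + z) = f u + f z" if "u \<in> carr A" "z \<in> carr A" for u z
    by (rule pe[OF that(1)], rule pe[OF that(2)]) (simp add: P.cmb_add Q.cmb_add f)
  have f_scal: "f (smul A c u) = smul A' c (f u)" if "u \<in> carr A" for u c
    by (rule pe[OF that]) (simp add: P.scal_cmb Q.scal_cmb f)
  have f_N: "nrm A' (f u) = nrm A u" if "u \<in> carr A" for u
    by (rule pe[OF that]) (simp add: P.N_cmb Q.N_cmb f)
  have f_B: "polar A' (f u) (f z) = polar A u z" if "u \<in> carr A" "z \<in> carr A" for u z
    by (rule pe[OF that(1)], rule pe[OF that(2)]) (simp add: P.B_cmb Q.B_cmb f)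
  have bij: "bij_betw f (carr A) (carr A')"
  proof (rule bij_betw_byWitness[of _ h])
    show "\<forall>a\<in>carr A. h (f a) = a" using pe f h by metis
    show "\<forall>a\<in>carr A'. f (h a) = a" using qe f h by metis
    show "f ` carr A \<subseteq> carr A'" "h ` carr A' \<subseteq> carr A" by (auto simp: fC h_def)
  qed
  \<comment> \<open>The elements whose two multiplications \<open>f\<close> respects are closed under products by the
    linearized identities, and they contain \<open>x\<close> and \<open>w\<close>.\<close>
  define G where "G = {a \<in> carr A. \<forall>c\<in>carr A. f (mul A a c) = mul A' (f a) (f c) \<and> f (mul A c a) = mul A' (f c) (f a)}"
  have fx: "f x = x'" "f w = w'"
    using f[of 1 0 0 0 0 0 0 0] f[of 0 0 1 0 0 0 0 0] by (simp_all add: P.cmb_unit Q.cmb_unit)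
  have Gx: "x \<in> G"
  proof -
    have "f (mul A x c) = mul A' x' (f c) \<and> f (mul A c x) = mul A' (f c) x'" if "c \<in> carr A" for c
      by (rule pe[OF that]) (simp add: f P.x_cmb P.cmb_x Q.x_cmb Q.cmb_x)
    then show ?thesis by (simp add: G_def fx)
  qed
  have Gw: "w \<in> G"
  proof -
    have "f (mul A w c) = mul A' w' (f c) \<and> f (mul A c w) = mul A' (f c) w'" if "c \<in> carr A" for c
      by (rule pe[OF that]) (simp add: f P.w_cmb P.cmb_w Q.w_cmb Q.cmb_w)
    then show ?thesis by (simp add: G_def fx)
  qed
  have f_diff: "f (u - z) = f u - f z" if "u \<in> carr A" "z \<in> carr A" for u z
    using f_add[of "u - z" z] that by (simp add: algebra_simps)
  have Gm: "mul A a b \<in> G" if "a \<in> G" "b \<in> G" for a b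
  proof -
    have ab: "a \<in> carr A" "b \<in> carr A" using that by (auto simp: G_def)
    have ga: "f (mul A a c) = mul A' (f a) (f c)" "f (mul A c a) = mul A' (f c) (f a)"
      "f (mul A b c) = mul A' (f b) (f c)" "f (mul A c b) = mul A' (f c) (f b)" if "c \<in> carr A" for c
      using \<open>a \<in> G\<close> \<open>b \<in> G\<close> that by (auto simp: G_def)
    have "f (mul A (mul A a b) c) = mul A' (f (mul A a b)) (f c)" if "c \<in> carr A" for c
      using P.flexl_lin[OF ab that] Q.flexl_lin[OF fC fC fC, of a b c] that ab
      by (simp add: ga f_diff f_scal f_B)
    moreover have "f (mul A c (mul A a b)) = mul A' (f c) (f (mul A a b))" if "c \<in> carr A" for c
      using P.flexr_lin[OF that ab] Q.flexr_lin[OF fC fC fC, of c a b] that ab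
      by (simp add: ga f_diff f_scal f_B)
    ultimately show ?thesis using ab by (simp add: G_def)
  qed
  have Gadd: "a + b \<in> G" if "a \<in> G" "b \<in> G" for a b
    using that by (auto simp: G_def f_add fC)
  have Gscal: "smul A c a \<in> G" if "a \<in> G" for a c
    using that by (auto simp: G_def f_scal fC)
  have "P.y \<in> G" "P.v \<in> G" "P.k \<in> G" by (simp_all add: P.y_def P.v_def P.k_def Gm Gx Gw)
  moreover from this have "P.l \<in> G" "P.m \<in> G" "P.j \<in> G" by (simp_all add: P.l_def P.m_def P.j_def Gm Gx Gw)
  ultimately have Gc: "P.cmb a b c d p q r s \<in> G" for a b c d p q r s
    unfolding P.cmb_def by (intro Gadd Gscal Gx Gw)
  have "a \<in> G" if "a \<in> carr A" for a by (rule pe[OF that]) (simp add: Gc)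
  then have "alg_iso A A' f"
    unfolding alg_iso_def using bij f_add f_scal f_N by (auto simp: G_def)
  then show ?thesis by blast
qed

section \<open>Cubes, common kernels and the automorphism of an idempotent\<close>

lemma cube_add: "(3::'f::field) = 0 \<Longrightarrow> (a + b) ^ 3 = a ^ 3 + (b::'f) ^ 3"
proof -
  assume "(3::'f) = 0"
  moreover have "(a + b) ^ 3 = a ^ 3 + b ^ 3 + 3 * (a^2 * b + a * b^2)" by algebra
  ultimately show ?thesis by simp
qed

lemma cube_diff: "(3::'f::field) = 0 \<Longrightarrow> (a - b) ^ 3 = a ^ 3 - (b::'f) ^ 3"
  using cube_add[of a "- b"] by simp

text \<open>A nontrivial relation is of degree one or two in \<open>t\<close>. In degree one it
  exhibits \<open>t\<close> as a cube directly, in degree two after completing the square.\<close>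

lemma non_cube_independent:
  fixes t :: "'f::field"
  assumes 3: "(3::'f) = 0" and t: "\<And>c. t \<noteq> c ^ 3" and eq: "c0 ^ 3 + c1 ^ 3 * t + c2 ^ 3 * t ^ 2 = 0"
  shows "c0 = 0" "c1 = 0" "c2 = 0"
proof -
  show c2: "c2 = 0"
  proof (rule ccontr)
    assume nz: "c2 \<noteq> 0"
    define a b where "a = c1 / c2" and "b = c0 / c2"
    have c: "c1 = a * c2" "c0 = b * c2" using nz by (auto simp: a_def b_def)
    have "c2 ^ 3 * (b ^ 3 + a ^ 3 * t + t ^ 2) = 0" using eq unfolding c by algebra
    then have q: "b ^ 3 + a ^ 3 * t + t ^ 2 = 0" using nz by simp
    \<comment> \<open>As \<open>1 / 2 = - 1\<close>, \<open>s\<close> completes the square in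
      \<open>q\<close> and gives \<open>s^2 = d^3\<close>. Then
      \<open>s = s^3 / s^2 = (s / d)^3\<close>, so \<open>t = s + a^3\<close> is a cube.\<close>
    define s d where "s = t - a ^ 3" and "d = a ^ 2 - b"
    have "s ^ 2 - d ^ 3 = (b ^ 3 + a ^ 3 * t + t ^ 2) - 3 * (a^3 * t - a ^ 4 * b + a ^ 2 * b ^ 2)"
      unfolding s_def d_def by algebra
    then have sd: "s ^ 2 = d ^ 3" using q 3 by simp
    have s: "s \<noteq> 0" using t[of a] by (simp add: s_def)
    then have "d \<noteq> 0" using sd by auto
    then have "s = (s / d) ^ 3" using sd s by (simp add: field_simps power2_eq_square power3_eq_cube)
    then have "t = (s / d + a) ^ 3" unfolding cube_add[OF 3] by (metis s_def diff_add_cancel)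
    then show False using t by blast
  qed
  show c1: "c1 = 0"
  proof (rule ccontr)
    assume "c1 \<noteq> 0"
    then have "t = (- c0 / c1) ^ 3" using eq c2 by (simp add: field_simps eq_neg_iff_add_eq_0)
    then show False using t by blast
  qed
  show "c0 = 0" using eq c1 c2 by simp
qed

context normed_alg
begin

definition lin_fun :: "('v \<Rightarrow> 'f) \<Rightarrow> bool" where
  "lin_fun h \<longleftrightarrow> (\<forall>a\<in>C. \<forall>b\<in>C. h (a + b) = h a + h b) \<and> (\<forall>c. \<forall>a\<in>C. h (c \<bullet>\<^sub>s a) = c * h a)"

lemma sum_C: "(\<And>i. i \<in> I \<Longrightarrow> u i \<in> C) \<Longrightarrow> (\<Sum>i\<in>I. u i) \<in> C"
  using subC by (rule subspace_sum)

lemma lin_fun_sum: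
  assumes "lin_fun h" "\<And>i. i \<in> I \<Longrightarrow> u i \<in> C"
  shows "h (\<Sum>i\<in>I. c i \<bullet>\<^sub>s u i) = (\<Sum>i\<in>I. c i * h (u i))"
proof -
  have z: "h 0 = 0"
  proof -
    have "h (0 \<bullet>\<^sub>s 0) = 0 * h 0" using assms(1) C_zero unfolding lin_fun_def by blast
    then show ?thesis by simp
  qed
  show ?thesis using assms(2)
  proof (induction I rule: infinite_finite_induct)
    case (insert i I)
    have "h (c i \<bullet>\<^sub>s u i + (\<Sum>i\<in>I. c i \<bullet>\<^sub>s u i)) = h (c i \<bullet>\<^sub>s u i) + h (\<Sum>i\<in>I. c i \<bullet>\<^sub>s u i)"
      using assms(1) insert.prems sum_C[of I "\<lambda>i. c i \<bullet>\<^sub>s u i"] unfolding lin_fun_def by (meson C_scal insertCI)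
    moreover have "h (c i \<bullet>\<^sub>s u i) = c i * h (u i)"
      using assms(1) insert.prems unfolding lin_fun_def by blast
    ultimately show ?case using insert by simp
  qed (use z in auto)
qed

lemma lin_fun_B: "z \<in> C \<Longrightarrow> lin_fun (B z)"
  by (simp add: lin_fun_def)

text \<open>Gaussian elimination, one functional at a time: some \<open>u i\<close> with
  \<open>h (u i) \<noteq> 0\<close> serves as pivot, leaves the index set, and corrects the other
  vectors into the kernel of \<open>h\<close>.\<close>

lemma common_kernel:
  assumes "\<forall>h\<in>set hs. lin_fun h" "finite I" "card I > length hs" "\<forall>i\<in>I. u i \<in> C"
    "\<forall>c. (\<Sum>i\<in>I. c i \<bullet>\<^sub>s u i) = 0 \<longrightarrow> (\<forall>i\<in>I. c i = 0)"
  shows "\<exists>c. (\<Sum>i\<in>I. c i \<bullet>\<^sub>s u i) \<noteq> 0 \<and> (\<forall>h\<in>set hs. h (\<Sum>i\<in>I. c i \<bullet>\<^sub>s u i) = 0)"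
  using assms
proof (induction hs arbitrary: I u)
  case Nil
  then obtain i where i: "i \<in> I" by fastforce
  show ?case
  proof (rule exI[of _ "\<lambda>k. if k = i then 1 else 0"], intro conjI notI)
    assume "(\<Sum>k\<in>I. (if k = i then 1 else 0) \<bullet>\<^sub>s u k) = 0"
    then have "\<forall>k\<in>I. (if k = i then 1 else 0) = (0::'f)" by (rule Nil(5)[THEN spec, THEN mp])
    then show False using i by force
  qed simp
next
  case (Cons h hs)
  show ?case
  proof (cases "\<forall>i\<in>I. h (u i) = 0")
    case True
    then have "h (\<Sum>i\<in>I. c i \<bullet>\<^sub>s u i) = 0" for c
      using Cons.prems by (subst lin_fun_sum) auto
    then show ?thesis using Cons.IH[of I u] Cons.prems by auto
  next
    case False
    then obtain i where i: "i \<in> I" "h (u i) \<noteq> 0" by auto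
    define I' where "I' = I - {i}"
    define u' where "u' k = u k - (h (u k) / h (u i)) \<bullet>\<^sub>s u i" for k
    have I: "I = insert i I'" "i \<notin> I'" "finite I'" using i Cons.prems by (auto simp: I'_def)
    \<comment> \<open>\<open>e c\<close> supplies the coefficient of the pivot, so that a
      combination of the corrected vectors \<open>u'\<close> becomes one of the original vectors
      \<open>u\<close>.\<close>
    define e where "e c = (\<lambda>k. if k = i then - (\<Sum>k\<in>I'. c k * h (u k)) / h (u i) else c k)" for c
    have s: "(\<Sum>k\<in>I'. c k \<bullet>\<^sub>s u' k) = (\<Sum>k\<in>I. e c k \<bullet>\<^sub>s u k)" for c
    proof -
      have "(\<Sum>k\<in>I. e c k \<bullet>\<^sub>s u k) = - ((\<Sum>k\<in>I'. c k * h (u k)) / h (u i)) \<bullet>\<^sub>s u i + (\<Sum>k\<in>I'. e c k \<bullet>\<^sub>s u k)"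
        using I by (simp add: e_def)
      also have "(\<Sum>k\<in>I'. e c k \<bullet>\<^sub>s u k) = (\<Sum>k\<in>I'. c k \<bullet>\<^sub>s u k)"
        by (rule sum.cong) (use I in \<open>auto simp: e_def\<close>)
      finally show ?thesis
        by (simp add: u'_def scale_right_diff_distrib sum_subtractf sum_divide_distrib scale_sum_left)
    qed
    have ih: "\<exists>c. (\<Sum>k\<in>I'. c k \<bullet>\<^sub>s u' k) \<noteq> 0 \<and> (\<forall>h\<in>set hs. h (\<Sum>k\<in>I'. c k \<bullet>\<^sub>s u' k) = 0)"
    proof (rule Cons.IH)
      show "\<forall>c. (\<Sum>k\<in>I'. c k \<bullet>\<^sub>s u' k) = 0 \<longrightarrow> (\<forall>k\<in>I'. c k = 0)"
      proof (intro allI impI ballI)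
        fix c k assume a: "(\<Sum>k\<in>I'. c k \<bullet>\<^sub>s u' k) = 0" "k \<in> I'"
        then have "\<forall>k\<in>I. e c k = 0" unfolding s by (intro Cons.prems(5)[THEN spec, THEN mp])
        then have "e c k = 0" using a I by blast
        then show "c k = 0" using a I by (auto simp: e_def split: if_splits)
      qed
    qed (use Cons.prems I in \<open>auto simp: u'_def\<close>)
    then obtain c where c: "(\<Sum>k\<in>I'. c k \<bullet>\<^sub>s u' k) \<noteq> 0" "\<forall>h\<in>set hs. h (\<Sum>k\<in>I'. c k \<bullet>\<^sub>s u' k) = 0" by blast
    have "h (u' k) = 0" if "k \<in> I'" for k
    proof -
      have lh: "lin_fun h" using Cons.prems by auto
      have "u k = u' k + (h (u k) / h (u i)) \<bullet>\<^sub>s u i" by (simp add: u'_def)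
      then have "h (u k) = h (u' k) + (h (u k) / h (u i)) * h (u i)"
        using lh Cons.prems(4) that I unfolding lin_fun_def u'_def by (metis C_diff C_scal insertCI)
      then show ?thesis using i by simp
    qed
    then have "h (\<Sum>k\<in>I'. c k \<bullet>\<^sub>s u' k) = 0"
      using Cons.prems I by (subst lin_fun_sum) (auto simp: u'_def)
    then show ?thesis using c s by auto
  qed
qed

lemma common_kernel_set:
  assumes "\<forall>h\<in>set hs. lin_fun h" "independent S" "S \<subseteq> C" "finite S" "card S > length hs"
  shows "\<exists>z. z \<in> span S \<and> z \<in> C \<and> z \<noteq> 0 \<and> (\<forall>h\<in>set hs. h z = 0)"
proof -
  have i: "\<forall>c. (\<Sum>i\<in>S. c i \<bullet>\<^sub>s i) = 0 \<longrightarrow> (\<forall>i\<in>S. c i = 0)"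
    using assms independentD[OF assms(2,4)] by auto
  obtain c where "(\<Sum>i\<in>S. c i \<bullet>\<^sub>s i) \<noteq> 0 \<and> (\<forall>h\<in>set hs. h (\<Sum>i\<in>S. c i \<bullet>\<^sub>s i) = 0)"
    using common_kernel[OF assms(1) assms(4) assms(5) _ i] assms(3) by auto
  moreover have "(\<Sum>i\<in>S. c i \<bullet>\<^sub>s i) \<in> span S" by (intro span_sum span_scale span_base)
  moreover have "(\<Sum>i\<in>S. c i \<bullet>\<^sub>s i) \<in> C" using assms(3) by (intro sum_C C_scal) auto
  ultimately show ?thesis by blast
qed

end

section \<open>The automorphism of an idempotent and its trace operator\<close>

context symcomp
begin

lemma g_sum: "(\<And>i. i \<in> I \<Longrightarrow> u i \<in> C) \<Longrightarrow> g (\<Sum>i\<in>I. c i \<bullet>\<^sub>s u i) = (\<Sum>i\<in>I. c i ^ 3 * g (u i))"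
proof (induction I rule: infinite_finite_induct)
  case (insert i I)
  then show ?case using sum_C[of I "\<lambda>i. c i \<bullet>\<^sub>s u i"] by (simp add: g_add g_scal)
qed auto

context
  fixes e assumes e: "idempotent A e"
begin

lemma eC[simp]: "e \<in> C" and ee[simp]: "e \<star> e = e" and e_nz: "e \<noteq> 0"
  using e by (auto simp: idempotent_def)

lemma Ne[simp]: "N e = 1"
  using flexl[of e e] e_nz by (metis ee eC scale_cancel_right scale_one)

lemma Bee[simp]: "B e e = - 1" by (simp add: B_N)

lemma ge[simp]: "g e = - 1" by (simp add: cubic_form_def)

abbreviation \<tau> where "\<tau> u \<equiv> idem_tau A e u"

lemma tauC[simp]: "u \<in> C \<Longrightarrow> \<tau> u \<in> C"
  by (simp add: idem_tau_def)

lemma tau_eq: "u \<in> C \<Longrightarrow> \<tau> u = B e u \<bullet>\<^sub>s e - u \<star> e"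
  using flexr_lin[of e e u] by (simp add: idem_tau_def)

lemma tau_add[simp]: "u \<in> C \<Longrightarrow> z \<in> C \<Longrightarrow> \<tau> (u + z) = \<tau> u + \<tau> z"
  and tau_scal[simp]: "u \<in> C \<Longrightarrow> \<tau> (c \<bullet>\<^sub>s u) = c \<bullet>\<^sub>s \<tau> u"
  and tau_diff[simp]: "u \<in> C \<Longrightarrow> z \<in> C \<Longrightarrow> \<tau> (u - z) = \<tau> u - \<tau> z"
  and tau_e[simp]: "\<tau> e = e"
  by (simp_all add: idem_tau_def)

lemma tau_mult_e: "u \<in> C \<Longrightarrow> \<tau> u \<star> e = e \<star> u"
  using flexl_lin[of u e e] by (simp add: tau_eq B_sym[of u e])

lemma e_mult_tau: "u \<in> C \<Longrightarrow> e \<star> \<tau> u = B e u \<bullet>\<^sub>s e - u"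
  by (simp add: tau_eq flexr)

text \<open>Linearized flexibility applied twice turns
  \<open>e \<star> (e \<star> (u \<star> z))\<close> into
  \<open>(u \<star> e) \<star> (z \<star> e)\<close> plus terms with values of \<open>B\<close>;
  these terms cancel when \<open>u \<star> e\<close> and \<open>z \<star> e\<close> are expressed
  through \<open>\<tau>\<close>.\<close>

lemma tau_mult: assumes "u \<in> C" "z \<in> C" shows "\<tau> (u \<star> z) = \<tau> u \<star> \<tau> z"
proof -
  have 1: "\<tau> (u \<star> z) = B e z \<bullet>\<^sub>s (e \<star> u) - B e (u \<star> e) \<bullet>\<^sub>s z + (u \<star> e) \<star> (z \<star> e)"
    using assms flexr_lin[of e u z] flexr_lin[of e z "u \<star> e"] by (simp add: idem_tau_def)
  have 2: "B e (u \<star> e) = B e u" using assms B_mult_right[of e e u] by simp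
  have 3: "u \<star> e = B e u \<bullet>\<^sub>s e - \<tau> u" "z \<star> e = B e z \<bullet>\<^sub>s e - \<tau> z" using assms by (simp_all add: tau_eq)
  show ?thesis unfolding 1 2 unfolding 3 using assms
    by (simp add: e_mult_tau tau_mult_e algebra_simps)
qed

lemma tau2: "u \<in> C \<Longrightarrow> \<tau> (\<tau> u) = B e u \<bullet>\<^sub>s e - e \<star> u"
  using e_mult_tau[of u] by (simp add: idem_tau_def)

lemma B_tau[simp]: "u \<in> C \<Longrightarrow> z \<in> C \<Longrightarrow> B (\<tau> u) (\<tau> z) = B u z"
  by (simp add: idem_tau_def B_mult_left)

lemma Be_tau[simp]: "u \<in> C \<Longrightarrow> B e (\<tau> u) = B e u"
  using B_tau[of e u] by simp

lemma tau3: "u \<in> C \<Longrightarrow> \<tau> (\<tau> (\<tau> u)) = u"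
  using tau2[of "\<tau> u"] e_mult_tau[of u] by simp

lemma g_tau[simp]: "u \<in> C \<Longrightarrow> g (\<tau> u) = g u"
  by (simp add: cubic_form_def tau_mult[symmetric])

text \<open>In characteristic 3 this is \<open>(\<tau> - 1)^2\<close>, so
  \<open>\<tau>^3 = 1\<close> makes its square zero. Since \<open>\<tau>\<close> is an isometry,
  \<open>Tr\<close> is self-adjoint, and its image is therefore totally isotropic; \<open>g\<close>
  vanishes on it because three equal values add up to zero. Adding elements of this image changes
  norms without changing \<open>g\<close>.\<close>

definition Tr where "Tr u = u + \<tau> u + \<tau> (\<tau> u)"

lemma TrC[simp]: "u \<in> C \<Longrightarrow> Tr u \<in> C" by (simp add: Tr_def)

lemma Tr_adj: assumes "u \<in> C" "z \<in> C" shows "B (Tr u) z = B u (Tr z)"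
proof -
  have "B (\<tau> u) z = B u (\<tau> (\<tau> z))" "B (\<tau> (\<tau> u)) z = B u (\<tau> z)"
    using assms B_tau[of u "\<tau> (\<tau> z)"] B_tau[of "\<tau> u" "\<tau> (\<tau> z)"] B_tau[of u "\<tau> z"] by (simp_all add: tau3)
  then show ?thesis using assms by (simp add: Tr_def)
qed

lemma Tr_Tr: "u \<in> C \<Longrightarrow> Tr (Tr u) = 0"
  using triple0[of "Tr u"] by (simp add: Tr_def tau3 ac_simps)

lemma N_Tr: assumes "u \<in> C" shows "N (Tr u) = 0"
  using assms Tr_adj[of u "Tr u"] B_N[of "Tr u"] by (simp add: Tr_Tr)

lemma g_Tr: assumes "u \<in> C" shows "g (Tr u) = 0"
  using assms ftriple0[of "g u"] by (simp add: Tr_def g_add add.assoc)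

text \<open>For \<open>u\<close> orthogonal to \<open>e\<close>, vanishing of the trace reads
  \<open>u \<star> e + e \<star> u = u\<close>. Substituting this into
  \<open>g u = B (u \<star> u) u\<close> produces two terms, each equal to
  \<open>N u * B u e = 0\<close>.\<close>

lemma g_eq_zero: assumes "u \<in> C" "B e u = 0" "Tr u = 0" shows "g u = 0"
proof -
  have "\<tau> u + \<tau> (\<tau> u) = - u" using assms(3) by (simp add: Tr_def add.assoc eq_neg_iff_add_eq_0 add.commute)
  moreover have "\<tau> u = - (u \<star> e)" "\<tau> (\<tau> u) = - (e \<star> u)" using assms tau_eq[of u] tau2[of u] by simp_all
  ultimately have eq: "u \<star> e + e \<star> u = u" by (metis minus_add_distrib add.commute neg_equal_iff_equal)
  have "g u = B (u \<star> u) (u \<star> e + e \<star> u)" using assms by (simp add: eq cubic_form_def B_sym)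
  also have "\<dots> = B (u \<star> u) (u \<star> e) + B u (u \<star> (e \<star> u))" using assms assoc[of u u "e \<star> u"] by simp
  also have "\<dots> = 0" using assms by (simp add: B_mult_left flexr B_sym[of u e])
  finally show ?thesis .
qed

end

end

context okubo_pair
begin

lemma kk: "k \<star> k = - j"
  using flexr_lin[of k x w] by (simp add: xw Bkw xk wm)

lemma mk: "m \<star> k = \<alpha> \<bullet>\<^sub>s v"
  using flexl_lin[of x k k] by (simp add: xk Bxk kk jx)

lemma mm: "m \<star> m = \<alpha> \<bullet>\<^sub>s l"
  using flexl_lin[of x k m] by (simp add: xk Bxm mk vx)

lemma gk: "g k = - (\<alpha> * \<beta>)" by (simp add: cubic_form_def kk Bkj)

lemma gm: "g m = \<alpha> ^ 2 * \<beta>"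
  by (simp add: cubic_form_def mm Btab' power2_eq_square)

text \<open>The vectors \<open>w\<close>, \<open>k\<close>, \<open>m\<close> span a totally
  isotropic space orthogonal to \<open>x\<close> and annihilated by right multiplication with
  \<open>x\<close>, so any combination can take the place of \<open>w\<close>. The values of
  \<open>g\<close> on the three are \<open>\<beta>\<close>, \<open>- \<alpha> \<beta>\<close> and
  \<open>\<alpha>^2 \<beta>\<close>.\<close>

lemma okubo_pair_change:
  assumes "w' = cmb 0 0 a 0 b 0 0 c"
  shows "okubo_pair A x w' \<alpha> (a ^ 3 * \<beta> - b ^ 3 * \<alpha> * \<beta> + c ^ 3 * \<alpha> ^ 2 * \<beta>)"
proof unfold_locales
  have w': "w' = a \<bullet>\<^sub>s w + b \<bullet>\<^sub>s k + c \<bullet>\<^sub>s m" by (simp add: assms cmb_def)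
  show "w' \<in> C" by (simp add: w')
  show "N w' = 0" by (simp add: assms N_cmb)
  show "B x w' = 0" by (simp add: assms B_gen_cmb)
  show "w' \<star> x = 0" by (simp add: assms cmb_x) (simp add: cmb_def)
  show "g w' = a ^ 3 * \<beta> - b ^ 3 * \<alpha> * \<beta> + c ^ 3 * \<alpha> ^ 2 * \<beta>"
    by (simp add: w' g_add g_scal gw gk gm)
qed (use gx in auto)

end

section \<open>Idempotents and isotropic pairs obtained from the image of \<open>g\<close>\<close>

context symcomp
begin

text \<open>Without idempotents the norm vanishes on the kernel of \<open>g\<close>. A nonzero
  \<open>z\<close> in this kernel that is orthogonal to \<open>b0\<close>, \<open>b1\<close>,
  \<open>b2\<close> is then orthogonal to the kernel and to a complement of it, against
  nonsingularity.\<close>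

lemma exists_idempotent:
  assumes S: "independent S" "S \<subseteq> C" "card S = 8"
    and t: "\<And>c. t \<noteq> c ^ 3"
    and b: "b0 \<in> C" "b1 \<in> C" "b2 \<in> C" "g b0 = 1" "g b1 = t" "g b2 = t ^ 2"
    and rng: "\<And>u. u \<in> C \<Longrightarrow> \<exists>c0 c1 c2. g u = c0 ^ 3 + c1 ^ 3 * t + c2 ^ 3 * t ^ 2"
  shows "\<exists>e. idempotent A e"
proof (rule ccontr)
  assume no: "\<nexists>e. idempotent A e"
  have iso: "N z = 0" if "z \<in> C" "g z = 0" for z
    using idem_of_trace_zero[OF that] no by blast
  obtain f0 f1 f2 where f: "\<And>u. u \<in> C \<Longrightarrow> g u = f0 u ^ 3 + f1 u ^ 3 * t + f2 u ^ 3 * t ^ 2"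
    using rng by metis
  have uniq: "f0 u = c0 \<and> f1 u = c1 \<and> f2 u = c2"
    if "u \<in> C" "g u = c0 ^ 3 + c1 ^ 3 * t + c2 ^ 3 * t ^ 2" for u c0 c1 c2
  proof -
    have "(f0 u - c0) ^ 3 + (f1 u - c1) ^ 3 * t + (f2 u - c2) ^ 3 * t ^ 2 = 0"
      using f[OF that(1)] that(2) by (simp add: cube_diff[OF char3] algebra_simps)
    from non_cube_independent[OF char3 t this] show ?thesis by simp
  qed
  have lin: "lin_fun f0" "lin_fun f1" "lin_fun f2"
  proof -
    have "f0 (a + b) = f0 a + f0 b \<and> f1 (a + b) = f1 a + f1 b \<and> f2 (a + b) = f2 a + f2 b"
      if "a \<in> C" "b \<in> C" for a b
      using that by (intro uniq) (simp_all add: g_add f[of a] f[of b] cube_add[OF char3] algebra_simps)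
    moreover have "f0 (c \<bullet>\<^sub>s a) = c * f0 a \<and> f1 (c \<bullet>\<^sub>s a) = c * f1 a \<and> f2 (c \<bullet>\<^sub>s a) = c * f2 a"
      if "a \<in> C" for a c
      using that by (intro uniq) (simp_all add: g_scal f[of a] power_mult_distrib algebra_simps)
    ultimately show "lin_fun f0" "lin_fun f1" "lin_fun f2" by (simp_all add: lin_fun_def)
  qed
  have fin: "finite S" using S(3) card.infinite by fastforce
  \<comment> \<open>Three conditions put \<open>z\<close> into the kernel of \<open>g\<close> and
    three make it orthogonal to \<open>b0\<close>, \<open>b1\<close>, \<open>b2\<close>: six
    functionals against eight independent vectors.\<close>
  obtain z where z: "z \<in> C" "z \<noteq> 0" "\<forall>h\<in>set [f0, f1, f2, B b0, B b1, B b2]. h z = 0"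
    using common_kernel_set[of "[f0, f1, f2, B b0, B b1, B b2]" S] lin lin_fun_B b S fin by auto
  then have gz: "g z = 0" by (simp add: f)
  have "B z u = 0" if u: "u \<in> C" for u
  proof -
    define u' where "u' = u - f0 u \<bullet>\<^sub>s b0 - f1 u \<bullet>\<^sub>s b1 - f2 u \<bullet>\<^sub>s b2"
    have u': "u' \<in> C" "g u' = 0" using u b by (simp_all add: u'_def g_diff g_scal f[of u])
    have "N (z + u') = 0" using iso z(1) gz u' by (simp add: g_add)
    then have "B z u' = 0" using iso[OF u'] iso[OF z(1) gz] by (simp add: N_add)
    then show ?thesis using z b u by (simp add: u'_def B_sym[of z])
  qed
  then show False using nonsing[OF z(1)] z(2) by blast
qed

lemma exists_okubo_pair:
  assumes e: "idempotent A e" and t: "\<And>c. t \<noteq> c ^ 3"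
    and x0: "x0 \<in> C" "g x0 = t"
    and rng: "\<And>u. u \<in> C \<Longrightarrow> \<exists>c0 c1 c2. g u = c0 ^ 3 + c1 ^ 3 * t + c2 ^ 3 * t ^ 2"
  shows "\<exists>x w. okubo_pair A x w t 1"
proof -
  note [simp] = eC[OF e] TrC[OF e]
  have t0: "t \<noteq> 0" using t[of 0] by auto
  \<comment> \<open>Otherwise \<open>x0 + b e\<close>, orthogonal to \<open>e\<close> because
    \<open>B e e = - 1\<close>, is killed by \<open>Tr\<close>, so \<open>g\<close> vanishes on it.
    As \<open>g e = - 1\<close>, this reads \<open>t = b^3\<close>.\<close>
  have Tr_nz: "Tr e x0 \<noteq> 0"
  proof
    assume a: "Tr e x0 = 0"
    define b where "b = B e x0"
    have "g (x0 + b \<bullet>\<^sub>s e) = 0"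
    proof (rule g_eq_zero[OF e])
      show "Tr e (x0 + b \<bullet>\<^sub>s e) = 0"
        using a x0 by (simp add: triple[of "b \<bullet>\<^sub>s e"] Tr_def[OF e] tau_add[OF e] tau_scal[OF e] tau_e[OF e] tauC[OF e] ac_simps)
    qed (use x0 in \<open>simp_all add: b_def Bee[OF e]\<close>)
    then have "t = b ^ 3" using x0 by (simp add: g_add g_scal ge[OF e])
    then show False using t by blast
  qed
  then obtain u where u: "u \<in> C" "B (Tr e x0) u \<noteq> 0" using nonsing[of "Tr e x0"] x0 by auto
  \<comment> \<open>\<open>Tr e u\<close> is isotropic, so the norm of \<open>x0 + s Tr e u\<close>
    is affine in \<open>s\<close> and this is its root; \<open>g (Tr e u) = 0\<close> keeps the
    value \<open>t\<close>.\<close>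
  define s where "s = - (N x0 / B x0 (Tr e u))"
  define x where "x = x0 + s \<bullet>\<^sub>s Tr e u"
  define y where "y = x \<star> x"
  have xC[simp]: "x \<in> C" using x0 u by (simp add: x_def)
  have yC[simp]: "y \<in> C" by (simp add: y_def)
  have bu: "B x0 (Tr e u) \<noteq> 0" using u Tr_adj[OF e x0(1) u(1)] by simp
  have Nx: "N x = 0" using x0 u bu by (simp add: x_def N_diff N_Tr[OF e] s_def)
  have gx: "g x = t" using x0 u by (simp add: x_def g_add g_scal g_Tr[OF e])
  have x_nz: "x \<noteq> 0" using gx t0 by auto
  have xy: "x \<star> y = 0" "y \<star> x = 0" using flexr[of x x] flexl[of x x] Nx by (simp_all add: y_def)
  have Bxy: "B x y = t" using gx by (simp add: cubic_form_def y_def)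
  have Nz: "N u = 0" if "u \<in> C" "u \<star> x = 0 \<or> x \<star> u = 0" for u
  proof -
    have "N u \<bullet>\<^sub>s x = 0" using that flexl[of u x] flexr[of u x] by auto
    then show ?thesis using x_nz by simp
  qed
  \<comment> \<open>If \<open>g\<close> vanished on all such \<open>z\<close>, the left and right
    annihilators of \<open>x\<close> would only carry values of \<open>g\<close> coming from
    multiples of \<open>y\<close>, and a decomposition of \<open>e\<close> would give a forbidden
    relation between \<open>1\<close>, \<open>t\<close>, \<open>t^2\<close>.\<close>
  have "\<exists>z\<in>C. z \<star> x = 0 \<and> B x z = 0 \<and> g z \<noteq> 0"
  proof (rule ccontr)
    assume "\<not> ?thesis"
    then have R: "g z = 0" if "z \<in> C" "z \<star> x = 0" "B x z = 0" for z using that by blast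
    \<comment> \<open>If \<open>x \<star> z = 0\<close>, then
      \<open>(z \<star> z) \<star> x = 0\<close>, so \<open>R\<close> applies to
      \<open>z \<star> z\<close>; and \<open>g (z \<star> z) = (g z)^2\<close> because
      \<open>N z = 0\<close>.\<close>
    have L: "g z = 0" if z: "z \<in> C" "x \<star> z = 0" "B x z = 0" for z
    proof -
      have "g (z \<star> z) = 0"
        using z flexl_lin[of z z x] assoc[of x z z] by (intro R) (simp_all add: B_sym[of z x])
      then show ?thesis using z Nz[of z] by (simp add: g_sq)
    qed
    have gy: "g y = t ^ 2" using gx Nx by (simp add: y_def g_sq)
    have R': "g z = (B x z / t) ^ 3 * t ^ 2" if "z \<in> C" "z \<star> x = 0" for z
      using R[of "z - (B x z / t) \<bullet>\<^sub>s y"] that xy Bxy t0 gy by (simp add: g_diff g_scal)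
    have L': "g z = (B x z / t) ^ 3 * t ^ 2" if "z \<in> C" "x \<star> z = 0" for z
      using L[of "z - (B x z / t) \<bullet>\<^sub>s y"] that xy Bxy t0 gy by (simp add: g_diff g_scal)
    \<comment> \<open>Linearized flexibility splits \<open>t e\<close> into \<open>a\<close>,
      \<open>c\<close> and a multiple of \<open>x\<close>, with \<open>a \<star> x = 0\<close> and
      \<open>x \<star> c = 0\<close>. Applying \<open>g\<close> gives a relation between
      \<open>1\<close>, \<open>t\<close>, \<open>t^2\<close> whose constant coefficient is
      \<open>t^3 \<noteq> 0\<close>.\<close>
    define a where "a = (x \<star> e) \<star> y - B (x \<star> e) x \<bullet>\<^sub>s x"
    define c where "c = (y \<star> e) \<star> x"
    have aC: "a \<in> C" "c \<in> C" by (simp_all add: a_def c_def)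
    have ax: "a \<star> x = 0" using flexl_lin[of "x \<star> e" y x] xy by (simp add: a_def y_def[symmetric])
    have xc: "x \<star> c = 0" using flexr[of x "y \<star> e"] Nx by (simp add: c_def)
    have "t \<bullet>\<^sub>s e = a + c + B (x \<star> e) x \<bullet>\<^sub>s x"
      using flexl_lin[of x e y] Bxy by (simp add: a_def c_def)
    then have "g (t \<bullet>\<^sub>s e) = g (a + c + B (x \<star> e) x \<bullet>\<^sub>s x)" by simp
    then have "- (t ^ 3) = (B x a / t) ^ 3 * t ^ 2 + (B x c / t) ^ 3 * t ^ 2 + (B (x \<star> e) x) ^ 3 * t"
      using aC R'[OF aC(1) ax] L'[OF aC(2) xc] gx by (simp add: g_add g_scal ge[OF e])
    moreover have "p + r * s + (q1 + q2) * q = 0" if "- p = q1 * q + q2 * q + r * s" for p q r s q1 q2 :: 'f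
      using that by algebra
    ultimately have "t ^ 3 + (B (x \<star> e) x) ^ 3 * t + (B x a / t + B x c / t) ^ 3 * t ^ 2 = 0"
      unfolding cube_add[OF char3] by blast
    from non_cube_independent(1)[OF char3 t this] t0 show False by simp
  qed
  then obtain z where z: "z \<in> C" "z \<star> x = 0" "B x z = 0" "g z \<noteq> 0" by blast
  interpret P: okubo_pair A x z t "g z"
    by unfold_locales (use z gx Nx Nz[of z] in auto)
  obtain c0 c1 c2 where c: "g z = c0 ^ 3 + c1 ^ 3 * t + c2 ^ 3 * t ^ 2" using rng z by blast
  \<comment> \<open>\<open>1 / g z = (g z)\<^sup>2 / (g z)\<^sup>3\<close> has coordinates \<open>a\<^sup>3, - b\<^sup>3, d\<^sup>3\<close> with respect to \<open>1, t, t\<^sup>2\<close>.\<close>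
  define a b d where "a = (c0^2 - c1 * c2 * t) / g z" "b = (c0 * c1 - c2 ^ 2 * t) / g z" "d = (c1 ^ 2 - c0 * c2) / g z"
  have "(c0^2 - c1 * c2 * t) ^ 3 - (c0 * c1 - c2 ^ 2 * t) ^ 3 * t + (c1 ^ 2 - c0 * c2) ^ 3 * t ^ 2
      = (c0 ^ 3 + c1 ^ 3 * t + c2 ^ 3 * t ^ 2)^2 - 3 * (c0 ^ 3 * c1 ^ 3 * t + c0 ^ 3 * c2 ^ 3 * t ^ 2 + c1 ^ 3 * c2 ^ 3 * t ^ 3)"
    unfolding cube_diff[OF char3] by algebra
  then have "(c0^2 - c1 * c2 * t) ^ 3 - (c0 * c1 - c2 ^ 2 * t) ^ 3 * t + (c1 ^ 2 - c0 * c2) ^ 3 * t ^ 2 = (g z) ^ 2"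
    unfolding c by (simp add: char3)
  moreover have "a ^ 3 * g z - b ^ 3 * t * g z + d ^ 3 * t ^ 2 * g z =
    ((c0^2 - c1 * c2 * t) ^ 3 - (c0 * c1 - c2 ^ 2 * t) ^ 3 * t + (c1 ^ 2 - c0 * c2) ^ 3 * t ^ 2) * (g z / g z ^ 3)"
    unfolding a_b_d_def power_divide by (simp add: divide_inverse algebra_simps)
  ultimately have "a ^ 3 * g z - b ^ 3 * t * g z + d ^ 3 * t ^ 2 * g z = 1"
    using z(4) by (simp add: power2_eq_square power3_eq_cube)
  then show ?thesis using P.okubo_pair_change[OF refl, of a b d] by auto
qed

lemma no_idempotent_of_dim_8:
  assumes g8: "has_dim_over field_cubes (cubic_form A ` C) 8"
  shows "\<nexists>e. idempotent A e"
proof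
  assume "\<exists>e. idempotent A e"
  then obtain e where e: "idempotent A e" by blast
  obtain T where T: "finite T" "card T = 8"
    "g ` C = {\<Sum>b\<in>T. c b * b | c. \<forall>b\<in>T. c b \<in> field_cubes}"
    "\<And>c. (\<forall>b\<in>T. c b \<in> field_cubes) \<and> (\<Sum>b\<in>T. c b * b) = 0 \<longrightarrow> (\<forall>b\<in>T. c b = 0)"
    using g8 by (auto simp: has_dim_over_def)
  have cub: "c ^ 3 \<in> field_cubes" for c :: 'f by (auto simp: field_cubes_def)
  have "\<exists>u\<in>C. g u = b" if "b \<in> T" for b
  proof -
    have "(\<Sum>b'\<in>T. (if b' = b then 1 else 0) * b') = (\<Sum>b'\<in>T. if b' = b then b' else 0)"
      by (rule sum.cong) auto
    then have "b = (\<Sum>b'\<in>T. (if b' = b then 1 else 0) * b')" using that T(1) by simp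
    moreover have "(1::'f) \<in> field_cubes" "(0::'f) \<in> field_cubes" using cub[of 1] cub[of 0] by simp_all
    ultimately have "b \<in> {\<Sum>b\<in>T. c b * b | c. \<forall>b\<in>T. c b \<in> field_cubes}"
      by (intro CollectI exI[of _ "\<lambda>b'. if b' = b then 1 else 0"]) auto
    then have "b \<in> g ` C" using T(3) by simp
    then show ?thesis by auto
  qed
  then obtain u where u: "\<And>b. b \<in> T \<Longrightarrow> u b \<in> C" "\<And>b. b \<in> T \<Longrightarrow> g (u b) = b" by metis
  have inj: "inj_on u T" using u(2) by (metis inj_onI)
  \<comment> \<open>\<open>g\<close> turns coefficients into their cubes, so a relation among the
    lifts \<open>u b\<close> becomes one among the elements of \<open>T\<close>. Hence the eight
    lifts form a basis of \<open>C\<close>, and \<open>g\<close> is injective.\<close>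
  have g0: "\<forall>b\<in>T. c b = 0" if "g (\<Sum>b\<in>T. c b \<bullet>\<^sub>s u b) = 0" for c
  proof -
    have "(\<Sum>b\<in>T. c b ^ 3 * b) = 0" using that u by (simp add: g_sum)
    then have "\<forall>b\<in>T. c b ^ 3 = 0" using T(4)[of "\<lambda>b. c b ^ 3"] cub by auto
    then show ?thesis by simp
  qed
  have ind: "independent (u ` T)"
  proof (rule independent_if_scalars_zero)
    fix f z assume a: "(\<Sum>x\<in>u ` T. f x \<bullet>\<^sub>s x) = 0" "z \<in> u ` T"
    then have "(\<Sum>b\<in>T. f (u b) \<bullet>\<^sub>s u b) = 0" using inj by (simp add: sum.reindex)
    then show "f z = 0" using g0[of "\<lambda>b. f (u b)"] a(2) by auto
  qed (use T in simp)
  have span: "span (u ` T) = C"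
  proof -
    obtain S where "finite S" "card S \<le> 8" "span S = C" using dim8 by blast
    then show ?thesis by (rule span_eq_carrier[OF _ _ _ ind]) (use u(1) card_image[OF inj] T(2) in auto)
  qed
  have g_inj: "z = 0" if z: "z \<in> C" "g z = 0" for z
  proof -
    obtain f where "z = (\<Sum>x\<in>u ` T. f x \<bullet>\<^sub>s x)"
      using z(1) span span_finite[of "u ` T"] T(1) by auto
    then have "z = (\<Sum>b\<in>T. f (u b) \<bullet>\<^sub>s u b)" using inj by (simp add: sum.reindex)
    moreover from this have "\<forall>b\<in>T. f (u b) = 0" using g0[of "\<lambda>b. f (u b)"] z(2) by metis
    ultimately show ?thesis by simp
  qed
  have tau: "idem_tau A e z = z" if "z \<in> C" for z
    using g_inj[of "idem_tau A e z - z"] that e by (simp add: tauC[OF e] g_diff g_tau[OF e])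
  obtain z where z: "z \<in> C" "z \<noteq> 0" "B e z = 0"
  proof -
    have "\<forall>h\<in>set [B e]. lin_fun h" using lin_fun_B[OF eC[OF e]] by simp
    moreover have "u ` T \<subseteq> C" "finite (u ` T)" "card (u ` T) > length [B e]"
      using u(1) T(1,2) card_image[OF inj] by auto
    ultimately show ?thesis using common_kernel_set[OF _ ind] that by fastforce
  qed
  have "Tr e z = 0" using z tau triple0[of z] by (simp add: Tr_def[OF e] add.assoc)
  then have "g z = 0" using g_eq_zero[OF e] z by blast
  then show False using g_inj z by blast
qed

end

section \<open>Coordinates for Petersson algebras\<close>

type_synonym 'f kp = "'f \<times> 'f"
type_synonym 'f ep = "'f kp \<times> 'f kp \<times> 'f kp \<times> 'f kp"

definition km :: "'f::field \<Rightarrow> 'f kp \<Rightarrow> 'f kp \<Rightarrow> 'f kp" where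
  "km \<nu> a b = (fst a * fst b - \<nu> * snd a * snd b, fst a * snd b + snd a * fst b)"

definition kc :: "'f::field kp \<Rightarrow> 'f kp" where
  "kc a = (fst a, - snd a)"

text \<open>
  \<open>'f kp\<close> with \<open>km \<nu>\<close> and \<open>kc\<close> is \<open>F[z] / (z\<^sup>2 + \<nu>)\<close> with its conjugation. \<open>EC \<nu> a\<close> is the Cayley
  algebra \<open>K \<oplus> W\<close> in coordinates with respect to an orthonormal \<open>K\<close>-basis of \<open>W\<close> permuted
  cyclically by \<open>\<tau>\<^bsub>K,a\<^esub>\<close>, and \<open>PE \<nu> a\<close> its Petersson algebra.
\<close>

fun emul :: "'f::field \<Rightarrow> 'f kp \<Rightarrow> 'f ep \<Rightarrow> 'f ep \<Rightarrow> 'f ep" where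
  "emul \<nu> a (b,x1,x2,x3) (c,y1,y2,y3) =
   (km \<nu> b c - km \<nu> x1 (kc y1) - km \<nu> x2 (kc y2) - km \<nu> x3 (kc y3),
    km \<nu> b y1 + km \<nu> (kc c) x1 + kc (km \<nu> a (km \<nu> x2 y3 - km \<nu> x3 y2)),
    km \<nu> b y2 + km \<nu> (kc c) x2 + kc (km \<nu> a (km \<nu> x3 y1 - km \<nu> x1 y3)),
    km \<nu> b y3 + km \<nu> (kc c) x3 + kc (km \<nu> a (km \<nu> x1 y2 - km \<nu> x2 y1)))"

fun etau :: "'f::field ep \<Rightarrow> 'f ep" where
  "etau (b,x1,x2,x3) = (b,x3,x1,x2)"

fun ecnj :: "'f::field ep \<Rightarrow> 'f ep" where
  "ecnj (b,x1,x2,x3) = (kc b,-x1,-x2,-x3)"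

definition pmul :: "'f::field \<Rightarrow> 'f kp \<Rightarrow> 'f ep \<Rightarrow> 'f ep \<Rightarrow> 'f ep" where
  "pmul \<nu> a x y = emul \<nu> a (etau (ecnj x)) (etau (etau (ecnj y)))"

fun enrm :: "'f::field \<Rightarrow> 'f ep \<Rightarrow> 'f" where
  "enrm \<nu> ((b0,b1),(x10,x11),(x20,x21),(x30,x31)) =
   b0^2 + \<nu>*b1^2 + (x10^2 + \<nu>*x11^2) + (x20^2 + \<nu>*x21^2) + (x30^2 + \<nu>*x31^2)"

fun esm :: "'f::field \<Rightarrow> 'f ep \<Rightarrow> 'f ep" where
  "esm c ((b0,b1),(x10,x11),(x20,x21),(x30,x31)) =
   ((c*b0,c*b1),(c*x10,c*x11),(c*x20,c*x21),(c*x30,c*x31))"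

definition EC :: "'f::field \<Rightarrow> 'f kp \<Rightarrow> ('f, 'f ep) nalg" where
  "EC \<nu> a = \<lparr>carr = UNIV, smul = esm, mul = emul \<nu> a, nrm = enrm \<nu>\<rparr>"

definition PE :: "'f::field \<Rightarrow> 'f kp \<Rightarrow> ('f, 'f ep) nalg" where
  "PE \<nu> a = \<lparr>carr = UNIV, smul = esm, mul = pmul \<nu> a, nrm = enrm \<nu>\<rparr>"

lemma PE_sel[simp]: "carr (PE \<nu> a) = UNIV" "smul (PE \<nu> a) = esm" "mul (PE \<nu> a) = pmul \<nu> a"
  "nrm (PE \<nu> a) = enrm \<nu>"
  and EC_sel[simp]: "carr (EC \<nu> a) = UNIV" "smul (EC \<nu> a) = esm" "mul (EC \<nu> a) = emul \<nu> a"
  "nrm (EC \<nu> a) = enrm \<nu>"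
  by (simp_all add: PE_def EC_def)

lemma ep_cases:
  obtains b0 b1 x1 x2 x3 x4 x5 x6 where "x = ((b0,b1),(x1,x2),(x3,x4),(x5,x6))"
  by (metis surj_pair)

lemmas ep_simps = pmul_def km_def kc_def zero_prod_def plus_prod_def minus_prod_def uminus_prod_def

lemma vector_space_esm: "vector_space esm"
  by unfold_locales (auto simp: plus_prod_def algebra_simps)

lemma polar_PE: "polar (PE \<nu> a) ((b0,b1),(x10,x11),(x20,x21),(x30,x31)) ((c0,c1),(y10,y11),(y20,y21),(y30,y31)) =
   2*(b0*c0 + \<nu>*b1*c1 + (x10*y10 + \<nu>*x11*y11) + (x20*y20 + \<nu>*x21*y21) + (x30*y30 + \<nu>*x31*y31))"
  by (simp add: polar_def power2_eq_square algebra_simps)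

lemma normed_algebra_PE: "normed_algebra (PE \<nu> a)"
proof -
  interpret vector_space esm by (rule vector_space_esm)
  have "pmul \<nu> a (x + y) z = pmul \<nu> a x z + pmul \<nu> a y z \<and> pmul \<nu> a z (x + y) = pmul \<nu> a z x + pmul \<nu> a z y"
    for x y z
    by (cases x rule: ep_cases, cases y rule: ep_cases, cases z rule: ep_cases)
      (simp add: ep_simps algebra_simps)
  moreover have "pmul \<nu> a (esm c x) y = esm c (pmul \<nu> a x y) \<and> pmul \<nu> a x (esm c y) = esm c (pmul \<nu> a x y)"
    for x y c
    by (cases x rule: ep_cases, cases y rule: ep_cases) (simp add: ep_simps algebra_simps)
  moreover have "enrm \<nu> (esm c x) = c^2 * enrm \<nu> x" for x c
    by (cases x rule: ep_cases) (simp add: algebra_simps power2_eq_square)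
  moreover have "polar (PE \<nu> a) (x + y) z = polar (PE \<nu> a) x z + polar (PE \<nu> a) y z" for x y z
    by (cases x rule: ep_cases, cases y rule: ep_cases, cases z rule: ep_cases)
      (simp add: polar_PE algebra_simps)
  moreover have "polar (PE \<nu> a) (esm c x) y = c * polar (PE \<nu> a) x y" for x y c
    by (cases x rule: ep_cases, cases y rule: ep_cases) (simp add: polar_PE algebra_simps)
  ultimately show ?thesis
    by (simp add: normed_algebra_def bilinear_mul_def quadratic_nrm_def vector_space_esm)
qed

lemma pmul_flexl:
  assumes "fst a^2 + \<nu> * snd a^2 = 1"
  shows "pmul \<nu> a (pmul \<nu> a x y) x = esm (enrm \<nu> x) y"
proof (cases x rule: ep_cases, cases y rule: ep_cases)
  obtain p q where a: "a = (p,q)" by (cases a)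
  have pq: "p^2 + \<nu> * q^2 = 1" using assms a by simp
  fix b0 b1 x1 x2 x3 x4 x5 x6 c0 c1 y1 y2 y3 y4 y5 y6
  assume x: "x = ((b0,b1),(x1,x2),(x3,x4),(x5,x6))" and y: "y = ((c0,c1),(y1,y2),(y3,y4),(y5,y6))"
  show ?thesis unfolding a x y
    by (simp add: ep_simps; intro conjI; (algebra | use pq in algebra))
qed

lemma pmul_flexr:
  assumes "fst a^2 + \<nu> * snd a^2 = 1"
  shows "pmul \<nu> a x (pmul \<nu> a y x) = esm (enrm \<nu> x) y"
proof (cases x rule: ep_cases, cases y rule: ep_cases)
  obtain p q where a: "a = (p,q)" by (cases a)
  have pq: "p^2 + \<nu> * q^2 = 1" using assms a by simp
  fix b0 b1 x1 x2 x3 x4 x5 x6 c0 c1 y1 y2 y3 y4 y5 y6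
  assume x: "x = ((b0,b1),(x1,x2),(x3,x4),(x5,x6))" and y: "y = ((c0,c1),(y1,y2),(y3,y4),(y5,y6))"
  show ?thesis unfolding a x y
    by (simp add: ep_simps; intro conjI; (algebra | use pq in algebra))
qed

lemma pmul_assoc: "polar (PE \<nu> a) (pmul \<nu> a x y) z = polar (PE \<nu> a) x (pmul \<nu> a y z)"
proof (cases x rule: ep_cases, cases y rule: ep_cases, cases z rule: ep_cases)
  obtain p q where a: "a = (p,q)" by (cases a)
  fix b0 b1 x1 x2 x3 x4 x5 x6 c0 c1 y1 y2 y3 y4 y5 y6 d0 d1 z1 z2 z3 z4 z5 z6
  assume x: "x = ((b0,b1),(x1,x2),(x3,x4),(x5,x6))" and y: "y = ((c0,c1),(y1,y2),(y3,y4),(y5,y6))"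
    and z: "z = ((d0,d1),(z1,z2),(z3,z4),(z5,z6))"
  show ?thesis unfolding a x y z by (simp add: ep_simps polar_PE) algebra
qed

lemma symcomp_PE:
  assumes 3: "(3::'f::field) = 0" and nu: "\<nu> \<noteq> (0::'f)" and a: "fst a^2 + \<nu> * snd a^2 = 1"
  shows "symcomp (PE \<nu> a)"
proof unfold_locales
  show "normed_algebra (PE \<nu> a)" by (rule normed_algebra_PE)
  interpret vector_space esm by (rule vector_space_esm)
  have 2: "(2::'f) \<noteq> 0"
  proof
    assume "(2::'f) = 0"
    then have "(3::'f) - 2 = 0" using 3 by simp
    then show False by simp
  qed
  show "x = 0" if "x \<in> carr (PE \<nu> a)" "\<And>y. y \<in> carr (PE \<nu> a) \<Longrightarrow> polar (PE \<nu> a) x y = 0" for x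
  proof (cases x rule: ep_cases)
    fix b0 b1 x1 x2 x3 x4 x5 x6 assume x: "x = ((b0,b1),(x1,x2),(x3,x4),(x5,x6))"
    have p: "polar (PE \<nu> a) x y = 0" for y using that by simp
    show ?thesis
      using p[of "((1,0),(0,0),(0,0),(0,0))"] p[of "((0,1),(0,0),(0,0),(0,0))"]
        p[of "((0,0),(1,0),(0,0),(0,0))"] p[of "((0,0),(0,1),(0,0),(0,0))"]
        p[of "((0,0),(0,0),(1,0),(0,0))"] p[of "((0,0),(0,0),(0,1),(0,0))"]
        p[of "((0,0),(0,0),(0,0),(1,0))"] p[of "((0,0),(0,0),(0,0),(0,1))"]
      unfolding x polar_PE using 2 nu by (simp add: zero_prod_def)
  qed
  define bs :: "'f ep list" where "bs = [((1,0),(0,0),(0,0),(0,0)), ((0,1),(0,0),(0,0),(0,0)),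
    ((0,0),(1,0),(0,0),(0,0)), ((0,0),(0,1),(0,0),(0,0)), ((0,0),(0,0),(1,0),(0,0)), ((0,0),(0,0),(0,1),(0,0)),
    ((0,0),(0,0),(0,0),(1,0)), ((0,0),(0,0),(0,0),(0,1))]"
  have "x \<in> span (set bs)" for x
  proof (cases x rule: ep_cases)
    fix b0 b1 x1 x2 x3 x4 x5 x6 assume x: "x = ((b0,b1),(x1,x2),(x3,x4),(x5,x6))"
    have "x = esm b0 (bs!0) + esm b1 (bs!1) + esm x1 (bs!2) + esm x2 (bs!3) + esm x3 (bs!4) + esm x4 (bs!5)
      + esm x5 (bs!6) + esm x6 (bs!7)" by (simp add: x bs_def)
    moreover have "bs ! i \<in> span (set bs)" if "i < 8" for i using that
      by (intro span_base nth_mem) (simp add: bs_def)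
    ultimately show ?thesis by (auto intro!: span_add span_scale)
  qed
  then have "span (set bs) = carr (PE \<nu> a)" by auto
  moreover have "card (set bs) \<le> 8" using card_length[of bs] by (simp add: bs_def)
  ultimately show "\<exists>S. finite S \<and> card S \<le> 8 \<and> module.span (smul (PE \<nu> a)) S = carr (PE \<nu> a)"
    by (intro exI[of _ "set bs"]) simp
qed (use 3 a in \<open>simp_all add: pmul_flexl pmul_flexr pmul_assoc\<close>)

text \<open>Only pure cubes survive in characteristic 3; the long polynomial is one third of the
  difference of the two sides before reduction. The coordinates in \<open>W\<close> enter through
  their sums alone.\<close>

lemma cubic_PE:
  fixes \<nu> :: "'f::field"
  assumes 3: "(3::'f::field) = 0"
  shows "cubic_form (PE \<nu> (p,q)) ((x0,x1),(x2,x3),(x4,x5),(x6,x7)) =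
    - (x0 ^ 3) - p * (x2 + x4 + x6) ^ 3 - q * \<nu>\<^sup>2 * (x3 + x5 + x7) ^ (3::nat)"
proof -
  have "cubic_form (PE \<nu> (p,q)) ((x0,x1),(x2,x3),(x4,x5),(x6,x7)) =
    - (x0 ^ 3) - p * (x2 ^ 3 + x4 ^ 3 + x6 ^ 3) - q * \<nu>\<^sup>2 * (x3 ^ 3 + x5 ^ 3 + x7 ^ 3) + 3 * (- (2 * \<nu> * p * x2 * x3^2) + 2 * \<nu> * p * x2 * x5 * x7 + 2 * \<nu> * p * x3 * x4 * x7 + 2 * \<nu> * p * x3 * x5 * x6 - 2 * \<nu> * p * x4 * x5^2 - 2 * \<nu> * p * x6 * x7^2 + 2 * \<nu> * q * x2 * x4 * x7 + 2 * \<nu> * q * x2 * x5 * x6 - 2 * \<nu> * q * x2^2 * x3 + 2 * \<nu> * q * x3 * x4 * x6 - 2 * \<nu> * q * x4^2 * x5 - 2 * \<nu> * q * x6^2 * x7 - 2 * \<nu> * x0 * x1^2 - 2 * \<nu> * x0 * x3 * x5 - 2 * \<nu> * x0 * x3 * x7 - 2 * \<nu> * x0 * x5 * x7 - 2 * \<nu> * x1 * x2 * x5 + 2 * \<nu> * x1 * x2 * x7 + 2 * \<nu> * x1 * x3 * x4 - 2 * \<nu> * x1 * x3 * x6 - 2 * \<nu> * x1 * x4 * x7 + 2 * \<nu> * x1 * x5 * x6 - 2 * \<nu>^2 * q * x3 * x5 * x7 + \<nu>^2 * q * x3^3 + \<nu>^2 * q * x5^3 + \<nu>^2 * q * x7^3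 - 2 * p * x2 * x4 * x6 + p * x2^3 + p * x4^3 + p * x6^3 - 2 * x0 * x2 * x4 - 2 * x0 * x2 * x6 - 2 * x0 * x4 * x6 + x0^3)"
    by (simp add: cubic_form_def polar_PE ep_simps) algebra
  then show ?thesis by (simp only: 3 cube_add[OF 3] mult_zero_left add_0_right)
qed

text \<open>The values \<open>1\<close> and \<open>\<nu>^3\<close> are those of the pair in
  \<open>okubo_pair_MO\<close>. For \<open>a = 1\<close> the form \<open>g\<close> is minus the cube
  of the sum of the first components, which makes them easy to arrange; norms and the product vanish
  as multiples of 3.\<close>

lemma okubo_pair_PE:
  fixes \<nu> :: "'f::field"
  assumes 3: "(3::'f) = 0" and nu: "\<nu> \<noteq> 0"
  shows "okubo_pair (PE \<nu> (1,0)) ((0,0),(1,1),(-1,1),(-1,-1)) ((- \<nu>,1),(0,0),(\<nu>,-1),(- \<nu>,-1)) 1 (\<nu> ^ 3)"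
proof -
  interpret symcomp "PE \<nu> (1,0)" using 3 nu by (intro symcomp_PE) auto
  show ?thesis
  proof unfold_locales
    have "enrm \<nu> ((0,0),(1,1),(-1,1),(-1,-1)) = 3 * (1 + \<nu>)" by simp
    then show "N ((0,0),(1,1),(-1,1),(-1,-1)) = 0" by (simp add: 3)
    have "enrm \<nu> ((- \<nu>,1),(0,0),(\<nu>,-1),(- \<nu>,-1)) = 3 * (\<nu> + \<nu>^2)" by simp
    then show "N ((- \<nu>,1),(0,0),(\<nu>,-1),(- \<nu>,-1)) = 0" by (simp add: 3)
    show "B ((0,0),(1,1),(-1,1),(-1,-1)) ((- \<nu>,1),(0,0),(\<nu>,-1),(- \<nu>,-1)) = 0"
      by (simp add: polar_PE)
    have "pmul \<nu> (1,0) ((- \<nu>,1),(0,0),(\<nu>,-1),(- \<nu>,-1)) ((0,0),(1,1),(-1,1),(-1,-1))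
      = ((0,0),(0,0),(0,- 3 * (1 + \<nu>)),(0,0))" by (simp add: ep_simps)
    then show "mul (PE \<nu> (1,0)) ((- \<nu>,1),(0,0),(\<nu>,-1),(- \<nu>,-1)) ((0,0),(1,1),(-1,1),(-1,-1)) = 0"
      by (simp add: 3 zero_prod_def)
    show "g ((0,0),(1,1),(-1,1),(-1,-1)) = 1" by (simp add: cubic_PE[OF 3])
    have "- ((- \<nu>) ^ 3) = \<nu> ^ 3" by simp
    then show "g ((- \<nu>,1),(0,0),(\<nu>,-1),(- \<nu>,-1)) = \<nu> ^ 3" by (simp add: cubic_PE[OF 3])
  qed auto
qed

section \<open>The split Okubo algebra on the double of the matrix algebra\<close>

type_synonym 'f mp = "'f \<times> 'f \<times> 'f \<times> 'f \<times> 'f \<times> 'f \<times> 'f \<times> 'f"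

text \<open>
  An element is a pair \<open>(p, r)\<close> of \<open>2 \<times> 2\<close> matrices, listed by rows. With \<open>w = 1 + E\<^sub>1\<^sub>2\<close> and
  \<open>p'\<close> the adjugate of \<open>p\<close>, the product of \<open>(p, r)\<close> and \<open>(q, s)\<close> is
  \<open>(p' q' + s' w\<^sup>2 r, - (w\<^sup>2 s p' + w r q))\<close> and the norm is \<open>det p - det r\<close>: the Petersson algebra
  of the Cayley-Dickson double for the automorphism \<open>(p, r) \<mapsto> (p, w r)\<close>.
\<close>

fun mmul :: "'f::field mp \<Rightarrow> 'f mp \<Rightarrow> 'f mp" where
  "mmul (x0,x1,x2,x3,x4,x5,x6,x7) (y0,y1,y2,y3,y4,y5,y6,y7) =
   (x1*y2 + x3*y3 + x4*y7 - x6*y5 - x6*y7, - x1*y0 - x3*y1 + x5*y7 - x7*y5 - x7*y7,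
    - x0*y2 - x2*y3 - x4*y6 + x6*y4 + x6*y6, x0*y0 + x2*y1 - x5*y6 + x7*y4 + x7*y6,
    x2*y5 - x2*y7 - x3*y4 + x3*y6 - x4*y0 - x5*y2 - x6*y0 - x7*y2,
    - x0*y5 + x0*y7 + x1*y4 - x1*y6 - x4*y1 - x5*y3 - x6*y1 - x7*y3,
    x2*y7 - x3*y6 - x6*y0 - x7*y2, - x0*y7 + x1*y6 - x6*y1 - x7*y3)"

fun mnrm :: "'f::field mp \<Rightarrow> 'f" where
  "mnrm (x0,x1,x2,x3,x4,x5,x6,x7) = x0*x3 - x1*x2 - x4*x7 + x5*x6"

fun msm :: "'f::field \<Rightarrow> 'f mp \<Rightarrow> 'f mp" where
  "msm c (x0,x1,x2,x3,x4,x5,x6,x7) = (c*x0,c*x1,c*x2,c*x3,c*x4,c*x5,c*x6,c*x7)"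

definition MO :: "('f::field, 'f mp) nalg" where
  "MO = \<lparr>carr = UNIV, smul = msm, mul = mmul, nrm = mnrm\<rparr>"

lemma MO_sel[simp]: "carr MO = UNIV" "smul MO = msm" "mul MO = mmul" "nrm MO = mnrm"
  by (simp_all add: MO_def)

lemma mp_cases:
  obtains x0 x1 x2 x3 x4 x5 x6 x7 where "x = (x0,x1,x2,x3,x4,x5,x6,x7)"
  by (metis surj_pair)

lemma vector_space_msm: "vector_space msm"
  by unfold_locales (auto simp: plus_prod_def algebra_simps)

lemma polar_MO: "polar MO (x0,x1,x2,x3,x4,x5,x6,x7) (y0,y1,y2,y3,y4,y5,y6,y7) =
   x0*y3 + y0*x3 - x1*y2 - y1*x2 - x4*y7 - y4*x7 + x5*y6 + y5*x6"
  by (simp add: polar_def algebra_simps)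

lemma normed_algebra_MO: "normed_algebra MO"
proof -
  interpret vector_space msm by (rule vector_space_msm)
  have "mmul (x + y) z = mmul x z + mmul y z \<and> mmul z (x + y) = mmul z x + mmul z y"
    for x y z :: "'a mp"
    by (cases x rule: mp_cases, cases y rule: mp_cases, cases z rule: mp_cases)
      (simp add: algebra_simps)
  moreover have "mmul (msm c x) y = msm c (mmul x y) \<and> mmul x (msm c y) = msm c (mmul x y)"
    for x y :: "'a mp" and c
    by (cases x rule: mp_cases, cases y rule: mp_cases) (simp add: algebra_simps)
  moreover have "mnrm (msm c x) = c^2 * mnrm x" for x :: "'a mp" and c
    by (cases x rule: mp_cases) (simp add: algebra_simps power2_eq_square)
  moreover have "polar MO (x + y) z = polar MO x z + polar MO y z" for x y z :: "'a mp"
    by (cases x rule: mp_cases, cases y rule: mp_cases, cases z rule: mp_cases)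
      (simp add: polar_MO algebra_simps)
  moreover have "polar MO (msm c x) y = c * polar MO x y" for x y :: "'a mp" and c
    by (cases x rule: mp_cases, cases y rule: mp_cases) (simp add: polar_MO algebra_simps)
  ultimately show ?thesis
    by (simp add: normed_algebra_def bilinear_mul_def quadratic_nrm_def vector_space_msm)
qed

text \<open>
  A polynomial identity valid only modulo \<open>3\<close> is proved by exhibiting the polynomial \<open>X\<close> whose
  triple is the difference of the two sides.
\<close>

lemma char3_eqI: "(3::'f::field) = 0 \<Longrightarrow> L = R + 3 * X \<Longrightarrow> L = (R::'f)"
  by simp

lemma char3_two_neq_0: "(3::'f::field) = 0 \<Longrightarrow> (2::'f) \<noteq> 0"
proof
  assume "(3::'f) = 0" "(2::'f) = 0"
  then have "(3::'f) - 2 = 0" by simp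
  then show False by simp
qed

lemma mmul_flexl:
  assumes 3: "(3::'f::field) = 0"
  shows "mmul (mmul x y) (x::'f mp) = msm (mnrm x) y"
proof (cases x rule: mp_cases, cases y rule: mp_cases)
  fix x0 x1 x2 x3 x4 x5 x6 x7 y0 y1 y2 y3 y4 y5 y6 y7
  assume x: "x = (x0,x1,x2,x3,x4,x5,x6,x7)" and y: "y = (y0,y1,y2,y3,y4,y5,y6,y7)"
  show ?thesis unfolding x y mmul.simps mnrm.simps msm.simps prod.inject
    by (intro conjI)
      ((rule char3_eqI[OF 3, where X="- (x2 * x7 * y7) + x3 * x7 * y6"], algebra),
       (rule char3_eqI[OF 3, where X="x0 * x7 * y7 - x1 * x7 * y6"], algebra),
       (rule char3_eqI[OF 3, where X="x2 * x6 * y7 - x3 * x6 * y6"], algebra),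
       (rule char3_eqI[OF 3, where X="- (x0 * x6 * y7) + x1 * x6 * y6"], algebra),
       (rule char3_eqI[OF 3, where X="x0 * x6 * y0 + x0 * x7 * y2 + x2 * x6 * y1 + x2 * x7 * y3"], algebra),
       (rule char3_eqI[OF 3, where X="x1 * x6 * y0 + x1 * x7 * y2 + x3 * x6 * y1 + x3 * x7 * y3"], algebra), algebra, algebra)
qed

lemma mmul_flexr:
  assumes 3: "(3::'f::field) = 0"
  shows "mmul x (mmul y (x::'f mp)) = msm (mnrm x) y"
proof (cases x rule: mp_cases, cases y rule: mp_cases)
  fix x0 x1 x2 x3 x4 x5 x6 x7 y0 y1 y2 y3 y4 y5 y6 y7
  assume x: "x = (x0,x1,x2,x3,x4,x5,x6,x7)" and y: "y = (y0,y1,y2,y3,y4,y5,y6,y7)"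
  show ?thesis unfolding x y mmul.simps mnrm.simps msm.simps prod.inject
    by (intro conjI)
      ((rule char3_eqI[OF 3, where X="x1 * x6 * y6 + x3 * x6 * y7"], algebra),
       (rule char3_eqI[OF 3, where X="x1 * x7 * y6 + x3 * x7 * y7"], algebra),
       (rule char3_eqI[OF 3, where X="- (x0 * x6 * y6) - x2 * x6 * y7"], algebra),
       (rule char3_eqI[OF 3, where X="- (x0 * x7 * y6) - x2 * x7 * y7"], algebra),
       (rule char3_eqI[OF 3, where X="- (x2 * x6 * y1) + x2 * x7 * y0 - x3 * x6 * y3 + x3 * x7 * y2"], algebra),
       (rule char3_eqI[OF 3, where X="x0 * x6 * y1 - x0 * x7 * y0 + x1 * x6 * y3 - x1 * x7 * y2"], algebra), algebra, algebra)
qed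

lemma mmul_assoc: "polar MO (mmul x y) z = polar MO x (mmul y z)"
proof (cases x rule: mp_cases, cases y rule: mp_cases, cases z rule: mp_cases)
  fix x0 x1 x2 x3 x4 x5 x6 x7 y0 y1 y2 y3 y4 y5 y6 y7 z0 z1 z2 z3 z4 z5 z6 z7
  assume x: "x = (x0,x1,x2,x3,x4,x5,x6,x7)" and y: "y = (y0,y1,y2,y3,y4,y5,y6,y7)"
    and z: "z = (z0,z1,z2,z3,z4,z5,z6,z7)"
  show ?thesis unfolding x y z by (simp only: mmul.simps polar_MO) algebra
qed

lemma symcomp_MO:
  assumes 3: "(3::'f::field) = 0"
  shows "symcomp (MO :: ('f, 'f mp) nalg)"
proof unfold_locales
  let ?A = "MO :: ('f, 'f mp) nalg"
  show "normed_algebra ?A" by (rule normed_algebra_MO)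
  interpret vector_space "msm :: 'f \<Rightarrow> _" by (rule vector_space_msm)
  show "x = 0" if "x \<in> carr ?A" "\<And>y. y \<in> carr ?A \<Longrightarrow> polar ?A x y = 0" for x
  proof (cases x rule: mp_cases)
    fix x0 x1 x2 x3 x4 x5 x6 x7 assume x: "x = (x0,x1,x2,x3,x4,x5,x6,x7)"
    have p: "polar ?A x y = 0" for y using that by simp
    show ?thesis
      using p[of "(1,0,0,0,0,0,0,0)"] p[of "(0,1,0,0,0,0,0,0)"] p[of "(0,0,1,0,0,0,0,0)"]
        p[of "(0,0,0,1,0,0,0,0)"] p[of "(0,0,0,0,1,0,0,0)"] p[of "(0,0,0,0,0,1,0,0)"]
        p[of "(0,0,0,0,0,0,1,0)"] p[of "(0,0,0,0,0,0,0,1)"]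
      unfolding x polar_MO by (simp add: zero_prod_def)
  qed
  define bs :: "'f mp list" where "bs = [(1,0,0,0,0,0,0,0), (0,1,0,0,0,0,0,0), (0,0,1,0,0,0,0,0),
    (0,0,0,1,0,0,0,0), (0,0,0,0,1,0,0,0), (0,0,0,0,0,1,0,0), (0,0,0,0,0,0,1,0), (0,0,0,0,0,0,0,1)]"
  have "x \<in> span (set bs)" for x
  proof (cases x rule: mp_cases)
    fix x0 x1 x2 x3 x4 x5 x6 x7 assume x: "x = (x0,x1,x2,x3,x4,x5,x6,x7)"
    have "x = msm x0 (bs!0) + msm x1 (bs!1) + msm x2 (bs!2) + msm x3 (bs!3) + msm x4 (bs!4) + msm x5 (bs!5)
      + msm x6 (bs!6) + msm x7 (bs!7)" by (simp add: x bs_def)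
    moreover have "bs ! i \<in> span (set bs)" if "i < 8" for i using that
      by (intro span_base nth_mem) (simp add: bs_def)
    ultimately show ?thesis by (auto intro!: span_add span_scale)
  qed
  then have "span (set bs) = carr ?A" by auto
  moreover have "card (set bs) \<le> 8" using card_length[of bs] by (simp add: bs_def)
  ultimately show "\<exists>S. finite S \<and> card S \<le> 8 \<and> module.span (smul ?A) S = carr ?A"
    by (intro exI[of _ "set bs"]) simp
qed (use 3 in \<open>simp_all add: mmul_flexl mmul_flexr mmul_assoc\<close>)

text \<open>The value is the cube of the trace of the first matrix. That \<open>g\<close> takes only
  cubes in the split algebra is what merges all classes over a given \<open>K\<close> into
  one.\<close>

lemma cubic_MO:
  fixes x0 :: "'f::field"
  assumes 3: "(3::'f) = 0"
  shows "cubic_form MO (x0,x1,x2,x3,x4,x5,x6,x7) = (x0 + x3) ^ 3"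
proof -
  have "cubic_form MO (x0,x1,x2,x3,x4,x5,x6,x7) = x0 ^ 3 + x3 ^ 3 + 3 * (x0 * x1 * x2 + x0 * x4 * x7 - x0 * x5 * x6 + x0 * x6 * x7 + x1 * x2 * x3 - x1 * x6^2 + x2 * x7^2 + x3 * x4 * x7 - x3 * x5 * x6 - x3 * x6 * x7)"
    by (simp only: cubic_form_def MO_sel polar_MO mmul.simps) algebra
  then show ?thesis by (simp only: 3 cube_add[OF 3] mult_zero_left add_0_right)
qed

text \<open>The elements are \<open>(E_22, E_22)\<close> and
  \<open>(\<nu> E_22, \<nu> E_21)\<close>: the matrices have rank at most one, so the norms vanish,
  and the traces \<open>1\<close> and \<open>\<nu>\<close> give the values of
  \<open>g\<close>.\<close>

lemma okubo_pair_MO: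
  fixes \<nu> :: "'f::field"
  assumes 3: "(3::'f) = 0"
  shows "okubo_pair MO (0,0,0,1,0,0,0,1) (0,0,0,\<nu>,0,0,\<nu>,0) 1 (\<nu> ^ 3)"
proof -
  interpret symcomp "MO :: ('f, 'f mp) nalg" using 3 by (rule symcomp_MO)
  show ?thesis
    by unfold_locales (simp_all add: cubic_MO[OF 3] polar_MO zero_prod_def)
qed

text \<open>The second row of \<open>r\<close> is zero, and \<open>p\<close> has trace
  \<open>- 1\<close> and determinant \<open>1\<close>, hence characteristic polynomial
  \<open>X^2 + X + 1 = (X - 1)^2\<close>, which makes \<open>p\<close> unipotent. The trace comes
  from \<open>g e = - 1\<close> and the determinant from \<open>N e = 1\<close>.\<close>

lemma idempotent_MO_iff:
  fixes x0 :: "'f::field"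
  assumes 3: "(3::'f) = 0"
  shows "idempotent MO (x0,x1,x2,x3,x4,x5,x6,x7) \<longleftrightarrow>
    x6 = 0 \<and> x7 = 0 \<and> x3 = - 1 - x0 \<and> x0 * x3 - x1 * x2 = 1"
proof
  interpret symcomp "MO :: ('f, 'f mp) nalg" using 3 by (rule symcomp_MO)
  let ?e = "(x0,x1,x2,x3,x4,x5,x6,x7)"
  assume e: "idempotent MO ?e"
  have "(x0 + x3 + 1) ^ 3 = 0" using ge[OF e] by (simp add: cubic_MO[OF 3] cube_add[OF 3])
  then have x3: "x3 = - 1 - x0" by (simp add: algebra_simps eq_neg_iff_add_eq_0)
  have m: "mmul ?e ?e = ?e" using e by (simp add: idempotent_def)
  have n: "x0 * x3 - x1 * x2 - x4 * x7 + x5 * x6 = 1" using Ne[OF e] by simp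
  have x7: "x7 = 0"
  proof -
    have "x1 - x7 * x7 = x1" using m by (simp add: x3 algebra_simps)
    then show ?thesis by simp
  qed
  have x6: "x6 = 0"
  proof -
    have "x2 + x6 * x6 = x2" using m by (simp add: x3 algebra_simps)
    then show ?thesis by simp
  qed
  show "x6 = 0 \<and> x7 = 0 \<and> x3 = - 1 - x0 \<and> x0 * x3 - x1 * x2 = 1"
    using n by (simp add: x3 x6 x7)
next
  assume a: "x6 = 0 \<and> x7 = 0 \<and> x3 = - 1 - x0 \<and> x0 * x3 - x1 * x2 = 1"
  then have b: "x1 * x2 = x0 * x3 - 1" "x2 * x1 = x0 * x3 - 1" by (simp_all add: algebra_simps)
  have "x0 \<noteq> 0 \<or> x1 \<noteq> 0" using a by auto
  then show "idempotent MO (x0,x1,x2,x3,x4,x5,x6,x7)"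
    using a by (simp add: idempotent_def zero_prod_def b) (auto simp: algebra_simps)
qed

text \<open>
  \<open>fU\<close>, \<open>fJ\<close> and \<open>fD\<close> are the automorphisms \<open>(p, r) \<mapsto> (h p h\<^sup>-\<^sup>1, r h\<^sup>-\<^sup>1)\<close> with \<open>h\<close> unipotent, the
  Weyl element and diagonal. \<open>fT\<close> and \<open>fS\<close> are the exponentials of \<open>s D\<close> for two nilpotent
  derivations \<open>D\<close>; as \<open>1 / 2 = - 1\<close>, the quadratic term is \<open>- s\<^sup>2 D\<^sup>2\<close>.
\<close>

fun fU :: "'f::field \<Rightarrow> 'f mp \<Rightarrow> 'f mp" where
  "fU s (x0,x1,x2,x3,x4,x5,x6,x7) =
   (x0 + s*x2, x1 + s*x3 - s*x0 - s^2*x2, x2, x3 - s*x2, x4, x5 - s*x4, x6, x7 - s*x6)"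

fun fJ :: "'f::field mp \<Rightarrow> 'f mp" where
  "fJ (x0,x1,x2,x3,x4,x5,x6,x7) = (x3, - x2, - x1, x0, x5, - x4, x7, - x6)"

fun fJ' :: "'f::field mp \<Rightarrow> 'f mp" where
  "fJ' (x0,x1,x2,x3,x4,x5,x6,x7) = (x3, - x2, - x1, x0, - x5, x4, - x7, x6)"

fun fD :: "'f::field \<Rightarrow> 'f mp \<Rightarrow> 'f mp" where
  "fD a (x0,x1,x2,x3,x4,x5,x6,x7) =
   (x0, a^2*x1, x2 / a^2, x3, x4 / a, a*x5, x6 / a, a*x7)"

fun fT :: "'f::field \<Rightarrow> 'f mp \<Rightarrow> 'f mp" where
  "fT s (x0,x1,x2,x3,x4,x5,x6,x7) = (x0, x1, x2 + s*x7, x3, x4 - s*x1, x5, x6, x7)"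

fun fS :: "'f::field \<Rightarrow> 'f mp \<Rightarrow> 'f mp" where
  "fS s (x0,x1,x2,x3,x4,x5,x6,x7) =
   (x0 + s*x7, x1, x2 + s*x6, x3 - s*x7, x4 - s*x0 + s*x3 - s^2*x7, x5 + s*x1, x6, x7)"

lemma alg_iso_MOI:
  assumes "\<And>x y. f (x + y) = f x + f y" "\<And>c x. f (msm c x) = msm c (f x)"
    "\<And>x y. f (mmul x y) = mmul (f x) (f y)" "\<And>x. mnrm (f x) = mnrm x"
    "\<And>x. h (f x) = x" "\<And>x. f (h x) = x"
  shows "alg_iso MO MO f"
  unfolding alg_iso_def using assms bij_betw_byWitness[of UNIV h f UNIV] by simp

lemma alg_iso_fU: "alg_iso MO MO (fU s)"
proof (rule alg_iso_MOI[where h = "fU (- s)"])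
  fix x y c
  show "fU s (x + y) = fU s x + fU s y" "fU s (mmul x y) = mmul (fU s x) (fU s y)"
    by (cases x rule: mp_cases, cases y rule: mp_cases, simp add: algebra_simps power2_eq_square)+
  show "fU s (msm c x) = msm c (fU s x)" "mnrm (fU s x) = mnrm x"
    "fU (- s) (fU s x) = x" "fU s (fU (- s) x) = x"
    by (cases x rule: mp_cases, simp add: algebra_simps power2_eq_square)+
qed

lemma alg_iso_fJ: "alg_iso MO MO fJ"
proof (rule alg_iso_MOI[where h = fJ'])
  fix x y :: "'a mp" and c
  show "fJ (x + y) = fJ x + fJ y" "fJ (mmul x y) = mmul (fJ x) (fJ y)"
    by (cases x rule: mp_cases, cases y rule: mp_cases, simp add: algebra_simps)+
  show "fJ (msm c x) = msm c (fJ x)" "mnrm (fJ x) = mnrm x" "fJ' (fJ x) = x" "fJ (fJ' x) = x"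
    by (cases x rule: mp_cases, simp add: algebra_simps)+
qed

lemma alg_iso_fD: assumes "a \<noteq> 0" shows "alg_iso MO MO (fD a)"
proof (rule alg_iso_MOI[where h = "fD (1 / a)"])
  fix x y c
  show "fD a (x + y) = fD a x + fD a y" "fD a (mmul x y) = mmul (fD a x) (fD a y)"
    using assms
    by (cases x rule: mp_cases, cases y rule: mp_cases, simp add: field_simps power2_eq_square)+
  show "fD a (msm c x) = msm c (fD a x)" "mnrm (fD a x) = mnrm x"
    "fD (1 / a) (fD a x) = x" "fD a (fD (1 / a) x) = x"
    using assms by (cases x rule: mp_cases, simp add: field_simps power2_eq_square)+
qed

lemma alg_iso_fT: assumes 3: "(3::'f::field) = 0" shows "alg_iso MO MO (fT (s::'f))"
proof (rule alg_iso_MOI[where h = "fT (- s)"])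
  fix x y c
  show "fT s (x + y) = fT s x + fT s y"
    by (cases x rule: mp_cases, cases y rule: mp_cases, simp add: algebra_simps)
  show "fT s (mmul x y) = mmul (fT s x) (fT s y)"
  proof (cases x rule: mp_cases, cases y rule: mp_cases)
    fix x0 x1 x2 x3 x4 x5 x6 x7 y0 y1 y2 y3 y4 y5 y6 y7
    assume x: "x = (x0,x1,x2,x3,x4,x5,x6,x7)" and y: "y = (y0,y1,y2,y3,y4,y5,y6,y7)"
    show ?thesis unfolding x y mmul.simps fT.simps prod.inject
      by (intro conjI) (algebra, rule refl, algebra, algebra,
        (rule char3_eqI[OF 3, where X="s * x7 * y7"], algebra), algebra, algebra, rule refl)
  qed
  show "fT s (msm c x) = msm c (fT s x)" "mnrm (fT s x) = mnrm x"
    "fT (- s) (fT s x) = x" "fT s (fT (- s) x) = x"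
    by (cases x rule: mp_cases, simp add: algebra_simps)+
qed

lemma alg_iso_fS: assumes 3: "(3::'f::field) = 0" shows "alg_iso MO MO (fS (s::'f))"
proof (rule alg_iso_MOI[where h = "fS (- s)"])
  fix x y c
  show "fS s (x + y) = fS s x + fS s y"
    by (cases x rule: mp_cases, cases y rule: mp_cases, simp add: algebra_simps)
  show "fS s (mmul x y) = mmul (fS s x) (fS s y)"
  proof (cases x rule: mp_cases, cases y rule: mp_cases)
    fix x0 x1 x2 x3 x4 x5 x6 x7 y0 y1 y2 y3 y4 y5 y6 y7
    assume x: "x = (x0,x1,x2,x3,x4,x5,x6,x7)" and y: "y = (y0,y1,y2,y3,y4,y5,y6,y7)"
    show ?thesis unfolding x y mmul.simps fS.simps prod.inject
      by (intro conjI) ((rule refl | algebra), (rule refl | algebra), (rule refl | algebra), (rule refl | algebra),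
        (rule char3_eqI[OF 3, where X="s * x6 * y7 + s * x7 * y6"], algebra),
        (rule char3_eqI[OF 3, where X="- (s * x7 * y7)"], algebra), (rule refl | algebra)+)
  qed
  show "fS s (msm c x) = msm c (fS s x)" "mnrm (fS s x) = mnrm x"
    "fS (- s) (fS s x) = x" "fS s (fS (- s) x) = x"
    by (cases x rule: mp_cases, simp add: algebra_simps power2_eq_square)+
qed

text \<open>The unipotent matrix is made upper triangular by \<open>fU\<close> and
  \<open>fJ\<close>; its nonzero corner \<open>y1\<close> then serves as pivot with which
  \<open>fT\<close> and \<open>fS\<close> clear the first row of \<open>r\<close>.\<close>

lemma idempotent_MO_conj_quadratic:
  fixes x0 :: "'f::field"
  assumes 3: "(3::'f) = 0" and e: "idempotent MO (x0,x1,x2,x3,x4,x5,x6,x7)"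
    and p: "x0 \<noteq> 1 \<or> x1 \<noteq> 0 \<or> x2 \<noteq> 0"
  shows "\<exists>f \<mu>. alg_iso MO MO f \<and> \<mu> \<noteq> 0 \<and> f (x0,x1,x2,x3,x4,x5,x6,x7) = (1,\<mu>,0,1,0,0,0,0)"
proof -
  have i: "x6 = 0" "x7 = 0" "x3 = - 1 - x0" "x0 * x3 - x1 * x2 = 1"
    using e idempotent_MO_iff[OF 3] by blast+
  have 2: "(2::'f) = - 1" using 3 by (simp add: eq_neg_iff_add_eq_0)
  have step: "\<exists>f \<mu>. alg_iso MO MO f \<and> \<mu> \<noteq> 0 \<and> f (1,y1,0,1,y4,y5,0,0) = (1,\<mu>,0,1,0,0,0,0)"
    if "y1 \<noteq> 0" for y1 y4 y5 :: 'f
  proof (intro exI conjI)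
    show "alg_iso MO MO (\<lambda>x. fS (- y5 / y1) (fT (y4 / y1) x))"
      by (intro alg_iso_comp[OF alg_iso_fT alg_iso_fS] 3)
  qed (use that in simp_all)
  show ?thesis
  proof (cases "x2 = 0")
    case True
    have "x0 * (- 1 - x0) = 1" using i True by simp
    then have "(x0 - 1) ^ 2 = 3 * (- x0)" by algebra
    then have x0: "x0 = 1" by (simp add: 3)
    have "x3 = - 2" unfolding i(3) x0 by simp
    then have "x3 = 1" unfolding 2 by simp
    then have "(x0,x1,x2,x3,x4,x5,x6,x7) = (1,x1,0,1,x4,x5,0,0)" using x0 i True by simp
    moreover have "x1 \<noteq> 0" using p True x0 by simp
    ultimately show ?thesis using step[of x1 x4 x5] by simp
  next
    case False
    \<comment> \<open>This \<open>s\<close> turns the upper left entry into \<open>1\<close>. The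
      trace then makes the other diagonal entry \<open>1\<close>, the determinant kills the upper
      right corner, and \<open>fJ\<close> exchanges the two corners.\<close>
    define s where "s = (1 - x0) / x2"
    have sx: "s * x2 = 1 - x0" using False by (simp add: s_def)
    have a: "fU s (x0,x1,x2,x3,x4,x5,x6,x7) = (1, x1 + s*x3 - s*x0 - s^2*x2, x2, x3 - s * x2, x4, x5 - s*x4, 0, 0)"
      using i sx by simp
    have "x3 - s * x2 = - 2" unfolding sx i by simp
    then have x3: "x3 - s * x2 = 1" unfolding 2 by simp
    have c: "alg_iso MO MO (\<lambda>x. fJ (fU s x))" by (rule alg_iso_comp[OF alg_iso_fU alg_iso_fJ])
    let ?e = "(x0,x1,x2,x3,x4,x5,x6,x7)"
    have "mnrm (fU s ?e) = mnrm ?e" using alg_isoD(6)[OF alg_iso_fU, of ?e s] by simp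
    then have "1 - (x1 + s*x3 - s*x0 - s^2*x2) * x2 = 1" unfolding a x3 using i by simp
    then have z: "x1 + s*x3 - s*x0 - s^2*x2 = 0" using False by simp
    have b: "fJ (fU s ?e) = (1, - x2, 0, 1, x5 - s*x4, - x4, 0, 0)" unfolding a x3 z by simp
    obtain f \<mu> where f: "alg_iso MO MO f" "\<mu> \<noteq> 0" "f (1, - x2, 0, 1, x5 - s*x4, - x4, 0, 0) = (1,\<mu>,0,1,0,0,0,0)"
      using step[of "- x2" "x5 - s*x4" "- x4"] False by (metis neg_equal_0_iff_equal)
    have "f (fJ (fU s ?e)) = (1,\<mu>,0,1,0,0,0,0)" unfolding b f(3) ..
    then show ?thesis using alg_iso_comp[OF c f(1)] f(2) by blast
  qed
qed

text \<open>The automorphisms \<open>fU\<close>, \<open>fJ\<close>, \<open>fD\<close> fix the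
  identity matrix and act transitively on nonzero first rows of \<open>r\<close>.\<close>

lemma idempotent_MO_conj_singular:
  fixes x4 :: "'f::field"
  assumes "x4 \<noteq> 0 \<or> x5 \<noteq> 0"
  shows "\<exists>f. alg_iso MO MO f \<and> f (1,0,0,1,x4,x5,0,0) = (1,0,0,1,1,0,0,0)"
proof -
  have step: "\<exists>f. alg_iso MO MO f \<and> f (1,0,0,1,y4,y5,0,0) = (1,0,0,1,1,0,0,0)" if "y4 \<noteq> 0" for y4 y5 :: 'f
  proof (intro exI conjI)
    show "alg_iso MO MO (\<lambda>x. fD y4 (fU (y5 / y4) x))"
      using that by (intro alg_iso_comp[OF alg_iso_fU alg_iso_fD])
  qed (use that in simp)
  show ?thesis
  proof (cases "x4 = 0")
    case True
    then obtain f where f: "alg_iso MO MO f" "f (1,0,0,1,x5,- x4,0,0) = (1,0,0,1,1,0,0,0)"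
      using step[of x5] assms by auto
    have "f (fJ (1,0,0,1,x4,x5,0,0)) = (1,0,0,1,1,0,0,0)" using f by simp
    then show ?thesis using alg_iso_comp[OF alg_iso_fJ f(1)] by blast
  qed (use step in blast)
qed

text \<open>Orthogonally to the idempotent, its centralizer is isotropic. This excludes
  para-quadratic as well as para-quaternion subalgebras there.\<close>

lemma centralizer_MO_singular:
  fixes x :: "'f::field mp"
  assumes 3: "(3::'f) = 0" and "x \<in> centralizer MO (1,0,0,1,1,0,0,0)" "polar MO (1,0,0,1,1,0,0,0) x = 0"
  shows "mnrm x = 0"
proof (cases x rule: mp_cases)
  fix x0 x1 x2 x3 x4 x5 x6 x7 assume x: "x = (x0,x1,x2,x3,x4,x5,x6,x7)"
  have 2: "(2::'f) \<noteq> 0" using 3 by (rule char3_two_neq_0)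
  have m: "mmul (1,0,0,1,1,0,0,0) x = mmul x (1,0,0,1,1,0,0,0)" using assms(2) by (simp add: centralizer_def)
  have b: "x0 + x3 - x7 = 0" using assms(3) by (simp add: x polar_MO add.commute)
  have "x7 = 0" using m by (simp add: x)
  moreover have "2 * x6 = 0" using m[unfolded x mmul.simps prod.inject] by algebra
  then have "x6 = 0" using 2 by simp
  moreover from this have "x0 = x3" using m[unfolded x mmul.simps prod.inject] by algebra
  moreover from this have "2 * x0 = 0" using b \<open>x7 = 0\<close> by simp
  then have "x0 = 0" using 2 by simp
  moreover have "2 * x1 = 0" using m[unfolded x mmul.simps prod.inject] \<open>x7 = 0\<close> by algebra
  then have "x1 = 0" using 2 by simp
  ultimately show ?thesis by (simp add: x)
qed

text \<open>The norms that occur are \<open>\<mu>\<close> times squares, so the idempotent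
  determines \<open>\<mu>\<close> up to squares once a nonzero norm is known.\<close>

lemma centralizer_MO_quadratic:
  fixes \<mu> :: "'f::field"
  assumes 3: "(3::'f) = 0" and mu: "\<mu> \<noteq> 0"
   and "x \<in> centralizer MO (1,\<mu>,0,1,0,0,0,0)" "polar MO (1,\<mu>,0,1,0,0,0,0) x = 0"
  shows "\<exists>s. mnrm x = \<mu> * s ^ 2"
proof (cases x rule: mp_cases)
  fix x0 x1 x2 x3 x4 x5 x6 x7 assume x: "x = (x0,x1,x2,x3,x4,x5,x6,x7)"
  have 2: "(2::'f) \<noteq> 0" using 3 by (rule char3_two_neq_0)
  have m: "mmul (1,\<mu>,0,1,0,0,0,0) x = mmul x (1,\<mu>,0,1,0,0,0,0)" using assms(3) by (simp add: centralizer_def)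
  have b: "x0 + x3 - \<mu> * x2 = 0" using assms(4) by (simp add: x polar_MO add.commute)
  have "\<mu> * x2 = 0" using m[unfolded x mmul.simps prod.inject] by algebra
  then have x2: "x2 = 0" using mu by simp
  have "\<mu> * x0 = \<mu> * x3" using m[unfolded x mmul.simps prod.inject] by algebra
  then have x0: "x0 = x3" using mu by simp
  have "2 * x0 = 0" using b x2 x0 by simp
  then have x0': "x0 = 0" using 2 by simp
  have "2 * x6 = 0" using m[unfolded x mmul.simps prod.inject] by algebra
  then have x6: "x6 = 0" using 2 by simp
  have "2 * (x7 + \<mu> * x4) = 0" using m[unfolded x mmul.simps prod.inject] x6 x2 by algebra
  then have "x7 = - (\<mu> * x4)" using 2 by (metis mult_eq_0_iff eq_neg_iff_add_eq_0)
  then have "mnrm x = \<mu> * x4 ^ 2" using x0 x0' x2 x6 by (simp add: x power2_eq_square)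
  then show ?thesis by blast
qed

section \<open>Descent along scalar extensions\<close>

lemma UNIV_cayley_ix: "(UNIV :: cayley_ix set) = {CE1, CE2, CU 1, CU 2, CU 3, CV 1, CV 2, CV 3}"
proof -
  have "x \<in> {CE1, CE2, CU 1, CU 2, CU 3, CV 1, CV 2, CV 3}" for x
  proof (cases x)
    case (CU i) then show ?thesis using exhaust_3[of i] by auto
  next
    case (CV i) then show ?thesis using exhaust_3[of i] by auto
  qed auto
  then show ?thesis by blast
qed

lemma sum_cayley_ix: "(\<Sum>i\<in>UNIV. f i) = f CE1 + f CE2 + f (CU 1) + f (CU 2) + f (CU 3) + f (CV 1) + f (CV 2) + f (CV 3 :: cayley_ix)"
proof -
  have "(1::3) \<noteq> 2" "(1::3) \<noteq> 3" "(2::3) \<noteq> 3" by simp_all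
  then show ?thesis unfolding UNIV_cayley_ix by (simp add: add.assoc)
qed

lemma ix3: "(3::3) + 1 = 1" "(1::3) + 2 = 3" "(2::3) + 2 = 1" "(3::3) + 2 = 2"
  "(1::3) - 1 = 3" "(2::3) - 1 = 1" "(3::3) - 1 = 2" "(1::3) \<noteq> 2" "(1::3) \<noteq> 3" "(2::3) \<noteq> 3"
   "(2::3) \<noteq> 1" "(3::3) \<noteq> 1" "(3::3) \<noteq> 2"
  by simp_all

lemma zero3: "(0::3) = 3"
  by simp

lemma split_cayley_mul_nth:
  "mul split_cayley x y $ k = (\<Sum>i\<in>UNIV. \<Sum>j\<in>UNIV. x $ i * y $ j * (cayley_table i j $ k))"
  by (simp add: split_cayley_def)

text \<open>For \<open>\<nu> = - 1\<close> the algebra \<open>K\<close> is split, with primitive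
  idempotents \<open>(1 + z) / 2\<close> and \<open>(1 - z) / 2\<close>. The map sends
  \<open>e_1\<close> and \<open>u_i\<close> to the former, \<open>e_2\<close> and \<open>v_i\<close>
  to the latter, each in its own coordinate; the signs stem from \<open>1 / 2 = - 1\<close>.\<close>

definition phi :: "'f::field ^ cayley_ix \<Rightarrow> 'f ep" where
  "phi x = ((- (x $ CE1 + x $ CE2), x $ CE2 - x $ CE1),
    (- (x $ CU 1 + x $ CV 1), x $ CV 1 - x $ CU 1),
    (- (x $ CU 2 + x $ CV 2), x $ CV 2 - x $ CU 2),
    (- (x $ CU 3 + x $ CV 3), x $ CV 3 - x $ CU 3))"

lemma mul_table:
  fixes x :: "'f::field ^ cayley_ix"
  shows "mul split_cayley x y $ CE1 = x $ CE1 * y $ CE1 - x $ CU 1 * y $ CV 1 - x $ CU 2 * y $ CV 2 - x $ CU 3 * y $ CV 3"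
   "mul split_cayley x y $ CE2 = x $ CE2 * y $ CE2 - x $ CV 1 * y $ CU 1 - x $ CV 2 * y $ CU 2 - x $ CV 3 * y $ CU 3"
   "mul split_cayley x y $ CU 1 = x $ CE1 * y $ CU 1 + x $ CU 1 * y $ CE2 + x $ CV 2 * y $ CV 3 - x $ CV 3 * y $ CV 2"
   "mul split_cayley x y $ CU 2 = x $ CE1 * y $ CU 2 + x $ CU 2 * y $ CE2 + x $ CV 3 * y $ CV 1 - x $ CV 1 * y $ CV 3"
   "mul split_cayley x y $ CU 3 = x $ CE1 * y $ CU 3 + x $ CU 3 * y $ CE2 + x $ CV 1 * y $ CV 2 - x $ CV 2 * y $ CV 1"
   "mul split_cayley x y $ CV 1 = x $ CE2 * y $ CV 1 + x $ CV 1 * y $ CE1 + x $ CU 2 * y $ CU 3 - x $ CU 3 * y $ CU 2"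
   "mul split_cayley x y $ CV 2 = x $ CE2 * y $ CV 2 + x $ CV 2 * y $ CE1 + x $ CU 3 * y $ CU 1 - x $ CU 1 * y $ CU 3"
   "mul split_cayley x y $ CV 3 = x $ CE2 * y $ CV 3 + x $ CV 3 * y $ CE1 + x $ CU 1 * y $ CU 2 - x $ CU 2 * y $ CU 1"
  unfolding split_cayley_mul_nth sum_cayley_ix by (simp_all add: ix3 axis_def)

lemma unity_eqI: "is_unit_of A u \<Longrightarrow> unity A = u"
  unfolding unity_def is_unit_of_def by (rule the_equality) metis+

lemma vec_eq_cayley_ix: "(x :: 'a ^ cayley_ix) = y \<longleftrightarrow> x $ CE1 = y $ CE1 \<and> x $ CE2 = y $ CE2 \<and>
    x $ CU 1 = y $ CU 1 \<and> x $ CU 2 = y $ CU 2 \<and> x $ CU 3 = y $ CU 3 \<and>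
    x $ CV 1 = y $ CV 1 \<and> x $ CV 2 = y $ CV 2 \<and> x $ CV 3 = y $ CV 3"
  unfolding vec_eq_iff using UNIV_cayley_ix by (metis (no_types, lifting) UNIV_I empty_iff insertE)

lemma unity_split_cayley: "unity (split_cayley :: ('f::field, 'f ^ cayley_ix) nalg) = axis CE1 1 + axis CE2 1"
proof (rule unity_eqI)
  have "carr (split_cayley :: ('f, 'f ^ cayley_ix) nalg) = UNIV" by (simp add: split_cayley_def)
  then show "is_unit_of (split_cayley :: ('f, 'f ^ cayley_ix) nalg) (axis CE1 1 + axis CE2 1)"
    unfolding is_unit_of_def vec_eq_cayley_ix mul_table by (simp add: axis_def)
qed

lemma nrm_split_cayley: "nrm split_cayley x = x $ CE1 * x $ CE2 + x $ CU 1 * x $ CV 1 + x $ CU 2 * x $ CV 2 + x $ CU 3 * x $ CV 3"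
  by (simp add: split_cayley_def sum_3)

lemma conjug_split_cayley:
  fixes x :: "'f::field ^ cayley_ix"
  shows "conjug split_cayley x $ CE1 = x $ CE2" "conjug split_cayley x $ CE2 = x $ CE1"
   "conjug split_cayley x $ CU i = - (x $ CU i)" "conjug split_cayley x $ CV i = - (x $ CV i)"
proof -
  have "polar split_cayley x (axis CE1 1 + axis CE2 1) = x $ CE1 + x $ CE2"
    by (simp add: polar_def nrm_split_cayley axis_def algebra_simps)
  then have c: "conjug split_cayley x = (x $ CE1 + x $ CE2) *s (axis CE1 1 + axis CE2 1) - x"
    unfolding conjug_def unity_split_cayley by simp (simp add: split_cayley_def)
  show "conjug split_cayley x $ CE1 = x $ CE2" "conjug split_cayley x $ CE2 = x $ CE1"
   "conjug split_cayley x $ CU i = - (x $ CU i)" "conjug split_cayley x $ CV i = - (x $ CV i)"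
    unfolding c by (simp_all add: axis_def)
qed

lemma phi_tau: "phi (tau_st x) = etau (phi x)"
  by (simp add: phi_def tau_st_def ix3 zero3)

lemma phi_conjug: "phi (conjug split_cayley x) = ecnj (phi x)"
  by (simp add: phi_def conjug_split_cayley kc_def uminus_prod_def)

lemma phi_mul:
  fixes x y :: "'f::field ^ cayley_ix"
  assumes 3: "(3::'f) = 0"
  shows "phi (mul split_cayley x y) = emul (- 1) (1,0) (phi x) (phi y)"
proof -
  \<comment> \<open>With \<open>- 1\<close> written for \<open>1 / 2\<close>, \<open>phi\<close> is
    \<open>- 2\<close> times the map that is multiplicative before reduction modulo 3. A product of
    two images therefore carries one surplus factor \<open>- 2\<close>.\<close>
  have r: "R = - 2 * L \<Longrightarrow> L = R" for L R :: 'f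
  proof -
    assume "R = - 2 * L"
    then have "L = R + 3 * L" by algebra
    then show "L = R" using 3 by simp
  qed
  show ?thesis unfolding phi_def mul_table
    by (simp only: emul.simps km_def kc_def fst_conv snd_conv plus_prod_def minus_prod_def prod.inject)
      (intro conjI; rule r; algebra)
qed

lemma alg_iso_phi:
  assumes 3: "(3::'f::field) = 0"
  shows "alg_iso (split_okubo :: ('f, 'f ^ cayley_ix) nalg) (PE (- 1) (1,0)) phi"
proof -
  let ?S = "split_okubo :: ('f, 'f ^ cayley_ix) nalg"
  have sel: "carr ?S = UNIV" "smul ?S = (*s)" "nrm ?S = nrm split_cayley"
    by (simp_all add: split_okubo_def petersson_def split_cayley_def)
  have m: "phi (mul ?S x y) = pmul (- 1) (1,0) (phi x) (phi y)" for x y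
    by (simp add: split_okubo_def petersson_def phi_mul[OF 3] phi_tau phi_conjug pmul_def)
  have three: "- (a + a) = a" for a :: 'f
  proof -
    have "- (a + a) = a - 3 * a" by (simp add: algebra_simps)
    then show ?thesis using 3 by simp
  qed
  define h :: "'f ep \<Rightarrow> 'f ^ cayley_ix" where "h = (\<lambda>(b,X1,X2,X3). (\<chi> i. case i of CE1 \<Rightarrow> fst b + snd b
     | CE2 \<Rightarrow> fst b - snd b
     | CU i \<Rightarrow> (let X = (if i = 1 then X1 else if i = 2 then X2 else X3) in fst X + snd X)
     | CV i \<Rightarrow> (let X = (if i = 1 then X1 else if i = 2 then X2 else X3) in fst X - snd X)))"
  have "- (a + b + (a - b)) = a" "a - b - (a + b) = b" "- (a + b) + (b - a) = a" "- (a + b) - (b - a) = b" for a b :: 'f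
    using three[of a] three[of b] by (simp_all add: algebra_simps)
  note ab = this
  have "phi (h x) = x" for x
    by (cases x rule: ep_cases) (simp add: phi_def h_def ix3 ab 3)
  moreover have "h (phi x) = x" for x
    unfolding vec_eq_cayley_ix by (simp add: phi_def h_def ix3 ab 3)
  ultimately have "bij_betw phi (UNIV :: ('f ^ cayley_ix) set) UNIV"
    by (intro bij_betw_byWitness[of _ h]) auto
  moreover have "phi (x + y) = phi x + phi y" for x y :: "'f ^ cayley_ix"
    by (simp add: phi_def)
  moreover have "phi (c *s x) = esm c (phi x)" for c and x :: "'f ^ cayley_ix"
    by (simp add: phi_def algebra_simps)
  moreover have "enrm (- 1) (phi x) = nrm ?S x" for x
  proof -
    have "enrm (- 1) (phi x) = nrm ?S x + 3 * nrm ?S x"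
      unfolding sel nrm_split_cayley phi_def enrm.simps by algebra
    then show ?thesis using 3 by simp
  qed
  ultimately show ?thesis
    unfolding alg_iso_def by (simp add: sel m)
qed

section \<open>Transfer of the symmetric composition laws\<close>

lemma normed_algebra_pullback:
  assumes f: "alg_iso A B f" and B: "normed_algebra B"
    and vs: "vector_space (smul A)" "module.subspace (smul A) (carr A)"
    and cl: "\<And>x y. x \<in> carr A \<Longrightarrow> y \<in> carr A \<Longrightarrow> mul A x y \<in> carr A"
  shows "normed_algebra A"
proof -
  interpret B: normed_alg B using B by unfold_locales
  interpret vector_space "smul A" by (rule vs)
  have [simp]: "x \<in> carr A \<Longrightarrow> y \<in> carr A \<Longrightarrow> x + y \<in> carr A" "x \<in> carr A \<Longrightarrow> smul A c x \<in> carr A" for x y c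
    using vs(2) by (simp_all add: subspace_add subspace_scale)
  note [simp] = alg_isoD(2-6)[OF f] cl
  have eqI: "x = y" if "f x = f y" "x \<in> carr A" "y \<in> carr A" for x y
    using alg_iso_injD[OF f] that by blast
  have p: "polar A x y = polar B (f x) (f y)" if "x \<in> carr A" "y \<in> carr A" for x y
    using that by (simp add: polar_def alg_isoD(6)[OF f, symmetric] del: alg_isoD(6)[OF f])
  have "bilinear_mul A" unfolding bilinear_mul_def
    by (intro conjI ballI allI; (rule eqI | rule cl); simp)
  moreover have "quadratic_nrm A" unfolding quadratic_nrm_def
  proof (intro conjI ballI allI)
    show "nrm A (smul A c x) = c\<^sup>2 * nrm A x" if "x \<in> carr A" for c x
      using that B.N_scal[of "f x" c] alg_isoD(6)[OF f, of "smul A c x"] by simp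
  qed (simp_all add: p)
  ultimately show ?thesis using vs by (simp add: normed_algebra_def)
qed

lemma symcomp_pullback:
  assumes f: "alg_iso A B f" and B: "symcomp B" and A: "normed_algebra A"
  shows "symcomp A"
proof -
  interpret B: symcomp B by fact
  interpret normed_alg A using A by unfold_locales
  note [simp] = alg_isoD(2-5)[OF f]
  have eqI: "x = y" if "f x = f y" "x \<in> carr A" "y \<in> carr A" for x y
    using alg_iso_injD[OF f] that by blast
  have p: "polar B (f x) (f y) = polar A x y" if "x \<in> carr A" "y \<in> carr A" for x y
    using alg_iso_polar[OF f A that] .
  show ?thesis
  proof unfold_locales
    show "(3::'a) = 0" by (rule B.char3)
    show "mul A (mul A x y) x = smul A (nrm A x) y" "mul A x (mul A y x) = smul A (nrm A x) y"
      if "x \<in> carr A" "y \<in> carr A" for x y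
      using that by (intro eqI; simp add: B.flexl B.flexr alg_isoD(6)[OF f])+
    show "polar A (mul A x y) z = polar A x (mul A y z)" if "x \<in> carr A" "y \<in> carr A" "z \<in> carr A" for x y z
      using that B.assoc[of "f x" "f y" "f z"] by (simp add: p[symmetric])
    show "x = 0" if x: "x \<in> carr A" "\<And>y. y \<in> carr A \<Longrightarrow> polar A x y = 0" for x
    proof (rule eqI)
      have f0: "f 0 = 0" using alg_isoD(4)[OF f, of 0 0] by simp
      have "polar B (f x) y = 0" if y: "y \<in> carr B" for y
        using alg_iso_surjE[OF f y] x p by metis
      then show "f x = f 0" unfolding f0 using x by (intro B.nonsing) auto
    qed (use x in simp_all)
    obtain S where S: "finite S" "card S \<le> 8" "B.span S = carr B" using B.dim8 by blast
    let ?h = "inv_into (carr A) f"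
    have h: "alg_iso B A ?h" by (rule alg_iso_inv[OF f A])
    have SC: "S \<subseteq> carr B" using S B.span_superset by blast
    have h0: "?h 0 = 0" using alg_isoD(4)[OF h, of 0 0] by simp
    have "?h z \<in> span (?h ` S) \<and> z \<in> carr B" if "z \<in> B.span S" for z
      using that
    proof (induction rule: B.span_induct_alt)
      case base then show ?case by (simp add: h0 span_zero)
    next
      case (step c s z)
      then have "s \<in> carr B" using SC by auto
      then show ?case using step alg_isoD(3,4)[OF h]
        by (simp add: span_add span_scale span_base)
    qed
    then have "carr A \<subseteq> span (?h ` S)" using S(3) alg_iso_surjE[OF h] by (metis subsetI)
    moreover have "span (?h ` S) \<subseteq> carr A"
      using subC alg_isoD(2)[OF h] SC by (intro span_minimal) auto
    ultimately have "span (?h ` S) = carr A" by auto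
    moreover have "card (?h ` S) \<le> 8" using card_image_le[OF S(1), of ?h] S(2) by linarith
    ultimately show "\<exists>S. finite S \<and> card S \<le> 8 \<and> span S = carr A" using S(1) by blast
  qed
qed

lemma symcomp_split_okubo:
  assumes 3: "(3::'f::field) = 0"
  shows "symcomp (split_okubo :: ('f, 'f ^ cayley_ix) nalg)"
proof -
  let ?S = "split_okubo :: ('f, 'f ^ cayley_ix) nalg"
  have sel: "carr ?S = UNIV" "smul ?S = (*s)"
    by (simp_all add: split_okubo_def petersson_def split_cayley_def)
  interpret P: symcomp "PE (- 1 :: 'f) (1,0)" using 3 by (intro symcomp_PE) auto
  have "normed_algebra ?S"
    by (rule normed_algebra_pullback[OF alg_iso_phi[OF 3] P.na])
      (simp_all add: sel vec.subspace_UNIV vec.vector_space_axioms)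
  then show ?thesis by (rule symcomp_pullback[OF alg_iso_phi[OF 3] P.symcomp_axioms])
qed

lemma card_cayley_ix: "CARD(cayley_ix) = 8"
proof -
  have "(1::3) \<noteq> 2" "(1::3) \<noteq> 3" "(2::3) \<noteq> 3" by simp_all
  then show ?thesis unfolding UNIV_cayley_ix by simp
qed

text \<open>The identities hold over the extension and are pulled back through
  \<open>\<iota>\<close>, which is injective because \<open>h\<close> is and a basis goes to a
  basis. If \<open>x\<close> is orthogonal to \<open>C\<close>, its image is orthogonal to the image
  of \<open>b\<close>, hence to the whole split algebra, and vanishes.\<close>

lemma okubo_algebra_symcomp:
  fixes A :: "('f::field, 'v::ab_group_add) nalg"
  assumes 3: "(3::'f) = 0" and ok: "okubo_algebra TYPE('l::field) A"
  shows "symcomp A \<and> (\<exists>S. \<not> module.dependent (smul A) S \<and> S \<subseteq> carr A \<and> card S = 8)"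
proof -
  let ?S = "split_okubo :: ('l, 'l ^ cayley_ix) nalg"
  have sel: "carr ?S = UNIV" "smul ?S = (*s)"
    by (simp_all add: split_okubo_def petersson_def split_cayley_def)
  obtain h :: "'f \<Rightarrow> 'l" and \<iota> where na: "normed_algebra A" and h: "field_embedding h"
    and se: "scalar_extension h \<iota> A ?S"
    using ok by (auto simp: okubo_algebra_def)
  interpret normed_alg A using na by unfold_locales
  have h_add: "h (a + b) = h a + h b" and h_mult: "h (a * b) = h a * h b" and h1: "h 1 = 1" for a b
    using h by (auto simp: field_embedding_def)
  have "h 0 + h 0 = h 0 + 0" using h_add[of 0 0] by simp
  then have h0: "h 0 = 0" by (simp only: add_left_cancel)
  have h_eq0: "a = 0" if "h a = 0" for a
  proof (rule ccontr)
    assume "a \<noteq> 0"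
    then have "h a * h (1 / a) = 1" by (simp add: h_mult[symmetric] h1)
    then show False using that by simp
  qed
  have h_diff: "h (a - b) = h a - h b" for a b
    using h_add[of "a - b" b] by simp
  have h_inj: "a = b" if "h a = h b" for a b
    using h_eq0[of "a - b"] that by (simp add: h_diff)
  have "h 3 = 3" using h_add[of 1 "1 + 1"] h_add[of 1 1] h1 by simp
  then have "(3::'l) = 0" using 3 h0 by simp
  then interpret S: symcomp ?S by (rule symcomp_split_okubo)
  have i_add: "\<iota> (x + y) = \<iota> x + \<iota> y" and i_scal: "\<iota> (c \<bullet>\<^sub>s x) = smul ?S (h c) (\<iota> x)"
    and i_mul: "\<iota> (x \<star> y) = mul ?S (\<iota> x) (\<iota> y)" and i_N: "nrm ?S (\<iota> x) = h (N x)"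
    if "x \<in> C" "y \<in> C" for x y c
    using se that by (auto simp: scalar_extension_def)
  obtain b where b: "alg_basis A b" "inj_on \<iota> b" "alg_basis ?S (\<iota> ` b)"
    using se by (auto simp: scalar_extension_def)
  have bi: "independent b" "span b = C" and ib: "S.independent (\<iota> ` b)" "S.span (\<iota> ` b) = UNIV"
    using b by (auto simp: alg_basis_def sel)
  have bC: "b \<subseteq> C" using bi span_superset by blast
  have "card (\<iota> ` b) = vec.dim (UNIV :: ('l ^ cayley_ix) set)"
    using ib by (intro vec.basis_card_eq_dim) (auto simp: sel)
  then have card: "card b = 8" using card_image[OF b(2)] by (simp add: vec.dim_UNIV card_cayley_ix card_cart_basis)
  then have fin: "finite b" using card.infinite by fastforce
  have i0: "\<iota> 0 = 0" using i_add[of 0 0] by simp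
  have i_sum: "\<iota> (\<Sum>s\<in>T. c s \<bullet>\<^sub>s s) = (\<Sum>s\<in>T. smul ?S (h (c s)) (\<iota> s))" if "T \<subseteq> C" for T c
    using that
  proof (induction T rule: infinite_finite_induct)
    case (insert t T)
    then have "(\<Sum>s\<in>T. c s \<bullet>\<^sub>s s) \<in> C" by (intro sum_C C_scal) auto
    then show ?case using insert by (simp add: i_add i_scal)
  qed (simp_all add: i0)
  have i_eq0: "x = 0" if x: "x \<in> C" "\<iota> x = 0" for x
  proof -
    obtain c where c: "x = (\<Sum>s\<in>b. c s \<bullet>\<^sub>s s)"
      using x(1) bi(2) span_finite[OF fin] by auto
    have "(\<Sum>t\<in>\<iota> ` b. smul ?S (h (c (inv_into b \<iota> t))) t) = 0"
      using x(2) unfolding c i_sum[OF bC] by (simp add: sum.reindex[OF b(2)] b(2))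
    then have "\<forall>t\<in>\<iota> ` b. h (c (inv_into b \<iota> t)) = 0"
      using S.independentD[OF ib(1) finite_imageI[OF fin] subset_refl, of "\<lambda>t. h (c (inv_into b \<iota> t))"] by blast
    then have "c s = 0" if "s \<in> b" for s using that b(2) h_eq0 by fastforce
    then show ?thesis unfolding c by simp
  qed
  have i_diff: "\<iota> (x - y) = \<iota> x - \<iota> y" if "x \<in> C" "y \<in> C" for x y
    using i_add[of "x - y" y] that by simp
  have i_inj: "x = y" if "\<iota> x = \<iota> y" "x \<in> C" "y \<in> C" for x y
    using i_eq0[of "x - y"] that by (simp add: i_diff)
  have i_B: "polar ?S (\<iota> x) (\<iota> y) = h (B x y)" if "x \<in> C" "y \<in> C" for x y
    using that i_N[of "x + y" 0] i_N[of x 0] i_N[of y 0] by (simp add: polar_def h_diff i_add)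
  have SC[simp]: "z \<in> carr ?S" for z by (simp add: sel)
  have "symcomp A"
  proof unfold_locales
    show "(x \<star> y) \<star> x = N x \<bullet>\<^sub>s y" "x \<star> (y \<star> x) = N x \<bullet>\<^sub>s y" if "x \<in> C" "y \<in> C" for x y
      using that by (intro i_inj; simp add: i_mul i_scal[where y=0] S.flexl S.flexr i_N[where y=0])+
    show "B (x \<star> y) z = B x (y \<star> z)" if "x \<in> C" "y \<in> C" "z \<in> C" for x y z
      using that S.assoc[of "\<iota> x" "\<iota> y" "\<iota> z"] by (intro h_inj) (simp add: i_B[symmetric] i_mul)
    show "x = 0" if x: "x \<in> C" "\<And>y. y \<in> C \<Longrightarrow> B x y = 0" for x
    proof -
      have "polar ?S (\<iota> x) y = 0" if "y \<in> S.span (\<iota> ` b)" for y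
        using that
      proof (induction rule: S.span_induct_alt)
        case base then show ?case by simp
      next
        case (step c s y)
        then obtain s' where "s' \<in> C" "s = \<iota> s'" using bC by auto
        then show ?case using step x by (simp add: i_B h0)
      qed
      then have "\<iota> x = 0" using ib(2) by (intro S.nonsing) auto
      then show ?thesis using i_eq0 x by blast
    qed
    show "\<exists>S. finite S \<and> card S \<le> 8 \<and> span S = C"
      using fin card bi by auto
  qed (rule 3)
  then show ?thesis using bi bC card by blast
qed

section \<open>The automorphism attached to an etale pair\<close>

definition KM :: "'f::field \<Rightarrow> ('f, 'f kp) nalg" where
  "KM \<nu> = \<lparr>carr = UNIV, smul = (\<lambda>c x. (c * fst x, c * snd x)), mul = km \<nu>, nrm = (\<lambda>x. fst x ^ 2 + \<nu> * snd x ^ 2)\<rparr>"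

lemma KM_sel[simp]: "carr (KM \<nu>) = UNIV" "smul (KM \<nu>) = (\<lambda>c x. (c * fst x, c * snd x))"
  "mul (KM \<nu>) = km \<nu>" "nrm (KM \<nu>) = (\<lambda>x. fst x ^ 2 + \<nu> * snd x ^ 2)"
  by (simp_all add: KM_def)

lemma polar_KM: "polar (KM \<nu>) x y = 2 * (fst x * fst y + \<nu> * snd x * snd y)"
  by (simp add: polar_def power2_eq_square algebra_simps)

lemma normed_algebra_KM: "normed_algebra (KM \<nu>)"
proof -
  have v: "vector_space (smul (KM \<nu>))"
    by unfold_locales (simp_all add: prod_eq_iff algebra_simps)
  then interpret vector_space "smul (KM \<nu>)" .
  show ?thesis
    unfolding normed_algebra_def bilinear_mul_def quadratic_nrm_def
    using v by (simp add: polar_KM km_def prod_eq_iff algebra_simps power2_eq_square subspace_UNIV[simplified])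
qed

text \<open>A vector \<open>z\<close> orthogonal to the unity completes it to a basis, and
  \<open>N z \<noteq> 0\<close> by nonsingularity. The equation \<open>z^2 = - N z\<close> is
  extracted from multiplicativity of the norm on a few elements.\<close>

lemma (in normed_alg) quadratic_etale_coordinates_aux:
  assumes 3: "(3::'f) = 0" and K: "quadratic_etale A"
  shows "\<exists>\<nu> \<kappa>. \<nu> \<noteq> 0 \<and> alg_iso (KM \<nu>) A \<kappa> \<and> is_unit_of A (\<kappa> (1,0))"
proof -
  have H: "hurwitz A" and d2: "alg_dim A = 2" using K by (auto simp: quadratic_etale_def)
  have ns: "x = 0" if "x \<in> C" "\<And>y. y \<in> C \<Longrightarrow> B x y = 0" for x
    using H that by (auto simp: hurwitz_def nonsingular_nrm_def)
  have mult: "N (x \<star> y) = N x * N y" if "x \<in> C" "y \<in> C" for x y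
    using H that by (auto simp: hurwitz_def)
  obtain u where u: "is_unit_of A u" using H by (auto simp: hurwitz_def)
  have uC[simp]: "u \<in> C" and ux[simp]: "x \<in> C \<Longrightarrow> u \<star> x = x" and xu[simp]: "x \<in> C \<Longrightarrow> x \<star> u = x" for x
    using u by (auto simp: is_unit_of_def)
  have 2: "(2::'f) \<noteq> 0" using 3 by (rule char3_two_neq_0)
  obtain S where S: "S \<subseteq> C" "independent S" "C \<subseteq> span S" "card S = 2"
    using basis_exists[of C] d2 by (auto simp: alg_dim_def)
  have fin: "finite S" using S(4) card.infinite by fastforce
  have spanS: "span S = C" using S subC by (metis span_minimal subset_antisym)
  obtain z where z: "z \<in> C" "z \<noteq> 0" "B u z = 0"
    using common_kernel_set[of "[B u]" S] lin_fun_B[OF uC] S fin by auto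
  have Nu: "N u = 1"
  proof -
    have "N u \<noteq> 0"
    proof
      assume "N u = 0"
      then have "N x = 0" if "x \<in> C" for x using mult[of u x] that by simp
      then have "B z y = 0" if "y \<in> C" for y using z(1) that by (simp add: polar_def)
      then show False using ns z by blast
    qed
    then show ?thesis using mult[of u u] by simp
  qed
  have Buu: "B u u = 2" by (simp add: B_self Nu)
  have un: "u \<noteq> 0" using Buu 2 by (metis B_zero_left uC)
  have zu: "z \<notin> span {u}"
  proof
    assume "z \<in> span {u}"
    then obtain c where "z = c \<bullet>\<^sub>s u" by (auto simp: span_singleton)
    then show False using z Buu 2 by simp
  qed
  have sp: "span {z, u} = C"
  proof (rule span_eq_carrier[OF fin _ spanS])
    show "independent {z, u}" using zu un by (simp add: independent_insert)
    show "card {z, u} = 2" using zu span_base[of u "{u}"] by (auto simp: card_insert_if)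
  qed (use S z in auto)
  have ex: "\<exists>a b. x = a \<bullet>\<^sub>s u + b \<bullet>\<^sub>s z" if "x \<in> C" for x
  proof -
    have "x \<in> span (insert z {u})" using that sp by simp
    then obtain b where "x - b \<bullet>\<^sub>s z \<in> span {u}" using span_breakdown_eq by blast
    then obtain a where "x - b \<bullet>\<^sub>s z = a \<bullet>\<^sub>s u" by (auto simp: span_singleton)
    then show ?thesis by (metis diff_add_cancel)
  qed
  have Nz: "N z \<noteq> 0"
  proof
    assume a: "N z = 0"
    have "B z y = 0" if "y \<in> C" for y
      using ex[OF that] z a by (auto simp: B_self B_sym[of z u])
    then show False using ns z by blast
  qed
  have Nf: "N (a \<bullet>\<^sub>s u + b \<bullet>\<^sub>s z) = a^2 + N z * b^2" for a b
    using z by (simp add: N_add Nu mult.commute)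
  have zz: "z \<star> z = (- N z) \<bullet>\<^sub>s u"
  proof -
    obtain r s where rs: "z \<star> z = r \<bullet>\<^sub>s u + s \<bullet>\<^sub>s z" using ex[of "z \<star> z"] z by auto
    have n1: "N ((a \<bullet>\<^sub>s u + b \<bullet>\<^sub>s z) \<star> z) = (a^2 + N z * b^2) * N z" for a b
    proof -
      have "N ((a \<bullet>\<^sub>s u + b \<bullet>\<^sub>s z) \<star> z) = N (a \<bullet>\<^sub>s u + b \<bullet>\<^sub>s z) * N z"
        using z by (intro mult) auto
      then show ?thesis by (simp only: Nf)
    qed
    have e: "(a \<bullet>\<^sub>s u + b \<bullet>\<^sub>s z) \<star> z = (b * r) \<bullet>\<^sub>s u + (a + b * s) \<bullet>\<^sub>s z" for a b
      using z by (simp add: rs algebra_simps)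
    have n2: "(b * r) ^ 2 + N z * (a + b * s) ^ 2 = (a^2 + N z * b^2) * N z" for a b
      using n1[of a b] Nf[of "b * r" "a + b * s"] unfolding e by simp
    \<comment> \<open>The norms of \<open>(u + z) \<star> z\<close> and
      \<open>(z - u) \<star> z\<close> agree, and their expressions differ only in the sign of
      \<open>s\<close>, which therefore vanishes.\<close>
    have "r ^ 2 + N z * (1 + s) ^ 2 = (1 + N z) * N z" using n2[of 1 1] by simp
    moreover have "r ^ 2 + N z * (1 - s) ^ 2 = (1 + N z) * N z" using n2[of "- 1" 1] by simp
    ultimately have "2 * (2 * (N z * s)) = 0" by algebra
    then have s: "s = 0" using Nz 2 by (metis mult_eq_0_iff)
    have m: "(a \<bullet>\<^sub>s u + b \<bullet>\<^sub>s z) \<star> (a \<bullet>\<^sub>s u + b \<bullet>\<^sub>s z) = (a^2 + b^2 * r) \<bullet>\<^sub>s u + (2 * a * b) \<bullet>\<^sub>s z" for a b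
      using z by (simp add: rs s algebra_simps power2_eq_square) (simp flip: scale_left_distrib)
    have n3: "N ((u + z) \<star> (u + z)) = (1 + N z) ^ 2"
    proof -
      have "N ((u + z) \<star> (u + z)) = N (u + z) * N (u + z)" using z by (intro mult) auto
      then show ?thesis using Nf[of 1 1] by (simp add: power2_eq_square)
    qed
    have n4: "(1 + r) ^ 2 + N z * 4 = (1 + N z) ^ 2"
      using n3 m[of 1 1] Nf[of "1 + r" 2] z by simp
    \<comment> \<open>This determines \<open>r\<close> up to sign; the norm of the square of
      \<open>u + z\<close>, recorded in \<open>n4\<close>, fixes the sign.\<close>
    have "r ^ 2 = N z ^ 2" using n2[where a=0 and b=1] by (simp add: s power2_eq_square)
    then have "2 * (r + N z) = 4 * N z + ((1 + r)\<^sup>2 - (1 + N z)\<^sup>2)" by algebra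
    also have "\<dots> = 0" using n4 by (simp add: algebra_simps)
    finally have "2 * (r + N z) = 0" .
    then have "r = - N z" using 2 by (metis mult_eq_0_iff eq_neg_iff_add_eq_0)
    then show ?thesis using rs s by simp
  qed
  define \<kappa> where "\<kappa> x = fst x \<bullet>\<^sub>s u + snd x \<bullet>\<^sub>s z" for x :: "'f kp"
  have kC: "\<kappa> x \<in> C" for x using z by (simp add: \<kappa>_def)
  have "inj \<kappa>"
  proof (rule injI)
    fix x y assume a: "\<kappa> x = \<kappa> y"
    have "B u (\<kappa> x) = fst x * 2" "B z (\<kappa> x) = snd x * (2 * N z)" for x
      using z by (simp_all add: \<kappa>_def Buu B_self B_sym[of z u])
    then have "fst x * 2 = fst y * 2" "snd x * (2 * N z) = snd y * (2 * N z)" using a by metis+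
    then show "x = y" using 2 Nz by (simp add: prod_eq_iff)
  qed
  moreover have "\<kappa> ` UNIV = C"
  proof -
    have "\<exists>y. x = \<kappa> y" if "x \<in> C" for x
      using ex[OF that] by (auto simp: \<kappa>_def)
    then show ?thesis using kC by auto
  qed
  ultimately have "bij_betw \<kappa> (carr (KM (N z))) C" by (simp add: bij_betw_def)
  moreover have "\<kappa> (km (N z) x y) = \<kappa> x \<star> \<kappa> y" for x y
    using z by (simp add: \<kappa>_def km_def zz algebra_simps)
  ultimately have "alg_iso (KM (N z)) A \<kappa>"
    unfolding alg_iso_def by (auto simp: \<kappa>_def Nf algebra_simps)
  moreover have "\<kappa> (1,0) = u" by (simp add: \<kappa>_def)
  ultimately show ?thesis using Nz u by metis
qed

lemma quadratic_etale_coordinates: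
  fixes K :: "('f::field, 'k::ab_group_add) nalg"
  assumes "(3::'f) = 0" and K: "quadratic_etale K"
  shows "\<exists>\<nu> \<kappa>. \<nu> \<noteq> 0 \<and> alg_iso (KM \<nu>) K \<kappa> \<and> is_unit_of K (\<kappa> (1,0))"
proof -
  interpret normed_alg K using K by unfold_locales (simp add: quadratic_etale_def hurwitz_def)
  show ?thesis using assms by (rule quadratic_etale_coordinates_aux)
qed

locale etale_coord =
  fixes K :: "('f::field, 'k::ab_group_add) nalg" and \<nu> :: 'f and \<kappa> :: "'f kp \<Rightarrow> 'k"
  assumes char3: "(3::'f) = 0" and nu: "\<nu> \<noteq> 0" and iso: "alg_iso (KM \<nu>) K \<kappa>"
    and unit: "is_unit_of K (\<kappa> (1,0))"
begin

lemma k_add: "\<kappa> a + \<kappa> b = \<kappa> (a + b)"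
  and k_mul: "mul K (\<kappa> a) (\<kappa> b) = \<kappa> (km \<nu> a b)"
  and k_scal: "smul K c (\<kappa> a) = \<kappa> (c * fst a, c * snd a)"
  and k_nrm: "nrm K (\<kappa> a) = fst a ^ 2 + \<nu> * snd a ^ 2"
  and k_C[simp]: "\<kappa> a \<in> carr K"
  using alg_isoD(2)[OF iso, of a] alg_isoD(3,5)[OF iso, of a b] alg_isoD(4)[OF iso, of a c]
    alg_isoD(6)[OF iso, of a] by simp_all

lemma k_inj: "\<kappa> a = \<kappa> b \<longleftrightarrow> a = b"
  using alg_iso_injD[OF iso] by simp

lemma k_zero: "\<kappa> 0 = 0"
  using k_add[of 0 0] by simp

lemma k_neg: "- \<kappa> a = \<kappa> (- a)"
  by (rule minus_unique) (simp add: k_add k_zero)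

lemma k_diff: "\<kappa> a - \<kappa> b = \<kappa> (a - b)"
  using k_add[of a "- b"] by (simp flip: k_neg)

lemma k_unity: "unity K = \<kappa> (1,0)"
  using unit by (rule unity_eqI)

lemma k_polar: "polar K (\<kappa> a) (\<kappa> b) = 2 * (fst a * fst b + \<nu> * snd a * snd b)"
  using alg_iso_polar[OF iso normed_algebra_KM] by (simp add: polar_KM)

lemma k_conj: "conjug K (\<kappa> a) = \<kappa> (kc a)"
  by (simp add: conjug_def k_unity k_polar k_scal k_diff kc_def minus_prod_def)

lemma k_ex: "x \<in> carr K \<Longrightarrow> \<exists>a. x = \<kappa> a"
  using alg_iso_surjE[OF iso] by (metis UNIV_I)

lemmas k_simps = k_add k_mul k_neg k_diff k_conj

text \<open>
  The vectors \<open>w\<^sub>i - (w\<^sub>1 + w\<^sub>2 + w\<^sub>3)\<close> form an orthonormal basis of \<open>W\<close> in characteristic \<open>3\<close>.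
\<close>

definition wv :: "'f kp \<Rightarrow> 'f kp \<Rightarrow> 'f kp \<Rightarrow> 'k ^ 3" where
  "wv X Y Z = (\<chi> i. if i = 1 then \<kappa> (X - (X + Y + Z)) else if i = 2 then \<kappa> (Y - (X + Y + Z)) else \<kappa> (Z - (X + Y + Z)))"

lemma wv_nth: "wv X Y Z $ 1 = \<kappa> (X - (X + Y + Z))" "wv X Y Z $ 2 = \<kappa> (Y - (X + Y + Z))"
  "wv X Y Z $ 3 = \<kappa> (Z - (X + Y + Z))"
  by (simp_all add: wv_def)

lemma kp_eqI: "a = b + (3 * x, 3 * y) \<Longrightarrow> a = (b :: 'f kp)"
  using char3 by (simp add: prod_eq_iff)

lemma wv_W: "wv X Y Z \<in> W_carr K"
  by (simp add: W_carr_def forall_3 wv_nth)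

lemma W_wv: assumes "x \<in> W_carr K" shows "\<exists>X Y Z. x = wv X Y Z"
proof -
  obtain a b c where abc: "x $ 1 = \<kappa> a" "x $ 2 = \<kappa> b" "x $ 3 = \<kappa> c"
    using assms k_ex by (simp add: W_carr_def) metis
  have "x + (a + b + c) - (a + (a + b + c) + (b + (a + b + c)) + (c + (a + b + c))) = x + (3 * - fst (a + b + c), 3 * - snd (a + b + c))" for x
    by (simp add: prod_eq_iff algebra_simps)
  note r = kp_eqI[OF this]
  \<comment> \<open>The new coordinates add up to four times \<open>a + b + c\<close>, that is to
    \<open>a + b + c\<close> itself, which \<open>wv\<close> subtracts again.\<close>
  have "x = wv (a + (a + b + c)) (b + (a + b + c)) (c + (a + b + c))"
    unfolding vec_eq_iff forall_3 wv_nth abc r by simp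
  then show ?thesis by blast
qed

lemma wv_inj: "wv X Y Z = wv X' Y' Z' \<longleftrightarrow> X = X' \<and> Y = Y' \<and> Z = Z'"
proof
  assume "wv X Y Z = wv X' Y' Z'"
  then have e: "X - (X + Y + Z) = X' - (X' + Y' + Z')" "Y - (X + Y + Z) = Y' - (X' + Y' + Z')"
    "Z - (X + Y + Z) = Z' - (X' + Y' + Z')"
    unfolding vec_eq_iff forall_3 wv_nth k_inj by auto
  have "(a - (a + b + c)) + (b - (a + b + c)) + (c - (a + b + c)) = (a + b + c) + (3 * - fst (a + b + c), 3 * - snd (a + b + c))"
    for a b c :: "'f kp"
    by (simp add: prod_eq_iff algebra_simps)
  note r = kp_eqI[OF this]
  have "X + Y + Z = X' + Y' + Z'" using r[of X Y Z] r[of X' Y' Z'] unfolding e by simp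
  then show "X = X' \<and> Y = Y' \<and> Z = Z'" using e by simp
qed auto

text \<open>With \<open>J\<close> the all-ones matrix, the Gram matrix of the \<open>w_i\<close> and
  the change of coordinates \<open>wv\<close> are both \<open>I - J\<close>. As
  \<open>J^2 = 3 J\<close>, the new Gram matrix is \<open>(I - J)^3 = I - 3 J = I\<close>; the
  polynomials given for \<open>X\<close> are the two components of the form
  \<open>- J\<close>.\<close>

lemma W_herm_wv: "W_herm K (wv X1 X2 X3) (wv Y1 Y2 Y3) =
  \<kappa> (km \<nu> X1 (kc Y1) + km \<nu> X2 (kc Y2) + km \<nu> X3 (kc Y3))"
proof -
  have s: "UNIV - {1} = {2, 3::3}" "UNIV - {2} = {1, 3::3}" "UNIV - {3} = {1, 2::3}"
    using UNIV_3 by auto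
  have ne: "(1::3) \<noteq> 2" "(1::3) \<noteq> 3" "(2::3) \<noteq> 3" by simp_all
  have sm: "sum f {2, 3::3} = f 2 + f 3" "sum f {1, 3::3} = f 1 + f 3" "sum f {1, 2::3} = f 1 + f 2" for f :: "3 \<Rightarrow> 'k"
    using ne by simp_all
  show ?thesis
    unfolding W_herm_def sum_3 s sm wv_nth k_simps k_inj prod_eq_iff km_def kc_def fst_add snd_add fst_diff snd_diff
      fst_uminus snd_uminus fst_conv snd_conv
    apply (rule conjI)
    apply (rule char3_eqI[OF char3, where X = "- ((fst X1 + fst X2 + fst X3) * (fst Y1 + fst Y2 + fst Y3) + \<nu> * (snd X1 + snd X2 + snd X3) * (snd Y1 + snd Y2 + snd Y3))"])
     apply algebra
    apply (rule char3_eqI[OF char3, where X = "- ((snd X1 + snd X2 + snd X3) * (fst Y1 + fst Y2 + fst Y3) - (fst X1 + fst X2 + fst X3) * (snd Y1 + snd Y2 + snd Y3))"])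
    apply algebra
    done
qed

lemma char3_eqI2: "L = - 2 * R \<Longrightarrow> L = (R::'f)"
proof -
  assume "L = - 2 * R"
  then have "L = R - 3 * R" by algebra
  then show "L = R" using char3 by simp
qed

text \<open>The change of coordinates has determinant \<open>1 - 3 = - 2\<close>, which is
  \<open>1\<close> in characteristic 3; this is the factor in \<open>char3_eqI2\<close>.\<close>

lemma W_alt_wv: "W_alt K (\<kappa> a) (wv Z1 Z2 Z3) (wv X1 X2 X3) (wv Y1 Y2 Y3) =
  \<kappa> (km \<nu> a (km \<nu> Z1 (km \<nu> X2 Y3 - km \<nu> X3 Y2) + km \<nu> Z2 (km \<nu> X3 Y1 - km \<nu> X1 Y3) + km \<nu> Z3 (km \<nu> X1 Y2 - km \<nu> X2 Y1)))"
    unfolding W_alt_def wv_nth k_simps k_inj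
  apply (rule arg_cong[where f = "km \<nu> a"])
    unfolding prod_eq_iff km_def fst_add snd_add fst_diff snd_diff
      fst_uminus snd_uminus fst_conv snd_conv
    apply (intro conjI; rule char3_eqI2; algebra)
    done

text \<open>In an orthonormal basis the defining equation yields the usual cross product, conjugated
  because \<open>W_herm\<close> is conjugate linear in its second argument. Testing against the
  basis vectors gives uniqueness.\<close>

lemma W_cross_wv: "W_cross K (\<kappa> a) (wv X1 X2 X3) (wv Y1 Y2 Y3) =
  wv (kc (km \<nu> a (km \<nu> X2 Y3 - km \<nu> X3 Y2))) (kc (km \<nu> a (km \<nu> X3 Y1 - km \<nu> X1 Y3)))
     (kc (km \<nu> a (km \<nu> X1 Y2 - km \<nu> X2 Y1)))" (is "_ = ?c")
  unfolding W_cross_def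
proof (rule the_equality)
  have *: "W_herm K z ?c = W_alt K (\<kappa> a) z (wv X1 X2 X3) (wv Y1 Y2 Y3)" if zW: "z \<in> W_carr K" for z
  proof -
    obtain Z1 Z2 Z3 where z: "z = wv Z1 Z2 Z3" using W_wv[OF zW] by blast
    show ?thesis unfolding z W_herm_wv W_alt_wv k_inj
      by (simp add: km_def kc_def prod_eq_iff; intro conjI; algebra)
  qed
  then show "?c \<in> W_carr K \<and> (\<forall>z\<in>W_carr K. W_herm K z ?c = W_alt K (\<kappa> a) z (wv X1 X2 X3) (wv Y1 Y2 Y3))"
    using wv_W by blast
  fix c assume c: "c \<in> W_carr K \<and> (\<forall>z\<in>W_carr K. W_herm K z c = W_alt K (\<kappa> a) z (wv X1 X2 X3) (wv Y1 Y2 Y3))"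
  then obtain C1 C2 C3 where cc: "c = wv C1 C2 C3" using W_wv by blast
  define D1 D2 D3 where "D1 = kc (km \<nu> a (km \<nu> X2 Y3 - km \<nu> X3 Y2))"
    "D2 = kc (km \<nu> a (km \<nu> X3 Y1 - km \<nu> X1 Y3))" "D3 = kc (km \<nu> a (km \<nu> X1 Y2 - km \<nu> X2 Y1))"
  have dd: "?c = wv D1 D2 D3" by (simp only: D1_D2_D3_def)
  have "W_herm K z c = W_herm K z ?c" if "z \<in> W_carr K" for z
    using c * that by simp
  then have h: "W_herm K (wv Z1 Z2 Z3) (wv C1 C2 C3) = W_herm K (wv Z1 Z2 Z3) (wv D1 D2 D3)" for Z1 Z2 Z3
    using wv_W unfolding cc dd by blast
  show "c = ?c" unfolding cc dd wv_inj
    using h[of "(1,0)" 0 0] h[of 0 "(1,0)" 0] h[of 0 0 "(1,0)"]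
    unfolding W_herm_wv k_inj by (simp add: km_def kc_def prod_eq_iff)
qed

definition Psi :: "'f ep \<Rightarrow> 'k \<times> ('k ^ 3)" where
  "Psi = (\<lambda>(b,X,Y,Z). (\<kappa> b, wv X Y Z))"

lemma wv_add: "wv X Y Z + wv X' Y' Z' = wv (X + X') (Y + Y') (Z + Z')"
  unfolding vec_eq_iff forall_3 by (simp add: wv_nth k_simps k_inj)

lemma Psi_tau: "Psi (etau x) = etale_tau (Psi x)"
proof (cases x)
  fix b X Y Z assume x: "x = (b,X,Y,Z)"
  have "wv Z X Y = (\<chi> i. wv X Y Z $ (i - 1))"
    unfolding vec_eq_iff forall_3 by (simp add: wv_nth ix3 zero3 k_inj)
  then show ?thesis by (simp add: x Psi_def etale_tau_def)
qed

lemma alg_iso_Psi: "alg_iso (EC \<nu> a) (etale_cayley K (\<kappa> a)) Psi"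
proof -
  have smul_wv: "(\<chi> i. smul K c (wv X Y Z $ i)) = wv (c * fst X, c * snd X) (c * fst Y, c * snd Y) (c * fst Z, c * snd Z)" for c X Y Z
    unfolding vec_eq_iff forall_3 by (simp add: wv_nth k_scal k_inj algebra_simps prod_eq_iff)
  have Wsm: "W_smul K (\<kappa> b) (wv X Y Z) = wv (km \<nu> b X) (km \<nu> b Y) (km \<nu> b Z)" for b X Y Z
    unfolding W_smul_def vec_eq_iff forall_3 by (simp add: wv_nth k_mul k_inj km_def algebra_simps prod_eq_iff)
  have the: "(THE c. smul K c (unity K) = W_herm K (wv X Y Z) (wv X Y Z)) =
    fst X ^ 2 + \<nu> * snd X ^ 2 + (fst Y ^ 2 + \<nu> * snd Y ^ 2) + (fst Z ^ 2 + \<nu> * snd Z ^ 2)" for X Y Z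
    unfolding W_herm_wv k_unity k_scal k_inj
    by (rule the_equality) (simp_all add: km_def kc_def prod_eq_iff power2_eq_square algebra_simps)
  have bij: "bij_betw Psi UNIV (carr K \<times> W_carr K)"
    unfolding bij_betw_def
  proof
    show "inj Psi" by (rule injI) (auto simp: Psi_def k_inj wv_inj split: prod.splits)
    show "range Psi = carr K \<times> W_carr K"
    proof
      show "range Psi \<subseteq> carr K \<times> W_carr K" using wv_W by (auto simp: Psi_def split: prod.splits)
      show "carr K \<times> W_carr K \<subseteq> range Psi"
      proof
        fix x assume "x \<in> carr K \<times> W_carr K"
        then obtain b w where x: "x = (b, w)" "b \<in> carr K" "w \<in> W_carr K" by auto
        obtain b' where "b = \<kappa> b'" using x k_ex by blast
        moreover obtain X Y Z where "w = wv X Y Z" using x W_wv by blast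
        ultimately have "x = Psi (b', X, Y, Z)" using x by (simp add: Psi_def)
        then show "x \<in> range Psi" by blast
      qed
    qed
  qed
  have "Psi (x + y) = Psi x + Psi y" for x y
    by (cases x, cases y) (simp add: Psi_def wv_add k_add)
  moreover have "Psi (esm c x) = smul (etale_cayley K (\<kappa> a)) c (Psi x)" for c x
    by (cases x rule: ep_cases) (simp add: Psi_def etale_cayley_def smul_wv k_scal)
  moreover have "nrm (etale_cayley K (\<kappa> a)) (Psi x) = enrm \<nu> x" for x
    by (cases x rule: ep_cases) (simp add: Psi_def etale_cayley_def the k_nrm)
  moreover have "Psi (emul \<nu> a x y) = mul (etale_cayley K (\<kappa> a)) (Psi x) (Psi y)" for x y
  proof (cases x, cases y)
    fix b X1 X2 X3 c Y1 Y2 Y3 assume x: "x = (b,X1,X2,X3)" and y: "y = (c,Y1,Y2,Y3)"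
    show ?thesis unfolding x y Psi_def etale_cayley_def
      by (simp add: k_simps k_inj Wsm W_cross_wv wv_add wv_inj W_herm_wv algebra_simps)
  qed
  moreover have "carr (etale_cayley K (\<kappa> a)) = carr K \<times> W_carr K" by (simp add: etale_cayley_def)
  ultimately show ?thesis unfolding alg_iso_def using bij by simp
qed

end

section \<open>Petersson coordinates of an idempotent, and equivalence of pairs\<close>

definition one_ep :: "'f::field ep" where
  "one_ep = ((1,0),(0,0),(0,0),(0,0))"

text \<open>The coordinate form of \<open>\<tau>\<^sub>e\<close> being conjugate to \<open>\<tau>\<^bsub>K,a\<^esub>\<close>.\<close>

definition petersson_at :: "('f::field, 'v::ab_group_add) nalg \<Rightarrow> 'v \<Rightarrow> 'f \<Rightarrow> 'f kp \<Rightarrow> bool" where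
  "petersson_at A e \<nu> a \<longleftrightarrow> (\<exists>f. alg_iso A (PE \<nu> a) f \<and> f e = one_ep)"

lemma polar_EC: "polar (EC \<nu> a) = polar (PE \<nu> b)"
  by (intro ext) (simp add: polar_def)

lemma normed_algebra_EC: "normed_algebra (EC \<nu> a)"
proof -
  have "emul \<nu> a (x + y) z = emul \<nu> a x z + emul \<nu> a y z \<and> emul \<nu> a z (x + y) = emul \<nu> a z x + emul \<nu> a z y"
    for x y z
    by (cases x rule: ep_cases, cases y rule: ep_cases, cases z rule: ep_cases)
      (simp add: ep_simps algebra_simps)
  moreover have "emul \<nu> a (esm c x) y = esm c (emul \<nu> a x y) \<and> emul \<nu> a x (esm c y) = esm c (emul \<nu> a x y)"
    for x y c
    by (cases x rule: ep_cases, cases y rule: ep_cases) (simp add: ep_simps algebra_simps)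
  ultimately show ?thesis
    using normed_algebra_PE[of \<nu> a]
    by (simp add: normed_algebra_def bilinear_mul_def quadratic_nrm_def polar_EC[of \<nu> a a])
qed

lemma emul_one: "emul \<nu> a one_ep x = x" "emul \<nu> a x one_ep = x"
  by (cases x rule: ep_cases; simp add: ep_simps one_ep_def)+

lemma pmul_one: "pmul \<nu> a one_ep x = etau (etau (ecnj x))" "pmul \<nu> a x one_ep = etau (ecnj x)"
  by (cases x rule: ep_cases; simp add: ep_simps one_ep_def)+

lemma idem_cayley_PE: "pmul \<nu> a (pmul \<nu> a one_ep x) (pmul \<nu> a y one_ep) = emul \<nu> a x y"
  unfolding pmul_one unfolding pmul_def
  by (cases x rule: ep_cases, cases y rule: ep_cases) (simp add: kc_def)

lemma tau_PE: "pmul \<nu> a one_ep (pmul \<nu> a one_ep x) = etau x"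
  unfolding pmul_one by (cases x rule: ep_cases) (simp add: kc_def)

lemma ecnj_eq: "ecnj x = esm (polar (PE \<nu> a) one_ep x) one_ep - x"
  by (cases x rule: ep_cases) (simp add: one_ep_def polar_PE kc_def uminus_prod_def minus_prod_def zero_prod_def)

lemma idem_cayley_sel[simp]: "carr (idem_cayley A e) = carr A" "smul (idem_cayley A e) = smul A"
  "nrm (idem_cayley A e) = nrm A" "mul (idem_cayley A e) x y = mul A (mul A e x) (mul A y e)"
  by (simp_all add: idem_cayley_def)

lemma polar_idem_cayley[simp]: "polar (idem_cayley A e) = polar A"
  by (intro ext) (simp add: polar_def)

context symcomp
begin

text \<open>The Petersson construction undoes the passage to the Cayley product and
  \<open>\<tau>\<close> at \<open>e\<close>: writing \<open>cj\<close> for conjugation,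
  \<open>e \<star> \<tau> (cj x) = x\<close> and
  \<open>\<tau> (\<tau> (cj y)) \<star> e = y\<close>.\<close>

lemma Petersson_eq:
  assumes e: "idempotent A e" and x: "x \<in> C" "y \<in> C"
  defines "cj \<equiv> \<lambda>x. B e x \<bullet>\<^sub>s e - x"
  shows "x \<star> y = mul (idem_cayley A e) (idem_tau A e (cj x)) (idem_tau A e (idem_tau A e (cj y)))"
proof -
  note [simp] = eC[OF e] tauC[OF e]
  have cC[simp]: "cj x \<in> C" "cj y \<in> C" using x by (simp_all add: cj_def)
  have b: "B e (cj u) = B e u" if "u \<in> C" for u
    using that fneg_double[of "- B e u"] by (simp add: cj_def Bee[OF e])
  have 1: "e \<star> idem_tau A e (cj u) = u" if "u \<in> C" "cj u \<in> C" for u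
    using that e_mult_tau[OF e, of "cj u"] by (simp add: b) (simp add: cj_def)
  have 2: "idem_tau A e (idem_tau A e (cj u)) \<star> e = u" if "u \<in> C" "cj u \<in> C" for u
    using that 1[OF that] tau_mult_e[OF e, of "idem_tau A e (cj u)"] by simp
  show ?thesis using x 1[of x] 2[of y] by simp
qed

text \<open>From left to right, the coordinates \<open>f\<close> derived from \<open>\<psi>\<close>
  respect unity, norm and \<open>\<tau>\<close>, hence conjugation, and \<open>Petersson_eq\<close>
  rebuilds the product of \<open>A\<close> from these. Conversely, the Cayley product and
  \<open>\<tau>\<close> at \<open>e\<close> are expressions in the product of \<open>A\<close> and
  are carried along.\<close>

lemma tau_conjugate_iff:
  assumes e: "idempotent A e" and K: "etale_coord K \<nu> \<kappa>"
  shows "tau_conjugate A e K (\<kappa> a) \<longleftrightarrow> petersson_at A e \<nu> a"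
proof
  interpret K: etale_coord K \<nu> \<kappa> by fact
  note Psi = K.alg_iso_Psi[of a]
  note [simp] = eC[OF e] tauC[OF e]
  { assume "tau_conjugate A e K (\<kappa> a)"
    then obtain \<psi> where p: "alg_iso (idem_cayley A e) (etale_cayley K (\<kappa> a)) \<psi>"
      "\<And>x. x \<in> C \<Longrightarrow> \<psi> (idem_tau A e x) = etale_tau (\<psi> x)" by (auto simp: tau_conjugate_def)
    define f where "f x = inv_into (carr (EC \<nu> a)) K.Psi (\<psi> x)" for x
    have f: "alg_iso (idem_cayley A e) (EC \<nu> a) f"
      unfolding f_def by (rule alg_iso_comp[OF p(1) alg_iso_inv[OF Psi normed_algebra_EC]])
    have Pf: "K.Psi (f x) = \<psi> x" if "x \<in> C" for x
      unfolding f_def using alg_isoD(1)[OF Psi] alg_isoD(2)[OF p(1), of x] that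
      by (intro f_inv_into_f) (simp add: bij_betw_def)
    have ft: "f (idem_tau A e x) = etau (f x)" if "x \<in> C" for x
    proof -
      have "K.Psi (f (idem_tau A e x)) = K.Psi (etau (f x))"
        using that Pf[of x] Pf[of "idem_tau A e x"] p(2)[of x] K.Psi_tau[of "f x"] by simp
      then show ?thesis using alg_iso_injD[OF Psi, of "f (idem_tau A e x)" "etau (f x)"] by simp
    qed
    have fe: "f e = one_ep"
    proof -
      obtain u where u: "u \<in> C" "f u = one_ep" using alg_iso_surjE[OF f, of one_ep] by auto
      have "emul \<nu> a (f e) (f u) = f ((e \<star> e) \<star> (u \<star> e))"
        using alg_isoD(5)[OF f, of e u] u by simp
      also have "\<dots> = f u" using u ee[OF e] Ne[OF e] by (simp add: flexr)
      finally show ?thesis using u by (simp add: emul_one)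
    qed
    have fB: "polar (PE \<nu> a) (f x) (f y) = B x y" if "x \<in> C" "y \<in> C" for x y
    proof -
      have "normed_algebra (idem_cayley A e)"
        using na e by (auto simp: normed_algebra_def bilinear_mul_def quadratic_nrm_def)
      then show ?thesis using alg_iso_polar[OF f] that by (simp add: polar_EC[of \<nu> a a])
    qed
    have fc: "f (B e x \<bullet>\<^sub>s e - x) = ecnj (f x)" if "x \<in> C" for x
    proof -
      have "f (B e x \<bullet>\<^sub>s e - x) + f x = esm (B e x) (f e)"
        using alg_isoD(3)[OF f, of "B e x \<bullet>\<^sub>s e - x" x] alg_isoD(4)[OF f, of e "B e x"] that by simp
      then show ?thesis using that fB[of e x] by (simp add: ecnj_eq[of _ \<nu> a] fe eq_diff_eq)
    qed
    have "f (x \<star> y) = pmul \<nu> a (f x) (f y)" if "x \<in> C" "y \<in> C" for x y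
      using that Petersson_eq[OF e that] alg_isoD(5)[OF f, of "idem_tau A e (B e x \<bullet>\<^sub>s e - x)" "idem_tau A e (idem_tau A e (B e y \<bullet>\<^sub>s e - y))"]
      by (simp add: ft fc pmul_def del: idem_cayley_sel(4))
    then have "alg_iso A (PE \<nu> a) f" using f by (simp add: alg_iso_def)
    then show "petersson_at A e \<nu> a" using fe by (auto simp: petersson_at_def) }
  { assume "petersson_at A e \<nu> a"
    then obtain f where f: "alg_iso A (PE \<nu> a) f" "f e = one_ep" by (auto simp: petersson_at_def)
    have fm: "f (x \<star> y) = pmul \<nu> a (f x) (f y)" if "x \<in> C" "y \<in> C" for x y
      using alg_isoD(5)[OF f(1) that] by simp
    have "alg_iso (idem_cayley A e) (EC \<nu> a) f"
      using f(1) unfolding alg_iso_def by (simp add: fm f(2) idem_cayley_PE)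
    moreover have "f (idem_tau A e x) = etau (f x)" if "x \<in> C" for x
      using that by (simp add: idem_tau_def fm f(2) tau_PE)
    ultimately show "tau_conjugate A e K (\<kappa> a)"
      unfolding tau_conjugate_def using alg_iso_comp[OF _ Psi]
      by (intro exI[of _ "\<lambda>x. K.Psi (f x)"]) (auto simp: K.Psi_tau) }
qed

end

text \<open>The coordinate form of pair equivalence, along the isomorphism \<open>z \<mapsto> y z'\<close>.\<close>

definition pair_eq :: "'f::field \<Rightarrow> 'f kp \<Rightarrow> 'f \<Rightarrow> 'f kp \<Rightarrow> bool" where
  "pair_eq \<nu> a \<nu>' a' \<longleftrightarrow> (\<exists>y c. y \<noteq> 0 \<and> \<nu> = \<nu>' * y ^ 2 \<and> (fst a, y * snd a) = km \<nu>' (km \<nu>' c (km \<nu>' c c)) a')"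

lemma km_assoc: "km \<nu> (km \<nu> a b) c = km \<nu> a (km \<nu> b c)"
  by (simp add: km_def algebra_simps)

lemma km_comm: "km \<nu> a b = km \<nu> b a"
  by (simp add: km_def algebra_simps)

lemma km_left_comm: "km \<nu> a (km \<nu> b c) = km \<nu> b (km \<nu> a c)"
  by (simp add: km_def algebra_simps)

lemma km_one: "km \<nu> (1,0) a = a" "km \<nu> a (1,0) = a"
  by (simp_all add: km_def)

definition knorm :: "'f::field \<Rightarrow> 'f kp \<Rightarrow> 'f" where
  "knorm \<nu> a = fst a ^ 2 + \<nu> * snd a ^ 2"

lemma knorm_km: "knorm \<nu> (km \<nu> a b) = knorm \<nu> a * knorm \<nu> b"
  unfolding knorm_def km_def fst_conv snd_conv by algebra

lemma km_kc: "km \<nu> a (kc a) = (knorm \<nu> a, 0)"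
  by (simp add: km_def kc_def knorm_def power2_eq_square algebra_simps)

lemma cube_eq_1: assumes 3: "(3::'f::field) = 0" and "n ^ 3 = (1::'f)" shows "n = 1"
  using assms cube_diff[OF 3, of n 1] by simp

lemma petersson_at_scale:
  fixes \<nu> :: "'f::field"
  assumes y: "y \<noteq> 0" and "petersson_at A e (\<nu> * y^2) a"
  shows "petersson_at A e \<nu> (fst a, y * snd a)"
proof -
  define s where "s x = (fst x, y * snd x)" for x :: "'f kp"
  define h :: "'f ep \<Rightarrow> 'f ep" where "h = (\<lambda>(b,X,Y,Z). (s b, s X, s Y, s Z))"
  define s' where "s' x = (fst x, snd x / y)" for x :: "'f kp"
  define h' :: "'f ep \<Rightarrow> 'f ep" where "h' = (\<lambda>(b,X,Y,Z). (s' b, s' X, s' Y, s' Z))"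
  have "h' (h x) = x" "h (h' x) = x" for x
    using y by (cases x rule: ep_cases; simp add: h_def h'_def s_def s'_def)+
  then have "bij_betw h UNIV UNIV" by (intro bij_betw_byWitness[of _ h']) auto
  moreover have "h (u + v) = h u + h v" "h (esm c u) = esm c (h u)" "enrm \<nu> (h u) = enrm (\<nu> * y^2) u" for u v c
    by (cases u rule: ep_cases, cases v rule: ep_cases; simp add: h_def s_def algebra_simps power2_eq_square)+
  moreover have "h (pmul (\<nu> * y^2) a u v) = pmul \<nu> (fst a, y * snd a) (h u) (h v)" for u v
    by (cases u rule: ep_cases, cases v rule: ep_cases) (simp add: h_def s_def ep_simps algebra_simps power2_eq_square)
  ultimately have "alg_iso (PE (\<nu> * y^2) a) (PE \<nu> (fst a, y * snd a)) h"
    by (simp add: alg_iso_def)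
  moreover have "h one_ep = one_ep" by (simp add: h_def one_ep_def s_def)
  moreover obtain f where "alg_iso A (PE (\<nu> * y^2) a) f" "f e = one_ep" using assms(2) unfolding petersson_at_def by blast
  ultimately show ?thesis unfolding petersson_at_def by (intro exI[of _ "\<lambda>x. h (f x)"]) (auto intro: alg_iso_comp)
qed

text \<open>Multiplying \<open>W\<close> by an element \<open>c\<close> of norm one preserves the
  hermitian form and multiplies the alternating form by \<open>c^3\<close>.\<close>

lemma petersson_at_cube:
  fixes \<nu> :: "'f::field"
  assumes c: "knorm \<nu> c = 1" and "petersson_at A e \<nu> (km \<nu> (km \<nu> c (km \<nu> c c)) a)"
  shows "petersson_at A e \<nu> a"
proof -
  define h :: "'f ep \<Rightarrow> 'f ep" where "h = (\<lambda>(b,X,Y,Z). (b, km \<nu> c X, km \<nu> c Y, km \<nu> c Z))"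
  define h' :: "'f ep \<Rightarrow> 'f ep" where "h' = (\<lambda>(b,X,Y,Z). (b, km \<nu> (kc c) X, km \<nu> (kc c) Y, km \<nu> (kc c) Z))"
  have cc: "km \<nu> c (kc c) = (1,0)" "km \<nu> (kc c) c = (1,0)" using km_kc[of \<nu> c] c by (simp_all add: km_comm)
  have cc': "km \<nu> c (km \<nu> (kc c) X) = X" "km \<nu> (kc c) (km \<nu> c X) = X" for X
    by (simp_all add: km_assoc[symmetric] cc km_one)
  have cn: "fst c ^ 2 + \<nu> * snd c ^ 2 = 1" using c by (simp add: knorm_def)
  have lin: "km \<nu> b (X + Y) = km \<nu> b X + km \<nu> b Y" "km \<nu> b (X - Y) = km \<nu> b X - km \<nu> b Y" "km \<nu> b (- X) = - km \<nu> b X"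
    "kc (km \<nu> X Y) = km \<nu> (kc X) (kc Y)" "kc (X + Y) = kc X + kc Y" "kc (X - Y) = kc X - kc Y" "kc (- X) = - kc X" "kc (kc X) = X" for b X Y
    by (simp_all add: km_def kc_def prod_eq_iff algebra_simps)
  have "h' (h x) = x" "h (h' x) = x" for x
    by (cases x; simp add: h_def h'_def cc')+
  then have "bij_betw h UNIV UNIV" by (intro bij_betw_byWitness[of _ h']) auto
  moreover have "h (u + v) = h u + h v" "h (esm t u) = esm t (h u)" for u v t
    by (cases u rule: ep_cases, cases v rule: ep_cases; simp add: h_def km_def algebra_simps)+
  moreover have "enrm \<nu> (h u) = enrm \<nu> u" for u
  proof -
    have k: "enrm \<nu> (b,X,Y,Z) = knorm \<nu> b + knorm \<nu> X + knorm \<nu> Y + knorm \<nu> Z" for b X Y Z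
      by (cases b; cases X; cases Y; cases Z) (simp add: knorm_def)
    show ?thesis by (cases u) (simp add: h_def k knorm_km c)
  qed
  moreover have "h (pmul \<nu> (km \<nu> (km \<nu> c (km \<nu> c c)) a) u v) = pmul \<nu> a (h u) (h v)" for u v
  proof -
    have 1: "km \<nu> (km \<nu> c X) (kc (km \<nu> c Y)) = km \<nu> X (kc Y)" for X Y
    proof -
      have "km \<nu> (km \<nu> c X) (kc (km \<nu> c Y)) = km \<nu> (km \<nu> c (kc c)) (km \<nu> X (kc Y))"
        by (simp only: lin km_assoc km_comm km_left_comm)
      then show ?thesis by (simp only: cc km_one)
    qed
    have 2: "km \<nu> c (kc (km \<nu> (km \<nu> (km \<nu> c (km \<nu> c c)) a) P)) = kc (km \<nu> a (km \<nu> c (km \<nu> c P)))" for P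
    proof -
      have "km \<nu> c (kc (km \<nu> (km \<nu> (km \<nu> c (km \<nu> c c)) a) P)) =
         km \<nu> (km \<nu> c (kc c)) (kc (km \<nu> a (km \<nu> c (km \<nu> c P))))"
        by (simp only: lin km_assoc km_comm km_left_comm)
      then show ?thesis by (simp only: cc km_one)
    qed
    have 3: "km \<nu> c (km \<nu> b X) = km \<nu> b (km \<nu> c X)" for b X by (rule km_left_comm)
    have 4: "km \<nu> (km \<nu> c X) (km \<nu> c Y) - km \<nu> (km \<nu> c Z) (km \<nu> c W) = km \<nu> c (km \<nu> c (km \<nu> X Y - km \<nu> Z W))" for X Y Z W
      by (simp only: lin km_assoc km_comm km_left_comm)
    have em: "h (emul \<nu> (km \<nu> (km \<nu> c (km \<nu> c c)) a) u v) = emul \<nu> a (h u) (h v)" for u v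
    proof (cases u, cases v)
      fix b X1 X2 X3 d Y1 Y2 Y3 assume u: "u = (b,X1,X2,X3)" and v: "v = (d,Y1,Y2,Y3)"
      show ?thesis unfolding u v h_def emul.simps split_conv 1 4 2[symmetric] lin(1) 3[of _ X1] 3[of _ X2] 3[of _ X3]
        3[of _ Y1] 3[of _ Y2] 3[of _ Y3] ..
    qed
    have "h (etau x) = etau (h x)" "h (ecnj x) = ecnj (h x)" for x
      by (cases x; simp only: h_def split_conv etau.simps ecnj.simps lin(3))+
    then show ?thesis by (simp only: pmul_def em)
  qed
  ultimately have "alg_iso (PE \<nu> (km \<nu> (km \<nu> c (km \<nu> c c)) a)) (PE \<nu> a) h"
    by (simp add: alg_iso_def)
  moreover have "h one_ep = one_ep" by (simp add: h_def one_ep_def km_def)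
  moreover obtain f where "alg_iso A (PE \<nu> (km \<nu> (km \<nu> c (km \<nu> c c)) a)) f" "f e = one_ep" using assms(2) unfolding petersson_at_def by blast
  ultimately show ?thesis unfolding petersson_at_def by (intro exI[of _ "\<lambda>x. h (f x)"]) (auto intro: alg_iso_comp)
qed

text \<open>Taking norms in the equation shows that the cube of the norm of \<open>c\<close> is
  \<open>1\<close>, and cubing is injective in characteristic 3.\<close>

lemma knorm_pair_eq:
  assumes 3: "(3::'f::field) = 0" and "knorm \<nu> a = (1::'f)" "knorm \<nu>' a' = 1"
    "\<nu> = \<nu>' * y ^ 2" "(fst a, y * snd a) = km \<nu>' (km \<nu>' c (km \<nu>' c c)) a'"
  shows "knorm \<nu>' c = 1"
proof -
  have "knorm \<nu>' (fst a, y * snd a) = knorm \<nu> a" by (simp add: knorm_def assms(4) power_mult_distrib)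
  then have "knorm \<nu>' c ^ 3 = 1" unfolding assms(5) knorm_km using assms(2,3) by (simp add: power3_eq_cube mult.assoc)
  then show ?thesis by (rule cube_eq_1[OF 3])
qed

lemma petersson_at_pair_eq:
  assumes 3: "(3::'f::field) = 0" and "petersson_at A e \<nu> a" "pair_eq \<nu> a \<nu>' a'" "knorm \<nu> a = 1" "knorm \<nu>' a' = (1::'f)"
  shows "petersson_at A e \<nu>' a'"
proof -
  obtain y c where y: "y \<noteq> 0" "\<nu> = \<nu>' * y ^ 2" "(fst a, y * snd a) = km \<nu>' (km \<nu>' c (km \<nu>' c c)) a'"
    using assms(3) by (auto simp: pair_eq_def)
  have "petersson_at A e \<nu>' (fst a, y * snd a)" using petersson_at_scale[OF y(1)] assms(2) y(2) by blast
  then show ?thesis using petersson_at_cube[OF knorm_pair_eq[OF 3 assms(4,5) y(2,3)]] y(3) by simp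
qed

text \<open>\<open>fe b c\<close> is the general fixed vector of \<open>etau\<close>. Its companion
  \<open>sg\<close> adds up the coordinates in \<open>W\<close>: this sum is all that
  \<open>g\<close> and the pairing with the vectors \<open>fe 0 t\<close> see of them.\<close>

definition fe :: "'f::field kp \<Rightarrow> 'f kp \<Rightarrow> 'f ep" where
  "fe b c = (b,c,c,c)"

definition sg :: "'f::field ep \<Rightarrow> 'f kp" where
  "sg = (\<lambda>(b,X,Y,Z). X + Y + Z)"

lemma etau_fixed: "etau u = u \<Longrightarrow> \<exists>b c. u = fe b c"
proof -
  assume a: "etau u = u"
  obtain b x1 x2 x3 where u: "u = (b,x1,x2,x3)" by (metis surj_pair)
  have "x2 = x1" "x3 = x1" using a unfolding u etau.simps prod.inject by blast+
  then show ?thesis unfolding u fe_def by blast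
qed

lemma polar_fe:
  "polar (PE \<nu> a) u (fe 0 t) = 2 * (fst (sg u) * fst t + \<nu> * snd (sg u) * snd t)"
  by (cases u rule: ep_cases; cases t) (simp add: fe_def sg_def polar_PE zero_prod_def algebra_simps)

lemma polar_one_ep: "polar (PE \<nu> a) one_ep u = 2 * fst (fst u)"
  by (cases u rule: ep_cases) (simp add: one_ep_def polar_PE)

lemma cubic_PE_sg:
  assumes 3: "(3::'f::field) = 0"
  shows "cubic_form (PE \<nu> a) u = - (fst (fst u) ^ 3) - fst a * fst (sg u) ^ 3 - snd a * \<nu>^2 * snd (sg u) ^ 3 + (0::'f)"
  by (cases u rule: ep_cases; cases a) (simp add: cubic_PE[OF 3] sg_def)

text \<open>Two coordinate systems at \<open>e\<close> differ by an isomorphism \<open>h\<close>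
  that fixes \<open>one_ep\<close> and commutes with \<open>etau\<close>, hence maps fixed vectors
  to fixed vectors. Norms of \<open>fe 0 c\<close> and pairings of it with fixed vectors are
  multiples of 3; so the norm of the image of \<open>z\<close> gives
  \<open>\<nu> = \<nu>' y^2\<close>, and \<open>fe 0 (1,0)\<close> goes to some
  \<open>fe 0 c\<close>. Comparing the two forms \<open>g\<close> shows that the cube of this
  \<open>c\<close> relates \<open>a\<close> and \<open>a'\<close>.\<close>

lemma petersson_at_unique:
  fixes \<nu> :: "'f::field"
  assumes 3: "(3::'f) = 0" and nu: "\<nu> \<noteq> 0" "\<nu>' \<noteq> 0" and a: "knorm \<nu> a = 1" "knorm \<nu>' a' = 1"
    and A: "normed_algebra A" "e \<in> carr A" and t: "petersson_at A e \<nu> a" "petersson_at A e \<nu>' a'"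
  shows "pair_eq \<nu> a \<nu>' a'"
proof -
  have 2: "(2::'f) \<noteq> 0" using 3 by (rule char3_two_neq_0)
  obtain f f' where f: "alg_iso A (PE \<nu> a) f" "f e = one_ep" "alg_iso A (PE \<nu>' a') f'" "f' e = one_ep"
    using t by (auto simp: petersson_at_def)
  define h where "h x = f' (inv_into (carr A) f x)" for x
  have h: "alg_iso (PE \<nu> a) (PE \<nu>' a') h"
    unfolding h_def by (rule alg_iso_comp[OF alg_iso_inv[OF f(1) A(1)] f(3)])
  have "inv_into (carr A) f one_ep = e"
    using inv_into_f_f[of f "carr A" e] alg_isoD(1)[OF f(1)] A(2) f(2) by (simp add: bij_betw_def)
  then have h1: "h one_ep = one_ep" by (simp add: h_def f(4))
  have hB: "polar (PE \<nu>' a') (h x) (h y) = polar (PE \<nu> a) x y" for x y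
    using alg_iso_polar[OF h normed_algebra_PE] by simp
  have hm: "h (pmul \<nu> a x y) = pmul \<nu>' a' (h x) (h y)" for x y
    using alg_isoD(5)[OF h, of x y] by simp
  have ha: "h (x + y) = h x + h y" and hs: "h (esm c x) = esm c (h x)" and hN: "enrm \<nu>' (h x) = enrm \<nu> x" for x y c
    using alg_isoD(3)[OF h, of x y] alg_isoD(4)[OF h, of x c] alg_isoD(6)[OF h, of x] by simp_all
  have hg: "cubic_form (PE \<nu>' a') (h u) = cubic_form (PE \<nu> a) u" for u
    by (simp add: cubic_form_def hB hm[symmetric])
  have ht: "h (etau u) = etau (h u)" for u
    using hm h1 by (metis tau_PE)
  have fix_fe: "etau (fe b c) = fe b c" for b c :: "'f kp" by (simp add: fe_def)
  have b0: "fst (fst (h u)) = fst (fst u)" for u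
    using hB[of one_ep u] 2 by (simp add: h1 polar_one_ep)
  obtain b d where hz: "h (fe (0,1) 0) = fe b d"
    using etau_fixed[of "h (fe (0,1) 0)"] ht[of "fe (0,1) 0"] by (auto simp: fix_fe)
  define y where "y = snd b"
  have b: "b = (0, y)" using b0[of "fe (0,1) 0"] unfolding hz by (simp add: fe_def y_def prod_eq_iff)
  have "enrm \<nu>' (fe b d) = \<nu>' * y^2 + 3 * (fst d ^ 2 + \<nu>' * snd d ^ 2)"
    unfolding b by (cases d) (simp add: fe_def)
  moreover have "enrm \<nu> (fe (0,1) 0) = \<nu>" by (simp add: fe_def zero_prod_def)
  ultimately have ny: "\<nu> = \<nu>' * y^2" using hN[of "fe (0,1) 0"] unfolding hz by (simp add: 3)
  then have y: "y \<noteq> 0" using nu by auto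
  obtain b' c where hw: "h (fe 0 (1,0)) = fe b' c"
    using etau_fixed[of "h (fe 0 (1,0))"] ht[of "fe 0 (1,0)"] by (auto simp: fix_fe)
  have "polar (PE \<nu>' a') (fe b' c) (fe b d) = 2 * \<nu>' * snd b' * y + 3 * (2 * (fst c * fst d + \<nu>' * snd c * snd d))"
    unfolding b by (cases b'; cases c; cases d) (simp add: fe_def polar_PE algebra_simps)
  moreover have "polar (PE \<nu> a) (fe 0 (1,0)) (fe (0,1) 0) = 0" by (simp add: fe_def polar_PE zero_prod_def)
  ultimately have "snd b' = 0" using hB[of "fe 0 (1,0)" "fe (0,1) 0"] 2 nu y unfolding hz hw by (simp add: 3)
  moreover have "fst b' = 0" using b0[of "fe 0 (1,0)"] unfolding hw by (simp add: fe_def)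
  ultimately have b': "b' = 0" by (simp add: prod_eq_iff)
  have "pmul \<nu>' a' (fe b d) (fe b' c) = fe (3 * - (fst d * fst c + \<nu>' * snd d * snd c), 3 * - (snd d * fst c - fst d * snd c)) (km \<nu>' (0,y) c)"
    unfolding b b' by (cases c; cases d; cases a') (simp add: fe_def ep_simps algebra_simps)
  then have "pmul \<nu>' a' (fe b d) (fe b' c) = fe 0 (km \<nu>' (0,y) c)" by (simp add: 3 zero_prod_def)
  moreover have "pmul \<nu> a (fe (0,1) 0) (fe 0 (1,0)) = fe 0 (0,1)"
    by (cases a) (simp add: fe_def ep_simps)
  ultimately have hwz: "h (fe 0 (0,1)) = fe 0 (km \<nu>' (0,y) c)" using hm[of "fe (0,1) 0" "fe 0 (1,0)"] unfolding hz hw by simp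
  \<comment> \<open>\<open>S0\<close> and \<open>S1\<close> are adjoint to the action of
    \<open>h\<close> on the vectors \<open>fe 0 t\<close>. Together they say that
    \<open>sg u\<close>, carried to the second etale algebra by \<open>y\<close>, is
    \<open>sg (h u)\<close> times the conjugate of \<open>c\<close>.\<close>
  have S0: "fst (sg u) = fst (sg (h u)) * fst c + \<nu>' * snd (sg (h u)) * snd c" for u
  proof -
    have "fst (sg (h u)) * fst c + \<nu>' * snd (sg (h u)) * snd c = fst (sg u) * fst (1,0::'f) + \<nu> * snd (sg u) * snd (1::'f,0)"
      using hB[of u "fe 0 (1,0)"] 2 unfolding hw b' polar_fe mult_cancel_left by blast
    then show ?thesis by simp
  qed
  have S1: "y * snd (sg u) = snd (sg (h u)) * fst c - fst (sg (h u)) * snd c" for u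
  proof -
    have "fst (sg (h u)) * fst (km \<nu>' (0,y) c) + \<nu>' * snd (sg (h u)) * snd (km \<nu>' (0,y) c) = fst (sg u) * fst (0::'f,1::'f) + \<nu> * snd (sg u) * snd (0::'f,1)"
      using hB[of u "fe 0 (0,1)"] 2 unfolding hwz polar_fe mult_cancel_left by blast
    then have "\<nu> * snd (sg u) = fst (sg (h u)) * fst (km \<nu>' (0,y) c) + \<nu>' * snd (sg (h u)) * snd (km \<nu>' (0,y) c)"
      by simp
    then have "(\<nu>' * y) * (y * snd (sg u)) = (\<nu>' * y) * (snd (sg (h u)) * fst c - fst (sg (h u)) * snd c)"
      unfolding ny km_def fst_conv snd_conv by algebra
    then show ?thesis using nu y by simp
  qed
  obtain p q where pq: "a = (p,q)" by (cases a)
  obtain p' q' where pq': "a' = (p',q')" by (cases a')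
  obtain c0 c1 where c: "c = (c0,c1)" by (cases c)
  define Q where "Q = y * q"
  have G: "p * fst (sg u) ^ 3 + Q * \<nu>'^2 * (y * snd (sg u)) ^ 3 = p' * fst (sg (h u)) ^ 3 + q' * \<nu>'^2 * snd (sg (h u)) ^ 3" for u
  proof -
    have "Q * \<nu>'^2 * (y * snd (sg u)) ^ 3 = q * \<nu>^2 * snd (sg u) ^ 3"
      unfolding Q_def ny by algebra
    moreover have "- (p' * fst (sg (h u)) ^ 3) - q' * \<nu>'^2 * snd (sg (h u)) ^ 3 =
      - (p * fst (sg u) ^ 3) - q * \<nu>^2 * snd (sg u) ^ 3"
      using hg[of u] unfolding cubic_PE_sg[OF 3] b0 pq pq' by simp
    ultimately show ?thesis by algebra
  qed
  have G': "p * (s0 * c0 + \<nu>' * s1 * c1) ^ 3 + Q * \<nu>'^2 * (s1 * c0 - s0 * c1) ^ 3 = p' * s0 ^ 3 + q' * \<nu>'^2 * s1 ^ 3" for s0 s1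
  proof -
    obtain u where "h u = (0, (s0,s1), 0, 0)" using alg_iso_surjE[OF h, of "(0, (s0,s1), 0, 0)"] by (metis PE_sel(1) UNIV_I)
    then have "sg (h u) = (s0, s1)" by (simp add: sg_def)
    then show ?thesis using G[of u] S0[of u] S1[of u] by (simp add: c)
  qed
  have i: "p' = p * c0 ^ 3 - Q * \<nu>'^2 * c1 ^ 3"
    using G'[of 1 0] by simp
  have "\<nu>'^2 * q' = \<nu>'^2 * (p * \<nu>' * c1 ^ 3 + Q * c0 ^ 3)"
    using G'[of 0 1] by (simp add: power_mult_distrib) algebra
  then have ii: "q' = p * \<nu>' * c1 ^ 3 + Q * c0 ^ 3" using nu by simp
  have n1: "p ^ 2 + \<nu>' * Q ^ 2 = 1" using a(1) unfolding pq knorm_def ny Q_def by (simp add: power_mult_distrib ac_simps)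
  have n2: "p' ^ 2 + \<nu>' * q' ^ 2 = 1" using a(2) unfolding pq' knorm_def by simp
  \<comment> \<open>The last factor is the cube of the norm of \<open>c\<close>; its value
    \<open>1\<close> is what inverts the linear equations \<open>i\<close> and
    \<open>ii\<close>.\<close>
  have "(p' ^ 2 + \<nu>' * q' ^ 2) = (p ^ 2 + \<nu>' * Q ^ 2) * (c0 ^ 6 + \<nu>' ^ 3 * c1 ^ 6)"
    unfolding i ii by algebra
  then have n3: "c0 ^ 6 + \<nu>' ^ 3 * c1 ^ 6 = 1" using n1 n2 by simp
  have "km \<nu>' c (km \<nu>' c c) = (c0 ^ 3 + 3 * - (\<nu>' * c0 * c1^2), - (\<nu>' * c1 ^ 3) + 3 * (c0^2 * c1))"
    unfolding c km_def by (simp add: prod_eq_iff algebra_simps power2_eq_square power3_eq_cube)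
  then have "km \<nu>' c (km \<nu>' c c) = (c0 ^ 3, - (\<nu>' * c1 ^ 3))" by (simp add: 3)
  moreover have "p = c0 ^ 3 * p' - \<nu>' * (- (\<nu>' * c1 ^ 3)) * q'" "Q = c0 ^ 3 * q' + (- (\<nu>' * c1 ^ 3)) * p'"
    unfolding i ii using n3 by algebra+
  ultimately have "(fst a, y * snd a) = km \<nu>' (km \<nu>' c (km \<nu>' c c)) a'"
    unfolding pq pq' by (simp add: km_def Q_def[symmetric])
  then show ?thesis unfolding pair_eq_def using y ny by blast
qed

lemma alg_cubes_coord:
  assumes "etale_coord K \<nu> \<kappa>"
  shows "alg_cubes K = {\<kappa> (km \<nu> c (km \<nu> c c)) | c. True}"
proof -
  interpret K: etale_coord K \<nu> \<kappa> by fact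
  have "mul K b (mul K b b) \<in> {\<kappa> (km \<nu> c (km \<nu> c c)) | c. True}" if bK: "b \<in> carr K" for b
  proof -
    obtain c where b: "b = \<kappa> c" using K.k_ex[OF bK] by blast
    show ?thesis unfolding b K.k_mul by blast
  qed
  moreover have "\<kappa> (km \<nu> c (km \<nu> c c)) \<in> alg_cubes K" for c
    unfolding alg_cubes_def by (intro CollectI exI[of _ "\<kappa> c"]) (simp only: K.k_mul K.k_C simp_thms)
  ultimately show ?thesis unfolding alg_cubes_def by blast
qed

lemma alg_iso_KM:
  assumes "y \<noteq> 0" "\<nu> = \<nu>' * y ^ 2"
  shows "alg_iso (KM \<nu>) (KM \<nu>') (\<lambda>x. (fst x, y * snd x))"
  unfolding alg_iso_def
  using assms bij_betw_byWitness[of UNIV "\<lambda>x. (fst x, snd x / y)" "\<lambda>x. (fst x, y * snd x)" UNIV]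
  by (simp add: km_def algebra_simps power2_eq_square)

lemma alg_iso_KM_form:
  fixes \<nu> :: "'f::field"
  assumes 3: "(3::'f) = 0" and nu: "\<nu> \<noteq> 0" and h: "alg_iso (KM \<nu>) (KM \<nu>') h"
  shows "\<exists>y. y \<noteq> 0 \<and> \<nu> = \<nu>' * y ^ 2 \<and> (\<forall>x. h x = (fst x, y * snd x))"
proof -
  have 2: "(2::'f) \<noteq> 0" using 3 by (rule char3_two_neq_0)
  have hm: "h (km \<nu> x y) = km \<nu>' (h x) (h y)" and ha: "h (x + y) = h x + h y"
    and hs: "h (t * fst x, t * snd x) = (t * fst (h x), t * snd (h x))"
    and hN: "fst (h x) ^ 2 + \<nu>' * snd (h x) ^ 2 = fst x ^ 2 + \<nu> * snd x ^ 2" for x y t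
    using alg_isoD(5)[OF h, of x y] alg_isoD(3)[OF h, of x y] alg_isoD(4)[OF h, of x t] alg_isoD(6)[OF h, of x]
    by simp_all
  obtain u where u: "h u = (1,0)" using alg_iso_surjE[OF h, of "(1,0)"] by auto
  have h1: "h (1,0) = (1,0)" using hm[of "(1,0)" u] u by (simp add: km_one)
  have "polar (KM \<nu>') (h (1,0)) (h (0,1)) = polar (KM \<nu>) (1,0) (0,1)"
    using alg_iso_polar[OF h normed_algebra_KM] by simp
  then have z: "fst (h (0,1)) = 0" using 2 unfolding h1 polar_KM by simp
  define y where "y = snd (h (0,1))"
  have n: "\<nu> = \<nu>' * y ^ 2" using hN[of "(0,1)"] by (simp add: z y_def)
  have "h x = (fst x, y * snd x)" for x
  proof -
    have "h (fst x, 0) = (fst x, 0)" using hs[where t="fst x" and x="(1,0)"] by (simp add: h1)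
    moreover have "h (0, snd x) = (0, y * snd x)"
      using hs[where t="snd x" and x="(0,1)"] by (simp add: z y_def mult.commute)
    moreover have "h x = h (fst x, 0) + h (0, snd x)" using ha[of "(fst x, 0)" "(0, snd x)"] by simp
    ultimately show ?thesis by simp
  qed
  then show ?thesis using n nu by (intro exI[of _ y]) auto
qed

lemma pair_equiv_iff:
  assumes K: "etale_coord K \<nu> \<kappa>" and K': "etale_coord K' \<nu>' \<kappa>'"
  shows "pair_equiv K (\<kappa> a) K' (\<kappa>' a') \<longleftrightarrow> pair_eq \<nu> a \<nu>' a'"
proof
  interpret K: etale_coord K \<nu> \<kappa> by fact
  interpret K': etale_coord K' \<nu>' \<kappa>' by fact
  have inv: "alg_iso K (KM \<nu>) (inv_into UNIV \<kappa>)" "alg_iso K' (KM \<nu>') (inv_into UNIV \<kappa>')"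
    using alg_iso_inv[OF K.iso normed_algebra_KM] alg_iso_inv[OF K'.iso normed_algebra_KM] by simp_all
  have ik: "inv_into UNIV \<kappa> (\<kappa> x) = x" "inv_into UNIV \<kappa>' (\<kappa>' x) = x" for x
    by (simp_all add: inv_into_f_f inj_def K.k_inj K'.k_inj)
  { assume "pair_equiv K (\<kappa> a) K' (\<kappa>' a')"
    then obtain \<phi> c where \<phi>: "alg_iso K K' \<phi>" "\<phi> (\<kappa> a) = mul K' (\<kappa>' (km \<nu>' c (km \<nu>' c c))) (\<kappa>' a')"
      unfolding pair_equiv_def alg_cubes_coord[OF K'] by blast
    have "alg_iso (KM \<nu>) (KM \<nu>') (\<lambda>x. inv_into UNIV \<kappa>' (\<phi> (\<kappa> x)))"
      by (rule alg_iso_comp[OF alg_iso_comp[OF K.iso \<phi>(1)] inv(2)])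
    from alg_iso_KM_form[OF K.char3 K.nu this] obtain y where y: "y \<noteq> 0" "\<nu> = \<nu>' * y ^ 2"
      "\<And>x. inv_into UNIV \<kappa>' (\<phi> (\<kappa> x)) = (fst x, y * snd x)" by blast
    have "(fst a, y * snd a) = km \<nu>' (km \<nu>' c (km \<nu>' c c)) a'"
      using y(3)[of a] unfolding \<phi>(2) K'.k_mul ik by simp
    then show "pair_eq \<nu> a \<nu>' a'" using y(1,2) unfolding pair_eq_def by blast }
  { assume "pair_eq \<nu> a \<nu>' a'"
    then obtain y c where y: "y \<noteq> 0" "\<nu> = \<nu>' * y ^ 2" "(fst a, y * snd a) = km \<nu>' (km \<nu>' c (km \<nu>' c c)) a'"
      by (auto simp: pair_eq_def)
    let ?p = "\<lambda>x. \<kappa>' (fst (inv_into UNIV \<kappa> x), y * snd (inv_into UNIV \<kappa> x))"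
    have "alg_iso K K' ?p"
      by (rule alg_iso_comp[OF alg_iso_comp[OF inv(1) alg_iso_KM[OF y(1,2)]] K'.iso])
    moreover have "?p (\<kappa> a) = mul K' (\<kappa>' (km \<nu>' c (km \<nu>' c c))) (\<kappa>' a')"
      unfolding ik y(3) K'.k_mul ..
    ultimately show "pair_equiv K (\<kappa> a) K' (\<kappa>' a')"
      unfolding pair_equiv_def alg_cubes_coord[OF K'] by blast }
qed

lemma pair_eq_refl: "pair_eq \<nu> a \<nu> a"
  unfolding pair_eq_def by (rule exI[of _ 1], rule exI[of _ "(1,0)"]) (simp add: km_one)

lemma etale_pair_coord:
  fixes K :: "('f::field, 'k::ab_group_add) nalg"
  assumes 3: "(3::'f) = 0" and "etale_pair K a"
  obtains \<nu> \<kappa> a0 where "etale_coord K \<nu> \<kappa>" "a = \<kappa> a0" "knorm \<nu> a0 = 1" "\<nu> \<noteq> 0"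
proof -
  have K: "quadratic_etale K" "a \<in> carr K" "nrm K a = 1" using assms(2) by (auto simp: etale_pair_def)
  obtain \<nu> \<kappa> where c: "\<nu> \<noteq> 0" "alg_iso (KM \<nu>) K \<kappa>" "is_unit_of K (\<kappa> (1,0))"
    using quadratic_etale_coordinates[OF 3 K(1)] by blast
  then interpret C: etale_coord K \<nu> \<kappa> using 3 by unfold_locales
  obtain a0 where "a = \<kappa> a0" using C.k_ex K by blast
  moreover have "knorm \<nu> a0 = 1" using K(3) calculation by (simp add: C.k_nrm knorm_def)
  ultimately show thesis using that C.etale_coord_axioms c by blast
qed

lemma pair_equiv_refl:
  fixes K :: "('f::field, 'k::ab_group_add) nalg"
  assumes 3: "(3::'f) = 0" and a: "etale_pair K a"
  shows "pair_equiv K a K a"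
proof -
  obtain \<nu> \<kappa> a0 where K: "etale_coord K \<nu> \<kappa>" "a = \<kappa> a0" "knorm \<nu> a0 = 1" "\<nu> \<noteq> 0"
    using etale_pair_coord[OF 3 a] .
  show ?thesis unfolding K(2) pair_equiv_iff[OF K(1) K(1)] by (rule pair_eq_refl)
qed

context symcomp
begin

lemma tau_conjugate_pair_equiv:
  assumes e: "idempotent A e" and "etale_pair K a" "etale_pair K' a'" "tau_conjugate A e K a" "pair_equiv K a K' a'"
  shows "tau_conjugate A e K' a'"
proof -
  obtain \<nu> \<kappa> a0 where K: "etale_coord K \<nu> \<kappa>" "a = \<kappa> a0" "knorm \<nu> a0 = 1" "\<nu> \<noteq> 0"
    using etale_pair_coord[OF char3 assms(2)] .
  obtain \<nu>' \<kappa>' a0' where K': "etale_coord K' \<nu>' \<kappa>'" "a' = \<kappa>' a0'" "knorm \<nu>' a0' = 1" "\<nu>' \<noteq> 0"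
    using etale_pair_coord[OF char3 assms(3)] .
  show ?thesis using assms(4,5) unfolding K(2) K'(2)
    unfolding tau_conjugate_iff[OF e K(1)] tau_conjugate_iff[OF e K'(1)] pair_equiv_iff[OF K(1) K'(1)]
    using petersson_at_pair_eq[OF char3] K K' by blast
qed

lemma tau_conjugate_unique:
  assumes e: "idempotent A e" and "etale_pair K a" "etale_pair K' a'" "tau_conjugate A e K a" "tau_conjugate A e K' a'"
  shows "pair_equiv K a K' a'"
proof -
  obtain \<nu> \<kappa> a0 where K: "etale_coord K \<nu> \<kappa>" "a = \<kappa> a0" "knorm \<nu> a0 = 1" "\<nu> \<noteq> 0"
    using etale_pair_coord[OF char3 assms(2)] .
  obtain \<nu>' \<kappa>' a0' where K': "etale_coord K' \<nu>' \<kappa>'" "a' = \<kappa>' a0'" "knorm \<nu>' a0' = 1" "\<nu>' \<noteq> 0"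
    using etale_pair_coord[OF char3 assms(3)] .
  show ?thesis using assms(4,5) unfolding K(2) K'(2)
    unfolding tau_conjugate_iff[OF e K(1)] tau_conjugate_iff[OF e K'(1)] pair_equiv_iff[OF K(1) K'(1)]
    using petersson_at_unique[OF char3 _ _ _ _ na eC[OF e]] K K' by blast
qed

text \<open>The union defining \<open>idem_class\<close> is a single class because conjugacy of
  \<open>\<tau>\<close> is invariant under equivalence of pairs and determines the pair up to
  equivalence. Conversely, \<open>(K, a)\<close> belongs to its own class by reflexivity.\<close>

lemma idem_class_iff:
  fixes K :: "('f, 'k::ab_group_add) nalg"
  assumes e: "idempotent A e" and a: "etale_pair K a"
  shows "idem_class A e = pair_class K a \<longleftrightarrow> tau_conjugate A e K a"
proof
  assume t: "tau_conjugate A e K a"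
  show "idem_class A e = pair_class K a"
  proof
    show "pair_class K a \<subseteq> idem_class A e" using a t by (auto simp: idem_class_def)
    show "idem_class A e \<subseteq> pair_class K a"
      unfolding idem_class_def pair_class_def
      using tau_conjugate_pair_equiv[OF e] tau_conjugate_unique[OF e a _ t] by blast
  qed
next
  assume c: "idem_class A e = pair_class K a"
  have "(K, a) \<in> idem_class A e" unfolding c using a pair_equiv_refl[OF char3 a] by (simp add: pair_class_def)
  then show "tau_conjugate A e K a"
    unfolding idem_class_def pair_class_def
    using tau_conjugate_pair_equiv[OF e] a by blast
qed

end

section \<open>Centralizers of idempotents\<close>

lemma alg_iso_sum:
  assumes f: "alg_iso A B f" and sub: "\<And>x y. x \<in> carr A \<Longrightarrow> y \<in> carr A \<Longrightarrow> x + y \<in> carr A"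
    "\<And>x c. x \<in> carr A \<Longrightarrow> smul A c x \<in> carr A" "0 \<in> carr A"
    and u: "\<And>i. i \<in> I \<Longrightarrow> u i \<in> carr A"
  shows "f (\<Sum>i\<in>I. smul A (c i) (u i)) = (\<Sum>i\<in>I. smul B (c i) (f (u i)))"
    and "(\<Sum>i\<in>I. smul A (c i) (u i)) \<in> carr A"
proof -
  have f0: "f 0 = 0" using alg_isoD(3)[OF f sub(3) sub(3)] by simp
  have "f (\<Sum>i\<in>I. smul A (c i) (u i)) = (\<Sum>i\<in>I. smul B (c i) (f (u i))) \<and> (\<Sum>i\<in>I. smul A (c i) (u i)) \<in> carr A"
    using u
  proof (induction I rule: infinite_finite_induct)
    case (insert i I)
    then show ?case using sub by (simp add: alg_isoD(3,4)[OF f])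
  qed (simp_all add: f0 sub)
  then show "f (\<Sum>i\<in>I. smul A (c i) (u i)) = (\<Sum>i\<in>I. smul B (c i) (f (u i)))"
    "(\<Sum>i\<in>I. smul A (c i) (u i)) \<in> carr A" by blast+
qed

context symcomp
begin

text \<open>By \<open>tau_eq\<close> and \<open>tau2\<close>, commuting with \<open>e\<close> gives
  \<open>\<tau> x = \<tau> (\<tau> x)\<close>, and \<open>\<tau>\<close> is invertible. On its fixed
  points, multiplication by \<open>e\<close> from either side is the conjugation of the Cayley
  algebra.\<close>

lemma centralizerD:
  assumes e: "idempotent A e" and x: "x \<in> centralizer A e"
  shows "x \<in> C" "e \<star> x = B e x \<bullet>\<^sub>s e - x" "x \<star> e = B e x \<bullet>\<^sub>s e - x" "idem_tau A e x = x"
proof -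
  show xC: "x \<in> C" using x by (simp add: centralizer_def)
  have xe: "e \<star> x = x \<star> e" using x by (simp add: centralizer_def)
  have "idem_tau A e x = idem_tau A e (idem_tau A e x)"
    using tau_eq[OF e xC] tau2[OF e xC] xe by simp
  then have "idem_tau A e (idem_tau A e (idem_tau A e x)) = idem_tau A e x" by simp
  then show t: "idem_tau A e x = x" using tau3[OF e xC] by simp
  show "x \<star> e = B e x \<bullet>\<^sub>s e - x" using tau_eq[OF e xC] t by (simp add: algebra_simps)
  then show "e \<star> x = B e x \<bullet>\<^sub>s e - x" using xe by simp
qed

text \<open>Since \<open>\<tau>\<close> is the identity on the centralizer, the Petersson formula
  becomes the para-Hurwitz one there; \<open>H\<close> is \<open>S\<close> with the Cayley product
  at \<open>e\<close>.\<close>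

lemma para_of_subspace:
  assumes e: "idempotent A e" and S: "subspace S" "S \<subseteq> centralizer A e" "e \<in> S"
    "\<And>x y. x \<in> S \<Longrightarrow> y \<in> S \<Longrightarrow> x \<star> y \<in> S"
    and ns: "\<And>x. x \<in> S \<Longrightarrow> (\<And>y. y \<in> S \<Longrightarrow> B x y = 0) \<Longrightarrow> x = 0"
  shows "\<exists>H :: ('f, 'v) nalg. hurwitz H \<and> alg_dim H = dim S \<and> isomorphic (A\<lparr>carr := S\<rparr>) (petersson H id)"
proof -
  define H where "H = (idem_cayley A e)\<lparr>carr := S\<rparr>"
  have [simp]: "carr H = S" "smul H = smul A" "nrm H = nrm A" "mul H = mul (idem_cayley A e)"
    by (simp_all add: H_def idem_cayley_def)
  have [simp]: "polar H = polar A" by (intro ext) (simp add: polar_def)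
  note [simp] = eC[OF e] ee[OF e] Ne[OF e]
  have SC: "x \<in> C" if "x \<in> S" for x using that S(2) by (auto simp: centralizer_def)
  have SZ: "x \<in> centralizer A e" if "x \<in> S" for x using that S(2) by auto
  have nH: "normed_algebra H"
    unfolding normed_algebra_def bilinear_mul_def quadratic_nrm_def
    using S by (simp add: vector_space_axioms SC)
  have unit: "is_unit_of H e"
    using S(3) by (auto simp: is_unit_of_def SC flexl flexr)
  then have ue: "unity H = e" by (rule unity_eqI)
  have hur: "hurwitz H"
    unfolding hurwitz_def nonsingular_nrm_def
    using nH ns unit by (auto simp: N_mult SC)
  have cj: "conjug H x = B e x \<bullet>\<^sub>s e - x" for x
    by (simp add: conjug_def ue B_sym)
  have cS: "conjug H x \<in> S" if "x \<in> S" for x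
    using that S by (simp add: cj subspace_diff subspace_scale)
  have b: "B e (conjug H u) = B e u" if "u \<in> S" for u
    using SC[OF that] fneg_double[of "- B e u"] by (simp add: cj Bee[OF e])
  have m: "x \<star> y = mul (petersson H id) x y" if "x \<in> S" "y \<in> S" for x y
  proof -
    have "e \<star> conjug H x = x"
      using centralizerD(2)[OF e SZ[OF cS[OF that(1)]]] b[OF that(1)] by (simp add: cj)
    moreover have "conjug H y \<star> e = y"
      using centralizerD(3)[OF e SZ[OF cS[OF that(2)]]] b[OF that(2)] by (simp add: cj)
    ultimately show ?thesis by (simp add: petersson_def)
  qed
  have "alg_iso (A\<lparr>carr := S\<rparr>) (petersson H id) (\<lambda>x. x)"
    unfolding alg_iso_def using m by (auto simp: bij_betw_def petersson_def)
  moreover have "alg_dim H = dim S" by (simp add: alg_dim_def)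
  ultimately show ?thesis using hur unfolding isomorphic_def by blast
qed

lemma centralizer_sq:
  assumes e: "idempotent A e" and z: "z \<in> centralizer A e" "B e z = 0"
  shows "z \<star> z = - N z \<bullet>\<^sub>s e" "e \<star> z = - z" "z \<star> e = - z"
proof -
  note d = centralizerD[OF e z(1)]
  show ez: "e \<star> z = - z" "z \<star> e = - z" using d z by simp_all
  have "(z \<star> e) \<star> z = N z \<bullet>\<^sub>s e" using d(1) eC[OF e] by (intro flexl)
  then show "z \<star> z = - N z \<bullet>\<^sub>s e" using d(1) unfolding ez by simp (metis add.inverse_inverse)
qed

lemma has_para_quadraticI:
  assumes e: "idempotent A e" and z: "z \<in> centralizer A e" "B e z = 0" "N z \<noteq> 0"
  shows "has_para_quadratic A (centralizer A e)"
proof -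
  define S where "S = span {z, e}"
  note [simp] = eC[OF e] ee[OF e] Ne[OF e] Bee[OF e]
  note cz = centralizer_sq[OF e z(1,2)]
  have zC[simp]: "z \<in> C" using z by (simp add: centralizer_def)
  have Sex: "\<exists>a b. x = a \<bullet>\<^sub>s z + b \<bullet>\<^sub>s e" if "x \<in> S" for x
  proof -
    have "x \<in> span (insert z {e})" using that by (simp add: S_def)
    then obtain b where "x - b \<bullet>\<^sub>s z \<in> span {e}" using span_breakdown_eq by blast
    then obtain a where "x - b \<bullet>\<^sub>s z = a \<bullet>\<^sub>s e" by (auto simp: span_singleton)
    then have "x = b \<bullet>\<^sub>s z + a \<bullet>\<^sub>s e" by (simp add: diff_eq_eq add.commute)
    then show ?thesis by blast
  qed
  have Sin: "a \<bullet>\<^sub>s z + b \<bullet>\<^sub>s e \<in> S" for a b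
    unfolding S_def by (intro span_add span_scale span_base) auto
  have sub: "subspace S" by (simp add: S_def subspace_span)
  have SZ: "S \<subseteq> centralizer A e"
    using Sex by (fastforce simp: centralizer_def cz)
  have cl: "x \<star> y \<in> S" if xy: "x \<in> S" "y \<in> S" for x y
  proof -
    obtain a b c d where "x = a \<bullet>\<^sub>s z + b \<bullet>\<^sub>s e" "y = c \<bullet>\<^sub>s z + d \<bullet>\<^sub>s e" using Sex[OF xy(1)] Sex[OF xy(2)] by blast
    then have "x \<star> y = (- (a * d + b * c)) \<bullet>\<^sub>s z + (b * d - a * c * N z) \<bullet>\<^sub>s e"
      by (simp add: cz algebra_simps)
    then show ?thesis using Sin by simp
  qed
  have 2: "(2::'f) \<noteq> 0" using char3 by (rule char3_two_neq_0)
  have ns: "x = 0" if xS: "x \<in> S" "\<And>y. y \<in> S \<Longrightarrow> B x y = 0" for x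
  proof -
    obtain a b where x: "x = a \<bullet>\<^sub>s z + b \<bullet>\<^sub>s e" using Sex[OF xS(1)] by blast
    have "z \<in> S" "e \<in> S" using Sin[of 1 0] Sin[of 0 1] by simp_all
    then have "B x z = 0" "B x e = 0" using xS by blast+
    then show ?thesis using z by (simp add: x B_sym[of z e] B_N)
  qed
  have eS: "e \<in> S" using Sin[of 0 1] by simp
  obtain H :: "('f, 'v) nalg" where H: "hurwitz H" "alg_dim H = dim S" "isomorphic (A\<lparr>carr := S\<rparr>) (petersson H id)"
    using para_of_subspace[OF e sub SZ eS cl ns] by blast
  have "z \<notin> span {e}" by (rule notin_span[of z]) (use z in \<open>auto simp: B_N B_sym[of z e]\<close>)
  moreover have "e \<noteq> 0" using e by (simp add: idempotent_def)
  ultimately have "independent {z, e}" "z \<noteq> e" using span_base[of e "{e}"] by (auto simp: independent_insert)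
  then have "dim S = 2" unfolding S_def using dim_span_eq_card_independent[of "{z, e}"] by simp
  then have "para_quadratic (A\<lparr>carr := S\<rparr>)"
    unfolding para_quadratic_def quadratic_etale_def using H by auto
  moreover have "subalgebra A S" unfolding subalgebra_def using sub SZ cl by (auto simp: centralizer_def)
  ultimately show ?thesis unfolding has_para_quadratic_def using SZ by blast
qed

text \<open>The functional \<open>B e\<close> has a nonzero zero \<open>z\<close> in the
  two-dimensional subalgebra \<open>S\<close>, wherever \<open>e\<close> lies. If \<open>N z\<close>
  were zero, then \<open>z \<star> z = 0\<close> by \<open>centralizer_sq\<close>, but an etale
  algebra has no nonzero element of square zero.\<close>

lemma has_para_quadraticD:
  assumes e: "idempotent A e" and p: "has_para_quadratic A (centralizer A e)"
  shows "\<exists>z\<in>centralizer A e. B e z = 0 \<and> N z \<noteq> 0"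
proof -
  obtain S and H :: "('f, 'v) nalg" and \<phi> where S: "S \<subseteq> centralizer A e" "subalgebra A S"
    and H: "quadratic_etale H" and \<phi>: "alg_iso (A\<lparr>carr := S\<rparr>) (petersson H id) \<phi>"
    using p by (auto simp: has_para_quadratic_def para_quadratic_def isomorphic_def)
  obtain \<nu> \<kappa> where c: "\<nu> \<noteq> 0" "alg_iso (KM \<nu>) H \<kappa>" "is_unit_of H (\<kappa> (1,0))"
    using quadratic_etale_coordinates[OF char3 H] by blast
  then interpret H: etale_coord H \<nu> \<kappa> using char3 by unfold_locales
  have SC: "x \<in> C" if "x \<in> S" for x using that S by (auto simp: centralizer_def)
  have sub: "subspace S" using S by (simp add: subalgebra_def)
  have 2: "(2::'f) \<noteq> 0" using char3 by (rule char3_two_neq_0)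
  have ex: "\<exists>x\<in>S. \<phi> x = \<kappa> a" for a
    using alg_iso_surjE[OF \<phi>, of "\<kappa> a"] by (auto simp: petersson_def)
  obtain s1 s2 where s: "s1 \<in> S" "\<phi> s1 = \<kappa> (1,0)" "s2 \<in> S" "\<phi> s2 = \<kappa> (0,1)" using ex by metis
  obtain a b where ab: "a * B e s1 + b * B e s2 = 0" "a \<noteq> 0 \<or> b \<noteq> 0"
  proof (cases "B e s1 = 0")
    case True then show thesis using that[of 1 0] by simp
  next
    case False then show thesis using that[of "- B e s2" "B e s1"] by (simp add: mult.commute)
  qed
  define z where "z = a \<bullet>\<^sub>s s1 + b \<bullet>\<^sub>s s2"
  have zS: "z \<in> S" using s sub by (simp add: z_def subspace_add subspace_scale)
  have Bz: "B e z = 0" using ab s SC eC[OF e] by (simp add: z_def)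
  have "\<phi> z = \<phi> (a \<bullet>\<^sub>s s1) + \<phi> (b \<bullet>\<^sub>s s2)"
    unfolding z_def using s sub by (intro alg_isoD(3)[OF \<phi>]) (simp_all add: subspace_scale)
  moreover have "\<phi> (a \<bullet>\<^sub>s s1) = smul H a (\<phi> s1)" "\<phi> (b \<bullet>\<^sub>s s2) = smul H b (\<phi> s2)"
    using alg_isoD(4)[OF \<phi>, of s1 a] alg_isoD(4)[OF \<phi>, of s2 b] s by (simp_all add: petersson_def)
  ultimately have fz: "\<phi> z = \<kappa> (a, b)" by (simp add: s H.k_scal H.k_add)
  have "\<phi> (z \<star> z) = \<kappa> (km \<nu> (kc (a,b)) (kc (a,b)))"
    using alg_isoD(5)[OF \<phi>, of z z] zS fz by (simp add: petersson_def H.k_conj H.k_mul)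
  also have "km \<nu> (kc (a,b)) (kc (a,b)) = (a * a - \<nu> * b * b, - (2 * a * b))"
    by (simp add: km_def kc_def)
  finally have f: "\<phi> (z \<star> z) = \<kappa> (a * a - \<nu> * b * b, - (2 * a * b))" .
  have "N z \<noteq> 0"
  proof
    assume "N z = 0"
    then have "z \<star> z = 0" using centralizer_sq(1)[OF e _ Bz] zS S by auto
    moreover have "\<phi> 0 = \<kappa> 0"
      using alg_isoD(3)[OF \<phi>, of 0 0] sub by (simp add: subspace_0 H.k_zero)
    ultimately have "(a * a - \<nu> * b * b, - (2 * a * b)) = 0" using f H.k_inj by metis
    then show False using ab(2) c(1) 2 by (auto simp: zero_prod_def)
  qed
  then show ?thesis using zS S Bz by auto
qed

text \<open>What the exclusion arguments use of a para-quaternion subalgebra: nonsingularity, and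
  enough dimension for two linear conditions to leave a nonzero vector.\<close>

lemma para_quaternion_kernel:
  assumes p: "has_para_quaternion A Z" and Z: "Z \<subseteq> C"
  obtains S where "S \<subseteq> Z" "subspace S" "\<And>x. x \<in> S \<Longrightarrow> \<forall>y\<in>S. B x y = 0 \<Longrightarrow> x = 0"
    "\<And>h1 h2. lin_fun h1 \<Longrightarrow> lin_fun h2 \<Longrightarrow> \<exists>x\<in>S. x \<noteq> 0 \<and> h1 x = 0 \<and> h2 x = 0"
proof -
  obtain S and H :: "('f, 'v) nalg" and \<phi> where S: "S \<subseteq> Z" "subalgebra A S"
    and H: "quaternion_alg H" and \<phi>: "alg_iso (A\<lparr>carr := S\<rparr>) (petersson H id) \<phi>"
    using p by (auto simp: has_para_quaternion_def para_quaternion_def isomorphic_def)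
  have hH: "hurwitz H" "alg_dim H = 4" using H by (auto simp: quaternion_alg_def)
  interpret H: normed_alg H using hH by unfold_locales (simp add: hurwitz_def)
  have sub: "subspace S" using S by (simp add: subalgebra_def)
  have SC: "x \<in> C" if "x \<in> S" for x using that S Z by auto
  have sel: "carr (petersson H id) = carr H" "smul (petersson H id) = smul H" "nrm (petersson H id) = nrm H"
    by (simp_all add: petersson_def)
  have f_add: "\<phi> (x + y) = \<phi> x + \<phi> y" and f_N: "nrm H (\<phi> x) = N x" and f_C: "\<phi> x \<in> carr H" if "x \<in> S" "y \<in> S" for x y
    using alg_isoD(3)[OF \<phi>, of x y] alg_isoD(6)[OF \<phi>, of x] alg_isoD(2)[OF \<phi>, of x] that by (simp_all add: sel)
  have f_B: "polar H (\<phi> x) (\<phi> y) = B x y" if "x \<in> S" "y \<in> S" for x y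
    using that f_add[OF that] f_N[of "x + y" "x + y"] f_N[of x x] f_N[of y y] sub
    by (simp add: polar_def subspace_add)
  have f0: "\<phi> 0 = 0" using f_add[of 0 0] sub by (simp add: subspace_0)
  have f_inj: "x = y" if "\<phi> x = \<phi> y" "x \<in> S" "y \<in> S" for x y
    using alg_iso_injD[OF \<phi>, of x y] that by simp
  have f_ex: "\<exists>x\<in>S. \<phi> x = y" if "y \<in> carr H" for y
    using alg_iso_surjE[OF \<phi>, of y] that by (auto simp: sel)
  have ns: "x = 0" if x: "x \<in> S" "\<forall>y\<in>S. B x y = 0" for x
  proof -
    have "polar H (\<phi> x) y = 0" if "y \<in> carr H" for y
      using f_ex[OF that] f_B x by auto
    then have "\<phi> x = 0" using hH(1) f_C x unfolding hurwitz_def nonsingular_nrm_def by blast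
    then show ?thesis using f_inj[of x 0] f0 x sub by (simp add: subspace_0)
  qed
  obtain T where T: "T \<subseteq> carr H" "H.independent T" "carr H \<subseteq> H.span T" "card T = 4"
    using H.basis_exists[of "carr H"] hH(2) by (auto simp: alg_dim_def)
  have fin: "finite T" using T(4) card.infinite by fastforce
  define u where "u t = inv_into S \<phi> t" for t
  have u: "u t \<in> S" "\<phi> (u t) = t" if "t \<in> T" for t
    using f_ex[of t] that T(1) unfolding u_def
    by (auto intro!: inv_into_into f_inv_into_f simp: image_iff subset_iff)
  have sumf: "\<phi> (\<Sum>t\<in>T. c t \<bullet>\<^sub>s u t) = (\<Sum>t\<in>T. smul H (c t) t)" "(\<Sum>t\<in>T. c t \<bullet>\<^sub>s u t) \<in> S" for c
    using alg_iso_sum[OF \<phi>, of T u c] u sub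
    by (simp_all add: sel subspace_add subspace_scale subspace_0)
  have ind: "\<forall>c. (\<Sum>t\<in>T. c t \<bullet>\<^sub>s u t) = 0 \<longrightarrow> (\<forall>t\<in>T. c t = 0)"
  proof (intro allI impI ballI)
    fix c t assume a: "(\<Sum>t\<in>T. c t \<bullet>\<^sub>s u t) = 0" "t \<in> T"
    then have "(\<Sum>t\<in>T. smul H (c t) t) = 0" using sumf(1)[of c] f0 by simp
    then show "c t = 0" using H.independentD[OF T(2) fin subset_refl, of c] a by blast
  qed
  have ker: "\<exists>x\<in>S. x \<noteq> 0 \<and> h1 x = 0 \<and> h2 x = 0" if lin: "lin_fun h1" "lin_fun h2" for h1 h2
  proof -
    obtain c where "(\<Sum>t\<in>T. c t \<bullet>\<^sub>s u t) \<noteq> 0 \<and> (\<forall>h\<in>set [h1, h2]. h (\<Sum>t\<in>T. c t \<bullet>\<^sub>s u t) = 0)"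
      using common_kernel[of "[h1, h2]" T u] lin fin T(4) ind u SC by auto
    then show ?thesis using sumf(2)[of c] by auto
  qed
  show ?thesis by (rule that[OF S(1) sub ns ker])
qed

lemma centralizer_subset: "centralizer A e \<subseteq> C"
  by (auto simp: centralizer_def)

text \<open>By hypothesis \<open>B\<close> vanishes between elements of \<open>S\<close> orthogonal
  to \<open>e\<close>. A nonzero \<open>x\<close> in \<open>S\<close> orthogonal to \<open>e\<close>
  and to one \<open>s\<close> with \<open>B e s \<noteq> 0\<close>, if there is one, is orthogonal
  to all of \<open>S\<close>.\<close>

lemma not_para_quaternion_singular:
  assumes e: "idempotent A e" and n: "\<And>x. x \<in> centralizer A e \<Longrightarrow> B e x = 0 \<Longrightarrow> N x = 0"
  shows "\<not> has_para_quaternion A (centralizer A e)"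
proof
  assume q: "has_para_quaternion A (centralizer A e)"
  obtain S where S: "S \<subseteq> centralizer A e" "subspace S" "\<And>x. x \<in> S \<Longrightarrow> \<forall>y\<in>S. B x y = 0 \<Longrightarrow> x = 0"
    "\<And>h1 h2. lin_fun h1 \<Longrightarrow> lin_fun h2 \<Longrightarrow> \<exists>x\<in>S. x \<noteq> 0 \<and> h1 x = 0 \<and> h2 x = 0"
    by (rule para_quaternion_kernel[OF q centralizer_subset]; rule that; assumption)
  have SC: "x \<in> C" if "x \<in> S" for x using that S(1) centralizer_subset[of e] by blast
  have B0: "B x y = 0" if "x \<in> S" "y \<in> S" "B e x = 0" "B e y = 0" for x y
  proof -
    have "x + y \<in> S" using S(2) that(1,2) by (rule subspace_add)
    moreover have "B e (x + y) = 0" using that SC[OF that(1)] SC[OF that(2)] eC[OF e] by simp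
    ultimately have "N (x + y) = 0" using n S(1) by blast
    moreover have "N x = 0" "N y = 0" using n S(1) that by blast+
    ultimately show ?thesis by (simp add: polar_def)
  qed
  obtain s where s: "s \<in> S" "B e s \<noteq> 0 \<or> (\<forall>y\<in>S. B e y = 0)" using S(2) subspace_0 by blast
  obtain x where x: "x \<in> S" "x \<noteq> 0" "B e x = 0" "B s x = 0"
    using S(4)[OF lin_fun_B[OF eC[OF e]] lin_fun_B[OF SC[OF s(1)]]] by blast
  have "B x y = 0" if y: "y \<in> S" for y
  proof (cases "\<forall>y\<in>S. B e y = 0")
    case True then show ?thesis using B0 x y by blast
  next
    case False
    then have es: "B e s \<noteq> 0" using s by blast
    define t where "t = y - (B e y / B e s) \<bullet>\<^sub>s s"
    have "t \<in> S" "B e t = 0"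
      using y s S(2) SC eC[OF e] es by (simp_all add: t_def subspace_diff subspace_scale)
    then have "B x t = 0" using B0 x by blast
    then show ?thesis using x(1,4) y s(1) SC by (simp add: t_def B_sym[of x s])
  qed
  then show False using S(3) x by blast
qed

lemma not_para_quaternion_functional:
  assumes e: "idempotent A e" and h: "lin_fun h"
    and n: "\<And>x y. x \<in> centralizer A e \<Longrightarrow> y \<in> centralizer A e \<Longrightarrow> B e x = 0 \<Longrightarrow> h x = 0 \<Longrightarrow> B x y = 0"
  shows "\<not> has_para_quaternion A (centralizer A e)"
proof
  assume q: "has_para_quaternion A (centralizer A e)"
  obtain S where S: "S \<subseteq> centralizer A e" "subspace S" "\<And>x. x \<in> S \<Longrightarrow> \<forall>y\<in>S. B x y = 0 \<Longrightarrow> x = 0"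
    "\<And>h1 h2. lin_fun h1 \<Longrightarrow> lin_fun h2 \<Longrightarrow> \<exists>x\<in>S. x \<noteq> 0 \<and> h1 x = 0 \<and> h2 x = 0"
    by (rule para_quaternion_kernel[OF q centralizer_subset]; rule that; assumption)
  obtain x where x: "x \<in> S" "x \<noteq> 0" "B e x = 0" "h x = 0"
    using S(4)[OF lin_fun_B[OF eC[OF e]] h] by blast
  have "\<forall>y\<in>S. B x y = 0"
  proof
    fix y assume "y \<in> S"
    then have "x \<in> centralizer A e" "y \<in> centralizer A e" using x(1) S(1) by blast+
    then show "B x y = 0" using n x(3,4) by blast
  qed
  then show False using S(3) x by blast
qed

lemma petersson_at_centralizer:
  assumes f: "alg_iso A (PE \<nu> a) f" "f e = one_ep" and e: "idempotent A e" and x: "x \<in> C"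
  shows "x \<in> centralizer A e \<longleftrightarrow> (\<exists>b c. f x = fe b c)"
proof -
  have "x \<in> centralizer A e \<longleftrightarrow> f (e \<star> x) = f (x \<star> e)"
    using x eC[OF e] alg_iso_injD[OF f(1), of "e \<star> x" "x \<star> e"] by (simp add: centralizer_def)
  also have "\<dots> \<longleftrightarrow> etau (etau (ecnj (f x))) = etau (ecnj (f x))"
    using alg_isoD(5)[OF f(1), of e x] alg_isoD(5)[OF f(1), of x e] x eC[OF e] by (simp add: f(2) pmul_one)
  also have "\<dots> \<longleftrightarrow> (\<exists>b c. f x = fe b c)"
  proof
    assume a: "etau (etau (ecnj (f x))) = etau (ecnj (f x))"
    obtain b x1 x2 x3 where u: "f x = (b,x1,x2,x3)" by (metis surj_pair)
    have "x2 = x1" "x3 = x1" using a unfolding u ecnj.simps etau.simps prod.inject neg_equal_iff_equal by blast+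
    then show "\<exists>b c. f x = fe b c" unfolding u fe_def by blast
  qed (auto simp: fe_def)
  finally show ?thesis .
qed

text \<open>In coordinates the centralizer consists of the vectors \<open>fe b c\<close>, and the
  \<open>fe 0 c\<close> are orthogonal to all of it, every pairing being a multiple of 3. The norm
  thus lives on the plane \<open>K\<close> spanned by \<open>e\<close> and \<open>z\<close>, too
  small for a quaternion algebra.\<close>

lemma petersson_at_quadratic:
  assumes e: "idempotent A e" and t: "petersson_at A e \<nu> a" and nu: "\<nu> \<noteq> 0"
  shows "quadratic_idempotent A e" "\<exists>z\<in>centralizer A e. B e z = 0 \<and> N z = \<nu>"
proof -
  obtain f where f: "alg_iso A (PE \<nu> a) f" "f e = one_ep" using t by (auto simp: petersson_at_def)
  have 2: "(2::'f) \<noteq> 0" using char3 by (rule char3_two_neq_0)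
  have fB: "polar (PE \<nu> a) (f x) (f y) = B x y" if "x \<in> C" "y \<in> C" for x y
    using alg_iso_polar[OF f(1) na that] .
  obtain z where z: "z \<in> C" "f z = fe (0,1) 0" using alg_iso_surjE[OF f(1), of "fe (0,1) 0"] by (metis PE_sel(1) UNIV_I)
  have zZ: "z \<in> centralizer A e" using petersson_at_centralizer[OF f e z(1)] z(2) by blast
  have Bz: "B e z = 0" using fB[of e z] eC[OF e] z by (simp add: f(2) polar_one_ep fe_def)
  have Nz: "N z = \<nu>" using alg_isoD(6)[OF f(1), of z] z by (simp add: fe_def zero_prod_def)
  show "\<exists>z\<in>centralizer A e. B e z = 0 \<and> N z = \<nu>" using zZ Bz Nz by blast
  have "\<not> has_para_quaternion A (centralizer A e)"
  proof (rule not_para_quaternion_functional[OF e lin_fun_B[OF z(1)]])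
    fix x y assume x: "x \<in> centralizer A e" "B e x = 0" "B z x = 0" and y: "y \<in> centralizer A e"
    have C: "x \<in> C" "y \<in> C" using x y by (auto simp: centralizer_def)
    obtain b c where fx: "f x = fe b c" using petersson_at_centralizer[OF f e C(1)] x by blast
    obtain b' c' where fy: "f y = fe b' c'" using petersson_at_centralizer[OF f e C(2)] y by blast
    have "fst b = 0" using fB[of e x] C eC[OF e] x(2) 2 by (simp add: f(2) polar_one_ep fx fe_def)
    moreover have "polar (PE \<nu> a) (fe (0,1) 0) (fe b c) = 2 * \<nu> * snd b"
      by (cases b; cases c) (simp add: fe_def polar_PE zero_prod_def)
    then have "snd b = 0" using fB[of z x] z C x(3) 2 nu by (simp add: fx)
    ultimately have b: "b = 0" by (simp add: prod_eq_iff)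
    have "polar (PE \<nu> a) (fe 0 c) (fe b' c') = 3 * (2 * (fst c * fst c' + \<nu> * snd c * snd c'))"
      by (cases b'; cases c; cases c') (simp add: fe_def polar_PE zero_prod_def)
    then show "B x y = 0" using fB[OF C] by (simp add: fx fy b char3)
  qed
  then show "quadratic_idempotent A e"
    unfolding quadratic_idempotent_def using e has_para_quadraticI[OF e zZ Bz] Nz nu by simp
qed

end

section \<open>Idempotents of a given class\<close>

text \<open>Cubing in \<open>K\<close> sends \<open>(s, b)\<close> to
  \<open>(s^3, - \<nu> b^3)\<close>. The first component of an element is minus its trace, so the
  lemma turns a cubic trace of a norm one element into a cube root.\<close>

lemma cube_of_trace:
  fixes \<nu> :: "'f::field"
  assumes 3: "(3::'f) = 0" and nu: "\<nu> \<noteq> 0" and n: "knorm \<nu> (s ^ 3, q) = 1"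
  shows "\<exists>c. km \<nu> c (km \<nu> c c) = (s ^ 3, q)"
proof -
  have k: "km \<nu> (a,b) (km \<nu> (a,b) (a,b)) = (a ^ 3, - (\<nu> * b ^ 3))" for a b
  proof -
    have "km \<nu> (a,b) (km \<nu> (a,b) (a,b)) = (a ^ 3 + 3 * - (\<nu> * a * b^2), - (\<nu> * b ^ 3) + 3 * (a^2 * b))"
      unfolding km_def by (simp add: prod_eq_iff algebra_simps power2_eq_square power3_eq_cube)
    then show ?thesis by (simp add: 3)
  qed
  define D where "D = 1 - s ^ 2"
  have "D ^ 3 = 1 - (s ^ 2) ^ 3" by (simp add: D_def cube_diff[OF 3])
  then have D: "\<nu> * q ^ 2 = D ^ 3" using n unfolding knorm_def fst_conv snd_conv by algebra
  show ?thesis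
  proof (cases "q = 0")
    case True
    then have "D = 0" using D by simp
    then have "s ^ 2 = 1" by (simp add: D_def)
    show ?thesis by (rule exI[of _ "(s, 0)"]) (simp add: k True)
  next
    case False
    then have D0: "D \<noteq> 0" using D nu by auto
    \<comment> \<open>The second component \<open>b\<close> must satisfy
      \<open>- \<nu> b^3 = q\<close>. As \<open>\<nu> q^2 = D^3\<close>, the choice
      \<open>b = - q / D\<close> gives \<open>\<nu> q^3 / D^3 = q\<close>.\<close>
    have "(- (\<nu> * (- q / D) ^ 3)) * D ^ 3 = q * (\<nu> * q ^ 2)"
      using D0 by (simp add: power_divide power2_eq_square power3_eq_cube)
    then have "- (\<nu> * (- q / D) ^ 3) = q" using D0 unfolding D by simp
    then show ?thesis by (intro exI[of _ "(s, - q / D)"]) (simp only: k)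
  qed
qed

definition cubes_span :: "'f::field \<Rightarrow> 'f set" where
  "cubes_span t = {c0 ^ 3 + c1 ^ 3 * t + c2 ^ 3 * t ^ 2 | c0 c1 c2. True}"

lemma cubes_spanI: "u = c0 ^ 3 + c1 ^ 3 * t + c2 ^ 3 * t ^ 2 \<Longrightarrow> u \<in> cubes_span t"
  by (auto simp: cubes_span_def)

lemma is_subfield_cubes_span:
  assumes 3: "(3::'f::field) = 0"
  shows "is_subfield (cubes_span (t::'f))"
proof -
  have m: "x * y \<in> cubes_span t" if xy: "x \<in> cubes_span t" "y \<in> cubes_span t" for x y
  proof -
    obtain c0 c1 c2 where x: "x = c0 ^ 3 + c1 ^ 3 * t + c2 ^ 3 * t ^ 2" using xy by (auto simp: cubes_span_def)
    obtain d0 d1 d2 where y: "y = d0 ^ 3 + d1 ^ 3 * t + d2 ^ 3 * t ^ 2" using xy by (auto simp: cubes_span_def)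
    have "x * y = (c0 * d0 + (c1 * d2 + c2 * d1) * t) ^ 3 + (c0 * d1 + c1 * d0 + c2 * d2 * t) ^ 3 * t
        + (c0 * d2 + c1 * d1 + c2 * d0) ^ 3 * t ^ 2"
      unfolding x y power_mult_distrib cube_add[OF 3] by algebra
    then show ?thesis by (rule cubes_spanI)
  qed
  have d: "x - y \<in> cubes_span t" if xy: "x \<in> cubes_span t" "y \<in> cubes_span t" for x y
  proof -
    obtain c0 c1 c2 where x: "x = c0 ^ 3 + c1 ^ 3 * t + c2 ^ 3 * t ^ 2" using xy by (auto simp: cubes_span_def)
    obtain d0 d1 d2 where y: "y = d0 ^ 3 + d1 ^ 3 * t + d2 ^ 3 * t ^ 2" using xy by (auto simp: cubes_span_def)
    have "x - y = (c0 - d0) ^ 3 + (c1 - d1) ^ 3 * t + (c2 - d2) ^ 3 * t ^ 2"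
      unfolding x y cube_diff[OF 3] by algebra
    then show ?thesis by (rule cubes_spanI)
  qed
  have c: "c ^ 3 \<in> cubes_span t" for c by (rule cubes_spanI[of _ c 0 _ 0]) simp
  have "inverse x \<in> cubes_span t" if x: "x \<in> cubes_span t" for x
  proof -
    \<comment> \<open>An inverse is a product of elements of the set and a cube, so closure under
      multiplication suffices.\<close>
    have "inverse x = x * x * (inverse x) ^ 3"
      by (cases "x = 0") (simp_all add: power3_eq_cube field_simps)
    moreover have "x * x * (inverse x) ^ 3 \<in> cubes_span t" using m x c by blast
    ultimately show ?thesis by simp
  qed
  then show ?thesis unfolding is_subfield_def using m d c[of 1] by auto
qed

lemma cubes_adjoin_subset:
  assumes 3: "(3::'f::field) = 0"
  shows "cubes_adjoin (t::'f) \<subseteq> cubes_span t"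
  unfolding cubes_adjoin_def
proof (rule hull_minimal)
  show "insert t field_cubes \<subseteq> cubes_span t"
    using cubes_spanI[of t 0 1 t 0] cubes_spanI[of "c ^ 3" c 0 t 0 for c] by (auto simp: field_cubes_def)
qed (rule is_subfield_cubes_span[OF 3])

lemma cubes_adjoin_powers: "1 \<in> cubes_adjoin t" "t \<in> cubes_adjoin t" "t ^ 2 \<in> cubes_adjoin t"
  unfolding cubes_adjoin_def hull_def is_subfield_def by (auto simp: power2_eq_square)

text \<open>Scaling the last sum by \<open>q\<close> makes its coefficient
  \<open>(\<nu> q^2)^2\<close>. Norm one turns this into
  \<open>(1 - p^2)^2 = 1 + p^2 + p p^3\<close>, a combination of \<open>1\<close>, \<open>p\<close>,
  \<open>p^2\<close> whose coefficients are cubes.\<close>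

lemma cubic_PE_range:
  fixes \<nu> :: "'f::field"
  assumes 3: "(3::'f) = 0" and n: "knorm \<nu> (p,q) = 1" and q: "q \<noteq> 0"
  shows "cubic_form (PE \<nu> (p,q)) u \<in> cubes_span (- p)"
proof (cases u rule: ep_cases)
  fix b0 b1 x1 x2 x3 x4 x5 x6 assume u: "u = ((b0,b1),(x1,x2),(x3,x4),(x5,x6))"
  define S0 S1 where "S0 = x1 + x3 + x5" "S1 = (x2 + x4 + x6) / q"
  have S1: "x2 + x4 + x6 = q * S1" using q by (simp add: S0_S1_def)
  have g: "cubic_form (PE \<nu> (p,q)) u = - (b0 ^ 3) - p * S0 ^ 3 - q * \<nu>\<^sup>2 * (q * S1) ^ 3"
    unfolding u cubic_PE[OF 3] S1 by (simp add: S0_S1_def)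
  have n': "\<nu> * q ^ 2 = 1 - p ^ 2" using n by (simp add: knorm_def algebra_simps)
  have "q * \<nu>\<^sup>2 * (q * S1) ^ 3 = (\<nu> * q ^ 2) ^ 2 * S1 ^ 3" by algebra
  also have "\<dots> = (1 + p ^ 2 + p * p ^ 3) * S1 ^ 3 - 3 * (p ^ 2 * S1 ^ 3)"
    unfolding n' by algebra
  finally have E: "q * \<nu>\<^sup>2 * (q * S1) ^ 3 = (1 + p ^ 2 + p * p ^ 3) * S1 ^ 3" by (simp only: 3 mult_zero_left diff_zero)
  have "cubic_form (PE \<nu> (p,q)) u = (- b0 - S1) ^ 3 + (S0 + p * S1) ^ 3 * (- p) + (- S1) ^ 3 * (- p) ^ 2"
    unfolding g E cube_diff[OF 3] cube_add[OF 3] by algebra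
  then show ?thesis by (rule cubes_spanI)
qed

lemma petersson_at_iso:
  assumes "alg_iso A' A f" "f e' = e" "petersson_at A e \<nu> a"
  shows "petersson_at A' e' \<nu> a"
proof -
  obtain h where "alg_iso A (PE \<nu> a) h" "h e = one_ep" using assms(3) by (auto simp: petersson_at_def)
  then show ?thesis unfolding petersson_at_def using assms alg_iso_comp[OF assms(1)] by (intro exI[of _ "\<lambda>x. h (f x)"]) auto
qed

lemma alg_iso_idempotent:
  assumes f: "alg_iso A A' f" and A: "normed_algebra A" and x: "x \<in> carr A"
  shows "idempotent A' (f x) \<longleftrightarrow> idempotent A x"
proof -
  interpret normed_alg A using A by unfold_locales
  have f0: "f 0 = 0" using alg_isoD(3)[OF f, of 0 0] by simp
  have "f x = 0 \<longleftrightarrow> x = 0" using alg_iso_injD[OF f x, of 0] f0 by simp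
  moreover have "mul A' (f x) (f x) = f x \<longleftrightarrow> mul A x x = x"
    using alg_iso_injD[OF f, of "mul A x x" x] alg_isoD(5)[OF f x x] x by simp
  ultimately show ?thesis using x alg_isoD(2)[OF f x] by (simp add: idempotent_def)
qed

lemma alg_iso_centralizer:
  assumes f: "alg_iso A A' f" and A: "normed_algebra A" and x: "x \<in> carr A" "e \<in> carr A"
  shows "f x \<in> centralizer A' (f e) \<longleftrightarrow> x \<in> centralizer A e"
proof -
  interpret normed_alg A using A by unfold_locales
  show ?thesis
    using x alg_isoD(2)[OF f] alg_iso_injD[OF f, of "mul A e x" "mul A x e"] alg_isoD(5)[OF f x(2,1)] alg_isoD(5)[OF f x]
    by (simp add: centralizer_def)
qed

lemma alg_iso_cubic:
  assumes f: "alg_iso A A' f" and A: "normed_algebra A" and x: "x \<in> carr A"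
  shows "cubic_form A' (f x) = cubic_form A x"
proof -
  interpret normed_alg A using A by unfold_locales
  show ?thesis using alg_isoD(5)[OF f x x] alg_iso_polar[OF f A x, of "mul A x x"] x by (simp add: cubic_form_def)
qed

context symcomp
begin

lemma petersson_at_conj:
  assumes "petersson_at A e \<nu> a" "petersson_at A e' \<nu> a" and e: "e \<in> C" "e' \<in> C"
  shows "\<exists>f. alg_iso A A f \<and> f e = e'"
proof -
  obtain f f' where f: "alg_iso A (PE \<nu> a) f" "f e = one_ep" "alg_iso A (PE \<nu> a) f'" "f' e' = one_ep"
    using assms by (auto simp: petersson_at_def)
  have "alg_iso A A (\<lambda>x. inv_into C f' (f x))"
    by (rule alg_iso_comp[OF f(1) alg_iso_inv[OF f(3) na]])
  moreover have "inv_into C f' (f e) = e'"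
    using inv_into_f_f[of f' C e'] alg_isoD(1)[OF f(3)] e f(2,4) by (simp add: bij_betw_def)
  ultimately show ?thesis by blast
qed

lemma quadratic_idempotent_exists_unique:
  fixes K :: "('f, 'k::ab_group_add) nalg"
  assumes S: "independent S" "S \<subseteq> C" "card S = 8"
    and a: "etale_pair K a" "a \<notin> alg_cubes K"
    and g: "g ` C = cubes_adjoin (polar K a (unity K))"
  shows "\<exists>!e. quadratic_idempotent A e \<and> idem_class A e = pair_class K a"
proof -
  have 2: "(2::'f) \<noteq> 0" using char3 by (rule char3_two_neq_0)
  obtain \<nu> \<kappa> a0 where K: "etale_coord K \<nu> \<kappa>" "a = \<kappa> a0" "knorm \<nu> a0 = 1" "\<nu> \<noteq> 0"
    using etale_pair_coord[OF char3 a(1)] .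
  interpret K: etale_coord K \<nu> \<kappa> by (rule K(1))
  obtain p q where pq: "a0 = (p,q)" by (cases a0)
  define t where "t = - p"
  have tr: "polar K a (unity K) = t"
    by (simp add: K(2) K.k_unity K.k_polar pq t_def two)
  have pc: "p \<noteq> s ^ 3" for s
  proof
    assume "p = s ^ 3"
    then obtain c where "km \<nu> c (km \<nu> c c) = a0" using cube_of_trace[OF char3 K(4)] K(3) pq by metis
    then have "a \<in> alg_cubes K" unfolding alg_cubes_coord[OF K(1)] K(2) by blast
    then show False using a(2) by blast
  qed
  have tnc: "t \<noteq> c ^ 3" for c
  proof
    assume "t = c ^ 3"
    then have "p = (- c) ^ 3" by (simp add: t_def) (metis add.inverse_inverse)
    then show False using pc by blast
  qed
  have q: "q \<noteq> 0"
  proof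
    assume "q = 0"
    then have "(p - 1) * (p + 1) = 0" using K(3) unfolding pq knorm_def by simp algebra
    then have "p = 1 ^ 3 \<or> p = (- 1) ^ 3" by (auto simp: eq_neg_iff_add_eq_0)
    then show False using pc by blast
  qed
  have rng: "\<exists>c0 c1 c2. g u = c0 ^ 3 + c1 ^ 3 * t + c2 ^ 3 * t ^ 2" if "u \<in> C" for u
    using g that cubes_adjoin_subset[OF char3, of t] unfolding tr cubes_span_def by blast
  have "\<exists>u\<in>C. g u = s" if "s \<in> {1, t, t^2}" for s
    using cubes_adjoin_powers[of t] that g unfolding tr by (metis (no_types, lifting) imageE insertE emptyE)
  then obtain b0 b1 b2 where b: "b0 \<in> C" "b1 \<in> C" "b2 \<in> C" "g b0 = 1" "g b1 = t" "g b2 = t ^ 2"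
    by (metis insertCI)
  obtain e0 where e0: "idempotent A e0"
    using exists_idempotent[OF S tnc b rng] by blast
  obtain x w where xw: "okubo_pair A x w t 1"
    using exists_okubo_pair[OF e0 tnc b(2,5) rng] by blast
  have nrm1: "fst a0 ^ 2 + \<nu> * snd a0 ^ 2 = 1" using K(3) by (simp add: knorm_def)
  interpret P: symcomp "PE \<nu> a0" by (rule symcomp_PE[OF char3 K(4) nrm1])
  have one_idem: "idempotent (PE \<nu> a0) one_ep"
    by (simp add: idempotent_def pmul_one) (simp add: one_ep_def zero_prod_def kc_def)
  \<comment> \<open>The existence argument that served for \<open>A\<close> applies to the Petersson
    algebra with the same \<open>t\<close>, so the two algebras have pairs with equal
    values.\<close>
  have "\<exists>x' w'. okubo_pair (PE \<nu> a0) x' w' t 1"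
  proof (rule P.exists_okubo_pair[OF one_idem tnc])
    show "cubic_form (PE \<nu> a0) (0, (1,0), 0, 0) = t"
      unfolding pq t_def zero_prod_def cubic_PE[OF char3] by simp
    show "\<exists>c0 c1 c2. cubic_form (PE \<nu> a0) u = c0 ^ 3 + c1 ^ 3 * t + c2 ^ 3 * t ^ 2" for u
      using cubic_PE_range[OF char3 _ q, of \<nu> p u] K(3) unfolding pq t_def cubes_span_def by blast
  qed simp
  then obtain x' w' where xw': "okubo_pair (PE \<nu> a0) x' w' t 1" by blast
  have "t \<noteq> 0" using tnc[of 0] by simp
  then obtain f where f: "alg_iso A (PE \<nu> a0) f" using okubo_pair_iso[OF xw xw'] by auto
  obtain e where e: "e \<in> C" "f e = one_ep" using alg_iso_surjE[OF f, of one_ep] by auto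
  have ei: "idempotent A e" using alg_iso_idempotent[OF f na e(1)] e(2) one_idem by simp
  have te: "petersson_at A e \<nu> a0" using f e by (auto simp: petersson_at_def)
  have cl: "idem_class A e' = pair_class K a \<longleftrightarrow> petersson_at A e' \<nu> a0" if "idempotent A e'" for e'
    using idem_class_iff[OF that a(1)] tau_conjugate_iff[OF that K(1), of a0] K(2) by simp
  show ?thesis
  proof (rule ex1I[of _ e])
    show "quadratic_idempotent A e \<and> idem_class A e = pair_class K a"
      using petersson_at_quadratic(1)[OF ei te K(4)] cl[OF ei] te by blast
    fix e' assume e': "quadratic_idempotent A e' \<and> idem_class A e' = pair_class K a"
    then have e'i: "idempotent A e'" by (simp add: quadratic_idempotent_def)
    then have e'C: "e' \<in> C" by (rule eC)
    have "petersson_at A e' \<nu> a0" using cl[OF e'i] e' by blast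
    then obtain h where h: "alg_iso A A h" "h e = e'" using petersson_at_conj[OF te _ e(1) e'C] by blast
    \<comment> \<open>In Petersson coordinates \<open>g u = 0\<close> is a relation between
      \<open>1\<close>, \<open>t\<close>, \<open>t^2\<close> with cube coefficients. Its triviality
      forces \<open>b0 = 0\<close>, and \<open>b0\<close> is up to a factor the pairing with
      \<open>one_ep\<close>.\<close>
    have ker: "B e u = 0" if u: "u \<in> C" "g u = 0" for u
    proof -
      obtain b0 b1 x1 x2 x3 x4 x5 x6 where fu: "f u = ((b0,b1),(x1,x2),(x3,x4),(x5,x6))" by (metis surj_pair)
      have "cubic_form (PE \<nu> (p,q)) (f u) = 0" using alg_iso_cubic[OF f na u(1)] u(2) pq by simp
      moreover define S0 S1 where "S0 = x1 + x3 + x5" "S1 = (x2 + x4 + x6) / q"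
      moreover have S1: "x2 + x4 + x6 = q * S1" using q by (simp add: S0_S1_def)
      ultimately have g0: "- (b0 ^ 3) - p * S0 ^ 3 - q * \<nu>\<^sup>2 * (q * S1) ^ 3 = 0"
        unfolding fu cubic_PE[OF char3] S1 by (simp add: S0_S1_def)
      have n': "\<nu> * q ^ 2 = 1 - p ^ 2" using K(3) by (simp add: pq knorm_def algebra_simps)
      have "q * \<nu>\<^sup>2 * (q * S1) ^ 3 = (\<nu> * q ^ 2) ^ 2 * S1 ^ 3" by algebra
      also have "\<dots> = (1 + p ^ 2 + p * p ^ 3) * S1 ^ 3 - 3 * (p ^ 2 * S1 ^ 3)"
        unfolding n' by algebra
      finally have E: "q * \<nu>\<^sup>2 * (q * S1) ^ 3 = (1 + p ^ 2 + p * p ^ 3) * S1 ^ 3" by (simp only: char3 mult_zero_class.mult_zero_left diff_zero)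
      have "(- b0 - S1) ^ 3 + (S0 + p * S1) ^ 3 * t + (- S1) ^ 3 * t ^ 2 = 0"
        using g0 unfolding E t_def cube_diff[OF char3] cube_add[OF char3] by algebra
      from non_cube_independent(1,3)[OF char3 tnc this] have "b0 = 0" by simp
      then have "polar (PE \<nu> a0) (f e) (f u) = 0" by (simp add: e(2) polar_one_ep fu)
      then show ?thesis using alg_iso_polar[OF f na e(1) u(1)] by simp
    qed
    \<comment> \<open>For \<open>y = h x\<close> the difference \<open>x - y\<close> lies in the
      kernel of \<open>g\<close>, so \<open>e\<close> pairs equally with both; and
      \<open>e' = h e\<close> pairs with \<open>y\<close> as \<open>e\<close> does with
      \<open>x\<close>.\<close>
    have "B (e' - e) y = 0" if y: "y \<in> C" for y
    proof -
      obtain x where x: "x \<in> C" "h x = y" using alg_iso_surjE[OF h(1) y] .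
      have "g (x - y) = 0" using x y alg_iso_cubic[OF h(1) na x(1)] by (simp add: g_diff)
      then have "B e x = B e y" using ker[of "x - y"] x y e(1) by simp
      moreover have "B e' y = B e x" using alg_iso_polar[OF h(1) na e(1) x(1)] h(2) x(2) by simp
      ultimately show ?thesis using e(1) e'C y by simp
    qed
    then have "e' - e = 0" using e(1) e'C by (intro nonsing) auto
    then show "e' = e" by simp
  qed
qed

end

section \<open>Idempotents of the split Okubo algebra\<close>

lemma petersson_at_iso_image:
  assumes f: "alg_iso A A' f" and A: "normed_algebra A" "e \<in> carr A" and t: "petersson_at A e \<nu> a"
  shows "petersson_at A' (f e) \<nu> a"
proof (rule petersson_at_iso[OF alg_iso_inv[OF f A(1)] _ t])
  show "inv_into (carr A) f (f e) = e"
    using alg_isoD(1)[OF f] A(2) by (simp add: bij_betw_def)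
qed

lemma conj_classI: "alg_iso A A f \<Longrightarrow> x = f e \<Longrightarrow> x \<in> conj_class A e"
  unfolding conj_class_def by blast

lemma conj_class_self: "e \<in> conj_class A e"
  by (rule conj_classI[OF alg_iso_id]) simp

lemma petersson_atI: "alg_iso A (PE \<nu> a) f \<Longrightarrow> f e = one_ep \<Longrightarrow> petersson_at A e \<nu> a"
  unfolding petersson_at_def by blast

lemma conj_class_eq:
  assumes f: "alg_iso A A f" "f e = e'" and A: "normed_algebra A" "e \<in> carr A"
  shows "conj_class A e = conj_class A e'"
proof
  show "conj_class A e' \<subseteq> conj_class A e"
  proof
    fix x assume "x \<in> conj_class A e'"
    then obtain h where h: "alg_iso A A h" "x = h e'" by (auto simp: conj_class_def)
    show "x \<in> conj_class A e" by (rule conj_classI[OF alg_iso_comp[OF f(1) h(1)]]) (simp add: f(2) h(2))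
  qed
  have i: "inv_into (carr A) f e' = e"
    using alg_isoD(1)[OF f(1)] A(2) f(2) by (auto simp: bij_betw_def)
  show "conj_class A e \<subseteq> conj_class A e'"
  proof
    fix x assume "x \<in> conj_class A e"
    then obtain h where h: "alg_iso A A h" "x = h e" by (auto simp: conj_class_def)
    show "x \<in> conj_class A e'"
      by (rule conj_classI[OF alg_iso_comp[OF alg_iso_inv[OF f(1) A(1)] h(1)]]) (simp add: i h(2))
  qed
qed

context symcomp
begin

text \<open>The pairs \<open>(p, 0)\<close> are closed under the product, which is the
  para-quaternion product of the matrix algebra there; they all commute with
  \<open>(1, 0)\<close>.\<close>

lemma has_para_quaternion_MO:
  assumes F: "alg_iso A (MO :: ('f, 'f mp) nalg) F" and e: "e \<in> C" "F e = (1,0,0,1,0,0,0,0)"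
  shows "idempotent A e" "has_para_quaternion A (centralizer A e)"
proof -
  have "(1::'f) = - 1 - 1" using two by simp
  then have "idempotent MO (1::'f,0,0,1,0,0,0,0)" unfolding idempotent_MO_iff[OF char3] by simp
  then show ei: "idempotent A e" using alg_iso_idempotent[OF F na e(1)] e(2) by simp
  have F_add: "F (x + y) = F x + F y" and F_mul: "F (x \<star> y) = mmul (F x) (F y)"
    and F_B: "polar MO (F x) (F y) = B x y" if "x \<in> C" "y \<in> C" for x y
    using alg_isoD(3)[OF F that] alg_isoD(5)[OF F that] alg_iso_polar[OF F na that] by simp_all
  have F_scal: "F (c \<bullet>\<^sub>s x) = msm c (F x)" if "x \<in> C" for x c using alg_isoD(4)[OF F that] by simp
  have F_inj: "x = y" if "F x = F y" "x \<in> C" "y \<in> C" for x y using alg_iso_injD[OF F] that by blast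
  have F_zero: "F 0 = 0" using F_add[of 0 0] by simp
  have F_ex: "\<exists>x\<in>C. F x = y" for y using alg_iso_surjE[OF F, of y] by auto
  define S where "S = {x \<in> C. \<exists>a b c d. F x = (a,b,c,d,0,0,0,0)}"
  have SC: "x \<in> C" if "x \<in> S" for x using that by (simp add: S_def)
  have S_ex: "\<exists>a b c d. F x = (a,b,c,d,0,0,0,0)" if "x \<in> S" for x using that by (simp add: S_def)
  have SI: "x \<in> S" if "x \<in> C" "F x = (a,b,c,d,0,0,0,0)" for x a b c d using that by (auto simp: S_def)
  have sub: "subspace S"
  proof (rule subspaceI)
    show "0 \<in> S" by (rule SI[of _ 0 0 0 0]) (simp_all add: F_zero zero_prod_def)
    fix x y assume xy: "x \<in> S" "y \<in> S"
    obtain a b c d where x: "F x = (a,b,c,d,0,0,0,0)" using S_ex[OF xy(1)] by blast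
    obtain a' b' c' d' where y: "F y = (a',b',c',d',0,0,0,0)" using S_ex[OF xy(2)] by blast
    show "x + y \<in> S" by (rule SI[of _ "a + a'" "b + b'" "c + c'" "d + d'"]) (use xy SC in \<open>simp_all add: F_add x y\<close>)
  next
    fix k x assume xS: "x \<in> S"
    obtain a b c d where x: "F x = (a,b,c,d,0,0,0,0)" using S_ex[OF xS] by blast
    show "k \<bullet>\<^sub>s x \<in> S" by (rule SI[of _ "k * a" "k * b" "k * c" "k * d"]) (use xS SC in \<open>simp_all add: F_scal x\<close>)
  qed
  have SZ: "S \<subseteq> centralizer A e"
  proof
    fix x assume xS: "x \<in> S"
    obtain a b c d where x: "F x = (a,b,c,d,0,0,0,0)" using S_ex[OF xS] by blast
    have "F (e \<star> x) = F (x \<star> e)" using xS SC e(1) by (simp add: F_mul e(2) x)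
    then have "e \<star> x = x \<star> e" using F_inj xS SC e(1) by simp
    then show "x \<in> centralizer A e" using xS SC by (simp add: centralizer_def)
  qed
  have cl: "x \<star> y \<in> S" if xy: "x \<in> S" "y \<in> S" for x y
  proof -
    obtain a b c d where x: "F x = (a,b,c,d,0,0,0,0)" using S_ex[OF xy(1)] by blast
    obtain a' b' c' d' where y: "F y = (a',b',c',d',0,0,0,0)" using S_ex[OF xy(2)] by blast
    have "F (x \<star> y) = (b * c' + d * d', - b * a' - d * b', - a * c' - c * d', a * a' + c * b', 0,0,0,0)"
      using xy SC by (simp add: F_mul x y)
    then show ?thesis using SI xy SC by simp
  qed
  have eS: "e \<in> S" using SI e by blast
  obtain b0 where b0: "b0 \<in> C" "F b0 = (1,0,0,0,0,0,0,0)" using F_ex by blast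
  obtain b1 where b1: "b1 \<in> C" "F b1 = (0,1,0,0,0,0,0,0)" using F_ex by blast
  obtain b2 where b2: "b2 \<in> C" "F b2 = (0,0,1,0,0,0,0,0)" using F_ex by blast
  obtain b3 where b3: "b3 \<in> C" "F b3 = (0,0,0,1,0,0,0,0)" using F_ex by blast
  note b = b0 b1 b2 b3
  have bS: "b0 \<in> S" "b1 \<in> S" "b2 \<in> S" "b3 \<in> S" using SI b by blast+
  have Bx: "B x b0 = d" "B x b1 = - c" "B x b2 = - b" "B x b3 = a" if "x \<in> C" "F x = (a,b,c,d,0,0,0,0)" for x a b c d
    using F_B[OF that(1) b0(1)] F_B[OF that(1) b1(1)] F_B[OF that(1) b2(1)] F_B[OF that(1) b3(1)]
    by (simp_all add: that(2) b0(2) b1(2) b2(2) b3(2) polar_MO)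
  have ns: "x = 0" if xS: "x \<in> S" "\<And>y. y \<in> S \<Longrightarrow> B x y = 0" for x
  proof -
    obtain a b c d where x: "F x = (a,b,c,d,0,0,0,0)" using S_ex[OF xS(1)] by blast
    have "F x = F 0" using Bx[OF SC[OF xS(1)] x] xS(2)[OF bS(1)] xS(2)[OF bS(2)] xS(2)[OF bS(3)] xS(2)[OF bS(4)]
      by (simp add: x F_zero zero_prod_def)
    then show ?thesis using F_inj SC[OF xS(1)] by simp
  qed
  note Bb = Bx[OF b0] Bx[OF b1] Bx[OF b2] Bx[OF b3]
  have n0: "b0 \<notin> span {b1,b2,b3}" by (rule notin_span[of b3]) (use b in \<open>auto simp: Bb\<close>)
  have n1: "b1 \<notin> span {b2,b3}" by (rule notin_span[of b2]) (use b in \<open>auto simp: Bb\<close>)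
  have n2: "b2 \<notin> span {b3}" by (rule notin_span[of b1]) (use b in \<open>auto simp: Bb\<close>)
  have n3: "b3 \<notin> span {}" by (rule notin_span[of b0]) (use b in \<open>auto simp: Bb\<close>)
  have ind: "independent {b0,b1,b2,b3}"
    using n0 n1 n2 n3 by (intro independent_insertI independent_empty)
  have "b0 \<notin> {b1,b2,b3}" "b1 \<notin> {b2,b3}" "b2 \<notin> {b3}" using n0 n1 n2 span_base by meson+
  then have card: "card {b0,b1,b2,b3} = 4" by simp
  have "span {b0,b1,b2,b3} = S"
  proof
    show "span {b0,b1,b2,b3} \<subseteq> S" using bS sub by (intro span_minimal) auto
    show "S \<subseteq> span {b0,b1,b2,b3}"
    proof
      fix x assume xS: "x \<in> S"
      obtain k0 k1 k2 k3 where x: "F x = (k0,k1,k2,k3,0,0,0,0)" using S_ex[OF xS] by blast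
      have "F x = F (k0 \<bullet>\<^sub>s b0 + k1 \<bullet>\<^sub>s b1 + k2 \<bullet>\<^sub>s b2 + k3 \<bullet>\<^sub>s b3)"
        using b by (simp add: F_add F_scal x)
      then have "x = k0 \<bullet>\<^sub>s b0 + k1 \<bullet>\<^sub>s b1 + k2 \<bullet>\<^sub>s b2 + k3 \<bullet>\<^sub>s b3" using F_inj b SC[OF xS] by simp
      then show "x \<in> span {b0,b1,b2,b3}" by (simp add: span_add span_scale span_base)
    qed
  qed
  then have d: "dim S = 4" using dim_span_eq_card_independent[OF ind] card by simp
  obtain H :: "('f, 'v) nalg" where H: "hurwitz H" "alg_dim H = dim S" "isomorphic (A\<lparr>carr := S\<rparr>) (petersson H id)"
    using para_of_subspace[OF ei sub SZ eS cl ns] by blast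
  have "para_quaternion (A\<lparr>carr := S\<rparr>)"
    unfolding para_quaternion_def quaternion_alg_def using H d by auto
  moreover have "subalgebra A S" unfolding subalgebra_def using sub cl SC by auto
  ultimately show "has_para_quaternion A (centralizer A e)" unfolding has_para_quaternion_def using SZ by blast
qed

lemma singular_MO:
  assumes F: "alg_iso A (MO :: ('f, 'f mp) nalg) F" and e: "e \<in> C" "F e = (1,0,0,1,1,0,0,0)"
    and x: "x \<in> centralizer A e" "B e x = 0"
  shows "N x = 0"
proof -
  have xC: "x \<in> C" using x by (simp add: centralizer_def)
  have "F x \<in> centralizer MO (F e)" using alg_iso_centralizer[OF F na xC e(1)] x by blast
  moreover have "polar MO (F e) (F x) = 0" using alg_iso_polar[OF F na e(1) xC] x by simp
  ultimately have "mnrm (F x) = 0" unfolding e(2) using centralizer_MO_singular[OF char3] by blast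
  then show ?thesis using alg_isoD(6)[OF F xC] by simp
qed

end

text \<open>The isomorphism \<open>h\<close> does not reveal the image of \<open>one_ep\<close>, so
  this is found by elimination. A para-quaternion subalgebra in the centralizer excludes
  \<open>(1, 0)\<close>, the missing norm \<open>\<mu>\<close> excludes the singular form, and a
  quadratic form with parameter \<open>\<mu>'\<close> satisfies \<open>\<mu> = \<mu>' s^2\<close>,
  which \<open>fD s\<close> normalizes.\<close>

lemma petersson_at_MO:
  fixes \<mu> :: "'f::field"
  assumes 3: "(3::'f) = 0" and mu: "\<mu> \<noteq> 0"
  shows "petersson_at MO (1,\<mu>,0,1,0,0,0,0) \<mu> (1,0)"
proof -
  interpret M: symcomp "MO :: ('f, 'f mp) nalg" using 3 by (rule symcomp_MO)
  obtain h where h: "alg_iso (PE \<mu> (1,0)) MO h"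
    using okubo_pair_iso[OF okubo_pair_PE[OF 3 mu] okubo_pair_MO[OF 3]] mu by auto
  have t: "petersson_at (PE \<mu> (1,0)) one_ep \<mu> (1,0)" by (rule petersson_atI[OF alg_iso_id]) simp
  have one_idem: "idempotent (PE \<mu> (1,0)) one_ep"
    by (simp add: idempotent_def pmul_one) (simp add: one_ep_def zero_prod_def kc_def)
  have i: "idempotent MO (h one_ep)" using alg_iso_idempotent[OF h normed_algebra_PE] one_idem by simp
  have t1: "petersson_at MO (h one_ep) \<mu> (1,0)" using petersson_at_iso_image[OF h normed_algebra_PE _ t] by simp
  obtain x0 x1 x2 x3 x4 x5 x6 x7 where e: "h one_ep = (x0,x1,x2,x3,x4,x5,x6,x7)" by (metis surj_pair)
  note i' = i[unfolded e] and t1' = t1[unfolded e]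
  have iff: "x6 = 0" "x7 = 0" "x3 = - 1 - x0" using i' idempotent_MO_iff[OF 3] by blast+
  have 2: "(1::'f) = - 1 - 1" using M.two by simp
  show ?thesis
  proof (cases "x0 \<noteq> 1 \<or> x1 \<noteq> 0 \<or> x2 \<noteq> 0")
    case True
    obtain f \<mu>' where f: "alg_iso MO MO f" "\<mu>' \<noteq> 0" "f (x0,x1,x2,x3,x4,x5,x6,x7) = (1,\<mu>',0,1,0,0,0,0)"
      using idempotent_MO_conj_quadratic[OF 3 i' True] by blast
    have t2: "petersson_at MO (1,\<mu>',0,1,0,0,0,0) \<mu> (1,0)" using petersson_at_iso_image[OF f(1) M.na _ t1'] f(3) by simp
    have i2: "idempotent MO (1,\<mu>',0,1,0,0,0,0)" unfolding idempotent_MO_iff[OF 3] using 2 by simp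
    obtain z where z: "z \<in> centralizer MO (1,\<mu>',0,1,0,0,0,0)" "polar MO (1,\<mu>',0,1,0,0,0,0) z = 0" "nrm MO z = \<mu>"
      using M.petersson_at_quadratic(2)[OF i2 t2 mu] by blast
    then obtain s where s: "\<mu> = \<mu>' * s ^ 2" using centralizer_MO_quadratic[OF 3 f(2) z(1,2)] z(3) by (metis MO_sel(4))
    then have "s \<noteq> 0" using mu by auto
    then have "petersson_at MO (fD s (1,\<mu>',0,1,0,0,0,0)) \<mu> (1,0)" using petersson_at_iso_image[OF alg_iso_fD M.na _ t2] by simp
    then show ?thesis using s by (simp add: mult.commute)
  next
    case False
    then have x: "x0 = 1" "x1 = 0" "x2 = 0" by auto
    have x3: "x3 = 1" unfolding iff x using 2 by simp
    have e': "(x0,x1,x2,x3,x4,x5,x6,x7) = (1,0,0,1,x4,x5,0,0)" using x x3 iff by simp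
    note q = M.petersson_at_quadratic[OF i' t1' mu]
    show ?thesis
    proof (cases "x4 \<noteq> 0 \<or> x5 \<noteq> 0")
      case True
      then obtain f where f: "alg_iso MO MO f" "f (1,0,0,1,x4,x5,0,0) = (1,0,0,1,1,0,0,0)"
        using idempotent_MO_conj_singular by blast
      obtain z where z: "z \<in> centralizer MO (1,0,0,1,x4,x5,0,0)" "polar MO (1,0,0,1,x4,x5,0,0) z = 0" "nrm MO z = \<mu>"
        using q(2) unfolding e' by blast
      have "nrm MO z = 0" by (rule M.singular_MO[OF f(1) _ f(2) z(1,2)]) simp
      then show ?thesis using z mu by simp
    next
      case False
      have "has_para_quaternion MO (centralizer MO (1::'f,0,0,1,0,0,0,0))"
        by (rule M.has_para_quaternion_MO(2)[OF alg_iso_id]) simp_all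
      then show ?thesis using q(1) False unfolding e' by (simp add: quadratic_idempotent_def)
    qed
  qed
qed

text \<open>The type \<open>'f ^ 2\<close> has room for a copy of
  \<open>F[z] / (z^2 + \<mu>)\<close> for every nonzero \<open>\<mu>\<close>, so the etale algebra
  of any quadratic idempotent of the split algebra can be realized on this one type.\<close>

lemma K2_exists:
  fixes \<mu> :: "'f::field"
  assumes 3: "(3::'f) = 0" and mu: "\<mu> \<noteq> 0"
  shows "\<exists>(K :: ('f, 'f ^ 2) nalg) \<kappa>. quadratic_etale K \<and> etale_coord K \<mu> \<kappa>"
proof -
  have 2: "(2::'f) \<noteq> 0" using 3 by (rule char3_two_neq_0)
  define \<kappa> :: "'f kp \<Rightarrow> 'f ^ 2" where "\<kappa> = (\<lambda>a. \<chi> i. if i = 1 then fst a else snd a)"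
  define \<rho> :: "'f ^ 2 \<Rightarrow> 'f kp" where "\<rho> x = (x $ 1, x $ 2)" for x
  define K :: "('f, 'f ^ 2) nalg" where
    "K = \<lparr>carr = UNIV, smul = (*s), mul = (\<lambda>x y. \<kappa> (km \<mu> (\<rho> x) (\<rho> y))), nrm = (\<lambda>x. (x $ 1)^2 + \<mu> * (x $ 2)^2)\<rparr>"
  have sel[simp]: "carr K = UNIV" "smul K = (*s)" "mul K x y = \<kappa> (km \<mu> (\<rho> x) (\<rho> y))" "nrm K x = (x $ 1)^2 + \<mu> * (x $ 2)^2" for x y
    by (simp_all add: K_def)
  have k[simp]: "\<kappa> a $ 1 = fst a" "\<kappa> a $ 2 = snd a" "\<rho> (\<kappa> a) = a" "\<kappa> (\<rho> x) = x" for a x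
    by (simp_all add: \<kappa>_def \<rho>_def vec_eq_iff forall_2)
  have bij: "bij_betw \<kappa> UNIV UNIV" by (rule bij_betw_byWitness[of _ \<rho>]) auto
  have iso: "alg_iso (KM \<mu>) K \<kappa>"
    unfolding alg_iso_def using bij by (simp add: vec_eq_iff forall_2)
  have un: "is_unit_of K (\<kappa> (1,0))" by (simp add: is_unit_of_def km_one)
  have "normed_algebra K"
    by (rule normed_algebra_pullback[OF alg_iso_inv[OF iso normed_algebra_KM] normed_algebra_KM])
      (simp_all add: vec.subspace_UNIV vec.vector_space_axioms)
  moreover have "nonsingular_nrm K"
    unfolding nonsingular_nrm_def
  proof (intro ballI impI)
    fix x assume a: "\<forall>y\<in>carr K. polar K x y = 0"
    have p: "polar K x y = 2 * (x $ 1 * y $ 1 + \<mu> * x $ 2 * y $ 2)" for y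
      by (simp add: polar_def power2_eq_square algebra_simps)
    have "polar K x (\<kappa> (1,0)) = 0" "polar K x (\<kappa> (0,1)) = 0" using a by simp_all
    then show "x = 0" using 2 mu unfolding p by (simp add: vec_eq_iff forall_2)
  qed
  moreover have "nrm K (mul K x y) = nrm K x * nrm K y" for x y
    by (simp add: km_def \<rho>_def) algebra
  moreover have "alg_dim K = 2"
    by (simp add: alg_dim_def vec.dim_UNIV vec.dimension_def card_cart_basis)
  ultimately have "quadratic_etale K"
    unfolding quadratic_etale_def hurwitz_def using un by blast
  moreover have "etale_coord K \<mu> \<kappa>" using 3 mu iso un by unfold_locales
  ultimately show ?thesis by blast
qed

context symcomp
begin

lemma quadratic_idempotents_of_iff:
  fixes K :: "('f, 'k::ab_group_add) nalg"
  shows "e \<in> quadratic_idempotents_of A K \<longleftrightarrow>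
    quadratic_idempotent A e \<and> (\<exists>a. etale_pair K a \<and> tau_conjugate A e K a)"
proof -
  have "idem_class A e = pair_class K a \<longleftrightarrow> tau_conjugate A e K a"
    if "quadratic_idempotent A e" "etale_pair K a" for a
    using idem_class_iff[of e K a] that by (simp add: quadratic_idempotent_def)
  then show ?thesis unfolding quadratic_idempotents_of_def by blast
qed

lemma quadratic_idempotents_of_isomorphic:
  fixes K K' :: "('f, 'k::ab_group_add) nalg"
  assumes K: "quadratic_etale K" "quadratic_etale K'" and i: "isomorphic K K'"
  shows "quadratic_idempotents_of A K \<subseteq> quadratic_idempotents_of A K'"
proof
  fix e assume "e \<in> quadratic_idempotents_of A K"
  then obtain a where e: "quadratic_idempotent A e" "etale_pair K a" "tau_conjugate A e K a"
    unfolding quadratic_idempotents_of_iff by blast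
  obtain \<phi> where p: "alg_iso K K' \<phi>" using i by (auto simp: isomorphic_def)
  have a: "a \<in> carr K" "nrm K a = 1" using e(2) by (auto simp: etale_pair_def)
  have ep: "etale_pair K' (\<phi> a)"
    using K(2) alg_isoD(2,6)[OF p a(1)] a(2) by (simp add: etale_pair_def)
  obtain u where u: "is_unit_of K' u" using K(2) by (auto simp: quadratic_etale_def hurwitz_def)
  then have "u \<in> alg_cubes K'" "mul K' u (\<phi> a) = \<phi> a"
    using alg_isoD(2)[OF p a(1)] by (auto simp: alg_cubes_def is_unit_of_def intro!: exI[of _ u])
  then have "pair_equiv K a K' (\<phi> a)" unfolding pair_equiv_def using p by force
  then have "tau_conjugate A e K' (\<phi> a)"
    using tau_conjugate_pair_equiv[OF _ e(2) ep e(3)] e(1) by (simp add: quadratic_idempotent_def)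
  then show "e \<in> quadratic_idempotents_of A K'" unfolding quadratic_idempotents_of_iff using e(1) ep by blast
qed

lemma quadratic_idempotents_of_inter:
  fixes K K' :: "('f, 'k::ab_group_add) nalg"
  assumes "e \<in> quadratic_idempotents_of A K" "e \<in> quadratic_idempotents_of A K'"
  shows "isomorphic K K'"
proof -
  have e: "idempotent A e" using assms(1) by (simp add: quadratic_idempotents_of_iff quadratic_idempotent_def)
  obtain a a' where "etale_pair K a" "tau_conjugate A e K a" "etale_pair K' a'" "tau_conjugate A e K' a'"
    using assms unfolding quadratic_idempotents_of_iff by blast
  then have "pair_equiv K a K' a'" using tau_conjugate_unique[OF e] by blast
  then show ?thesis by (auto simp: pair_equiv_def isomorphic_def)
qed

context
  fixes F assumes F: "alg_iso A (MO :: ('f, 'f mp) nalg) F"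
begin

lemma idempotent_split_cases:
  assumes e: "idempotent A e"
  shows "F e = (1,0,0,1,0,0,0,0) \<or> (\<exists>\<mu>. \<mu> \<noteq> 0 \<and> petersson_at A e \<mu> (1,0)) \<or>
    (\<exists>f. alg_iso A (MO :: ('f, 'f mp) nalg) f \<and> f e = (1,0,0,1,1,0,0,0))"
proof -
  have eC: "e \<in> C" by (rule eC[OF e])
  obtain x0 x1 x2 x3 x4 x5 x6 x7 where fe: "F e = (x0,x1,x2,x3,x4,x5,x6,x7)" by (metis surj_pair)
  have i: "idempotent MO (x0,x1,x2,x3,x4,x5,x6,x7)" using alg_iso_idempotent[OF F na eC] e fe by simp
  have iff: "x6 = 0" "x7 = 0" "x3 = - 1 - x0" using i idempotent_MO_iff[OF char3] by blast+
  have 2: "(1::'f) = - 1 - 1" using two by simp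
  show ?thesis
  proof (cases "x0 \<noteq> 1 \<or> x1 \<noteq> 0 \<or> x2 \<noteq> 0")
    case True
    obtain f \<mu> where f: "alg_iso MO MO f" "\<mu> \<noteq> 0" "f (F e) = (1,\<mu>,0,1,0,0,0,0)"
      using idempotent_MO_conj_quadratic[OF char3 i True] fe by metis
    have "petersson_at A e \<mu> (1,0)" by (rule petersson_at_iso[OF alg_iso_comp[OF F f(1)] f(3) petersson_at_MO[OF char3 f(2)]])
    then show ?thesis using f(2) by blast
  next
    case False
    then have x: "x0 = 1" "x1 = 0" "x2 = 0" by auto
    have x3: "x3 = 1" unfolding iff x using 2 by simp
    have e': "F e = (1,0,0,1,x4,x5,0,0)" using x x3 iff fe by simp
    show ?thesis
    proof (cases "x4 \<noteq> 0 \<or> x5 \<noteq> 0")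
      case True
      then obtain f where f: "alg_iso MO MO f" "f (F e) = (1,0,0,1,1,0,0,0)"
        unfolding e' using idempotent_MO_conj_singular by blast
      then show ?thesis using alg_iso_comp[OF F f(1)] by blast
    qed (use e' in simp)
  qed
qed

lemma F_ex: "\<exists>e\<in>C. F e = y"
  using alg_iso_surjE[OF F, of y] by auto

lemma unique_quaternionic: "\<exists>!e. quaternionic_idempotent A e"
proof -
  obtain e where e: "e \<in> C" "F e = (1,0,0,1,0,0,0,0)" using F_ex by blast
  show ?thesis
  proof (rule ex1I[of _ e])
    show "quaternionic_idempotent A e"
      using has_para_quaternion_MO[OF F e] by (simp add: quaternionic_idempotent_def)
    fix e' assume e': "quaternionic_idempotent A e'"
    then have i: "idempotent A e'" and h: "has_para_quaternion A (centralizer A e')"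
      by (simp_all add: quaternionic_idempotent_def)
    have e'C: "e' \<in> C" by (rule eC[OF i])
    show "e' = e" using idempotent_split_cases[OF i]
    proof (elim disjE exE conjE)
      assume "F e' = (1,0,0,1,0,0,0,0)"
      then show "e' = e" using alg_iso_injD[OF F e'C e(1)] e(2) by simp
    next
      fix \<mu> assume "\<mu> \<noteq> 0" "petersson_at A e' \<mu> (1,0)"
      then show "e' = e" using petersson_at_quadratic(1)[OF i] h by (auto simp: quadratic_idempotent_def)
    next
      fix f assume f: "alg_iso A (MO :: ('f, 'f mp) nalg) f" "f e' = (1,0,0,1,1,0,0,0)"
      show "e' = e" using not_para_quaternion_singular[OF i singular_MO[OF f(1) e'C f(2)]] h by blast
    qed
  qed
qed

text \<open>In the split algebra \<open>g\<close> takes only cubes. Evaluated on a suitable vector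
  of \<open>W\<close>, it shows that the trace of \<open>a\<close> is a cube; so \<open>a\<close> is
  a cube in \<open>K\<close>, the pair is equivalent to \<open>(K, 1)\<close>, and idempotents with
  the same pair are conjugate.\<close>

lemma quadratic_conj_class:
  fixes K :: "('f, 'k::ab_group_add) nalg"
  assumes K: "quadratic_etale K" "etale_coord K \<nu> \<kappa>" and e: "idempotent A e" "petersson_at A e \<nu> (1,0)"
  shows "quadratic_idempotents_of A K = conj_class A e"
proof -
  interpret K: etale_coord K \<nu> \<kappa> by (rule K(2))
  have eC: "e \<in> C" by (rule eC[OF e(1)])
  have ep: "etale_pair K (\<kappa> (1,0))" using K(1) by (simp add: etale_pair_def K.k_nrm)
  have sub: "f e \<in> quadratic_idempotents_of A K" if f: "alg_iso A A f" for f
  proof -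
    have i: "idempotent A (f e)" using alg_iso_idempotent[OF f na eC] e(1) by simp
    have t: "petersson_at A (f e) \<nu> (1,0)" by (rule petersson_at_iso_image[OF f na eC e(2)])
    show ?thesis unfolding quadratic_idempotents_of_iff
      using petersson_at_quadratic(1)[OF i t K.nu] ep tau_conjugate_iff[OF i K(2)] t by blast
  qed
  moreover have "e' \<in> conj_class A e" if e': "e' \<in> quadratic_idempotents_of A K" for e'
  proof -
    obtain a where a: "quadratic_idempotent A e'" "etale_pair K a" "tau_conjugate A e' K a"
      using e' unfolding quadratic_idempotents_of_iff by blast
    have i: "idempotent A e'" using a(1) by (simp add: quadratic_idempotent_def)
    obtain a0 where a0: "a = \<kappa> a0" using K.k_ex[of a] a(2) unfolding etale_pair_def by blast
    have n: "knorm \<nu> a0 = 1" using a(2) by (simp add: etale_pair_def a0 K.k_nrm knorm_def)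
    have t: "petersson_at A e' \<nu> a0" using a(3) tau_conjugate_iff[OF i K(2)] a0 by simp
    then obtain f where f: "alg_iso A (PE \<nu> a0) f" by (auto simp: petersson_at_def)
    obtain p q where pq: "a0 = (p,q)" by (cases a0)
    obtain u where u: "u \<in> C" "f u = (0,(1,0),0,0)" using alg_iso_surjE[OF f, of "(0,(1,0),0,0)"] by (metis PE_sel(1) UNIV_I)
    have "cubic_form (PE \<nu> a0) (f u) = - p"
      unfolding u(2) pq zero_prod_def cubic_PE[OF char3] by simp
    then have gu: "g u = - p" using alg_iso_cubic[OF f na u(1)] by simp
    obtain y0 y1 y2 y3 y4 y5 y6 y7 where Fu: "F u = (y0,y1,y2,y3,y4,y5,y6,y7)" by (metis surj_pair)
    have "g u = (y0 + y3) ^ 3" using alg_iso_cubic[OF F na u(1)] unfolding Fu cubic_MO[OF char3] by simp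
    then have "p = (- (y0 + y3)) ^ 3" using gu by algebra
    then obtain c where c: "km \<nu> c (km \<nu> c c) = a0"
      using cube_of_trace[OF char3 K.nu, of "- (y0 + y3)" q] n pq by auto
    have "pair_eq \<nu> a0 \<nu> (1,0)"
      unfolding pair_eq_def by (rule exI[of _ 1], rule exI[of _ c]) (simp add: km_one c)
    then have "petersson_at A e' \<nu> (1,0)" using petersson_at_pair_eq[OF char3 t _ n] by (simp add: knorm_def)
    obtain h where h: "alg_iso A A h" "h e = e'"
      using petersson_at_conj[OF e(2) \<open>petersson_at A e' \<nu> (1,0)\<close> eC symcomp.eC[OF symcomp_axioms i]] by blast
    show ?thesis by (rule conj_classI[OF h(1)]) (simp add: h(2))
  qed
  ultimately show ?thesis unfolding conj_class_def by blast
qed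

lemma exists_quadratic:
  assumes "\<nu> \<noteq> 0"
  shows "\<exists>e. idempotent A e \<and> petersson_at A e \<nu> (1,0)"
proof -
  obtain e where e: "e \<in> C" "F e = (1,\<nu>,0,1,0,0,0,0)" using F_ex by blast
  have "(1::'f) = - 1 - 1" using two by simp
  then have "idempotent MO (1,\<nu>,0,1,0,0,0,0)" unfolding idempotent_MO_iff[OF char3] by simp
  then have "idempotent A e" using alg_iso_idempotent[OF F na e(1)] e(2) by simp
  then show ?thesis using petersson_at_iso[OF F e(2) petersson_at_MO[OF char3 assms]] by blast
qed

lemma singular_iff:
  "singular_idempotent A e \<longleftrightarrow> idempotent A e \<and>
    (\<exists>f. alg_iso A (MO :: ('f, 'f mp) nalg) f \<and> f e = (1,0,0,1,1,0,0,0))"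
proof (cases "idempotent A e")
  case i: True
  have eC: "e \<in> C" by (rule eC[OF i])
  show ?thesis
  proof
    assume s: "singular_idempotent A e"
    have "F e \<noteq> (1,0,0,1,0,0,0,0)"
      using has_para_quaternion_MO(2)[OF F eC] s by (auto simp: singular_idempotent_def quaternionic_idempotent_def)
    moreover have "\<not> (\<exists>\<mu>. \<mu> \<noteq> 0 \<and> petersson_at A e \<mu> (1,0))"
      using petersson_at_quadratic(1)[OF i] s by (auto simp: singular_idempotent_def)
    ultimately show "idempotent A e \<and> (\<exists>f. alg_iso A (MO :: ('f, 'f mp) nalg) f \<and> f e = (1,0,0,1,1,0,0,0))"
      using idempotent_split_cases[OF i] i by satx
  next
    assume "idempotent A e \<and> (\<exists>f. alg_iso A (MO :: ('f, 'f mp) nalg) f \<and> f e = (1,0,0,1,1,0,0,0))"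
    then obtain f where f: "alg_iso A (MO :: ('f, 'f mp) nalg) f" "f e = (1,0,0,1,1,0,0,0)" by blast
    note n = singular_MO[OF f(1) eC f(2)]
    have "\<not> has_para_quaternion A (centralizer A e)" by (rule not_para_quaternion_singular[OF i n])
    moreover have "\<not> has_para_quadratic A (centralizer A e)" using has_para_quadraticD[OF i] n by blast
    ultimately show "singular_idempotent A e"
      using i by (simp add: singular_idempotent_def quaternionic_idempotent_def quadratic_idempotent_def)
  qed
qed (simp add: singular_idempotent_def)

lemma unique_singular_class: "\<exists>!Cl. Cl \<in> conj_class A ` {e. singular_idempotent A e}"
proof -
  obtain e where e: "e \<in> C" "F e = (1,0,0,1,1,0,0,0)" using F_ex by blast
  have "(1::'f) = - 1 - 1" using two by simp
  then have "idempotent MO (1::'f,0,0,1,1,0,0,0)" unfolding idempotent_MO_iff[OF char3] by simp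
  then have i: "idempotent A e" using alg_iso_idempotent[OF F na e(1)] e(2) by simp
  then have s: "singular_idempotent A e" using singular_iff F e(2) by blast
  have "conj_class A e' = conj_class A e" if e': "singular_idempotent A e'" for e'
  proof -
    obtain f where f: "alg_iso A (MO :: ('f, 'f mp) nalg) f" "f e' = (1,0,0,1,1,0,0,0)" and i': "idempotent A e'"
      using e' singular_iff by auto
    have "alg_iso A A (\<lambda>x. inv_into C F (f x))" by (rule alg_iso_comp[OF f(1) alg_iso_inv[OF F na]])
    moreover have "inv_into C F (f e') = e"
      using inv_into_f_f[of F C e] alg_isoD(1)[OF F] e f(2) by (simp add: bij_betw_def)
    ultimately show ?thesis using conj_class_eq na eC[OF i'] by blast
  qed
  note eq = this
  show ?thesis
  proof (rule ex1I[of _ "conj_class A e"])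
    show "conj_class A e \<in> conj_class A ` {e. singular_idempotent A e}" using s by simp
    fix Cl assume "Cl \<in> conj_class A ` {e. singular_idempotent A e}"
    then obtain e' where "singular_idempotent A e'" "Cl = conj_class A e'" by blast
    then show "Cl = conj_class A e" using eq by simp
  qed
qed

end

end

theorem theorem8p5:
  fixes A :: "('f::field, 'v::ab_group_add) nalg"
  assumes "CHAR('f) = 3"
    and "okubo_algebra TYPE('l::field) A"
  shows
    "(has_dim_over field_cubes (cubic_form A ` carr A) 8 \<longrightarrow> \<not> (\<exists>e. idempotent A e)) \<and>
     (has_dim_over field_cubes (cubic_form A ` carr A) 3 \<longrightarrow>
        (\<forall>(K :: ('f, 'k::ab_group_add) nalg) a.
           etale_pair K a \<and> a \<notin> alg_cubes K \<and>
           cubic_form A ` carr A = cubes_adjoin (polar K a (unity K)) \<longrightarrow>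
           (\<exists>!e. quadratic_idempotent A e \<and> idem_class A e = pair_class K a))) \<and>
     (isomorphic A (split_okubo :: ('f, 'f ^ cayley_ix) nalg) \<longrightarrow>
        (\<exists>!e. quaternionic_idempotent A e) \<and>
        ((\<forall>K :: ('f, 'k) nalg. quadratic_etale K \<longrightarrow>
            (\<exists>e. quadratic_idempotent A e \<and> quadratic_idempotents_of A K = conj_class A e)) \<and>
         (\<forall>(K :: ('f, 'k) nalg) (K' :: ('f, 'k) nalg).
            quadratic_etale K \<and> quadratic_etale K' \<longrightarrow>
            (quadratic_idempotents_of A K = quadratic_idempotents_of A K' \<longleftrightarrow> isomorphic K K')) \<and>
         (\<forall>e. quadratic_idempotent A e \<longrightarrow>
            (\<exists>K :: ('f, 'f ^ 2) nalg. quadratic_etale K \<and>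
               conj_class A e = quadratic_idempotents_of A K))) \<and>
        (\<exists>!C. C \<in> conj_class A ` {e. singular_idempotent A e}))"
proof -
  have 3: "(3::'f) = 0" using of_nat_CHAR[where 'a = 'f] assms(1) by simp
  obtain S where A: "symcomp A" and S: "\<not> module.dependent (smul A) S" "S \<subseteq> carr A" "card S = 8"
    using okubo_algebra_symcomp[OF 3 assms(2)] by blast
  interpret symcomp A by (rule A)
  have part3: "(\<exists>!e. quaternionic_idempotent A e) \<and>
        ((\<forall>K :: ('f, 'k) nalg. quadratic_etale K \<longrightarrow>
            (\<exists>e. quadratic_idempotent A e \<and> quadratic_idempotents_of A K = conj_class A e)) \<and>
         (\<forall>(K :: ('f, 'k) nalg) (K' :: ('f, 'k) nalg).
            quadratic_etale K \<and> quadratic_etale K' \<longrightarrow>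
            (quadratic_idempotents_of A K = quadratic_idempotents_of A K' \<longleftrightarrow> isomorphic K K')) \<and>
         (\<forall>e. quadratic_idempotent A e \<longrightarrow>
            (\<exists>K :: ('f, 'f ^ 2) nalg. quadratic_etale K \<and>
               conj_class A e = quadratic_idempotents_of A K))) \<and>
        (\<exists>!C. C \<in> conj_class A ` {e. singular_idempotent A e})"
    if split: "isomorphic A (split_okubo :: ('f, 'f ^ cayley_ix) nalg)"
  proof -
    obtain f0 where f0: "alg_iso A (split_okubo :: ('f, 'f ^ cayley_ix) nalg) f0"
      using split by (auto simp: isomorphic_def)
    have m1: "(- 1 :: 'f) \<noteq> 0" by simp
    \<comment> \<open>For \<open>\<nu> = - 1\<close>, the parameter occurring in \<open>phi\<close>,
      both models have a pair with values \<open>1\<close> and \<open>- 1\<close>.\<close>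
    obtain f1 where f1: "alg_iso (PE (- 1) (1,0)) (MO :: ('f, 'f mp) nalg) f1"
      using okubo_pair_iso[OF okubo_pair_PE[OF 3 m1] okubo_pair_MO[OF 3]] by auto
    note F = alg_iso_comp[OF alg_iso_comp[OF f0 alg_iso_phi[OF 3]] f1]
    have ex: "\<exists>e. quadratic_idempotent A e \<and> quadratic_idempotents_of A K = conj_class A e"
      if K: "quadratic_etale K" for K :: "('f, 'k) nalg"
    proof -
      obtain \<nu> \<kappa> where c: "\<nu> \<noteq> 0" "alg_iso (KM \<nu>) K \<kappa>" "is_unit_of K (\<kappa> (1,0))"
        using quadratic_etale_coordinates[OF 3 K] by blast
      then have ec: "etale_coord K \<nu> \<kappa>" using 3 by unfold_locales
      obtain e where e: "idempotent A e" "petersson_at A e \<nu> (1,0)" using exists_quadratic[OF F c(1)] by blast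
      show ?thesis using petersson_at_quadratic(1)[OF e c(1)] quadratic_conj_class[OF F K ec e] by blast
    qed
    have iso: "quadratic_idempotents_of A K = quadratic_idempotents_of A K' \<longleftrightarrow> isomorphic K K'"
      if K: "quadratic_etale K" "quadratic_etale K'" for K K' :: "('f, 'k) nalg"
    proof
      assume eq: "quadratic_idempotents_of A K = quadratic_idempotents_of A K'"
      obtain e where "quadratic_idempotents_of A K = conj_class A e" using ex[OF K(1)] by blast
      then have "e \<in> quadratic_idempotents_of A K" by (simp add: conj_class_self)
      then show "isomorphic K K'" using quadratic_idempotents_of_inter eq by blast
    next
      assume i: "isomorphic K K'"
      then obtain f where "alg_iso K K' f" by (auto simp: isomorphic_def)
      moreover have "normed_algebra K" using K(1) by (simp add: quadratic_etale_def hurwitz_def)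
      ultimately have "isomorphic K' K" unfolding isomorphic_def using alg_iso_inv by blast
      then show "quadratic_idempotents_of A K = quadratic_idempotents_of A K'"
        using quadratic_idempotents_of_isomorphic[OF K i] quadratic_idempotents_of_isomorphic[OF K(2,1)] by blast
    qed
    have quad: "\<exists>K :: ('f, 'f ^ 2) nalg. quadratic_etale K \<and> conj_class A e = quadratic_idempotents_of A K"
      if e: "quadratic_idempotent A e" for e
    proof -
      have i: "idempotent A e" using e by (simp add: quadratic_idempotent_def)
      obtain F where F: "alg_iso A (MO :: ('f, 'f mp) nalg) F" using F by blast
      have "F e \<noteq> (1,0,0,1,0,0,0,0)"
        using has_para_quaternion_MO(2)[OF F eC[OF i]] e by (auto simp: quadratic_idempotent_def)
      moreover have "\<not> (\<exists>f. alg_iso A (MO :: ('f, 'f mp) nalg) f \<and> f e = (1,0,0,1,1,0,0,0))"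
        using singular_iff[OF F, of e] e i by (auto simp: singular_idempotent_def)
      ultimately have "\<exists>\<mu>. \<mu> \<noteq> 0 \<and> petersson_at A e \<mu> (1,0)"
        using idempotent_split_cases[OF F i] by satx
      then obtain \<mu> where mu: "\<mu> \<noteq> 0" "petersson_at A e \<mu> (1,0)" by blast
      obtain K :: "('f, 'f ^ 2) nalg" and \<kappa> where K: "quadratic_etale K" "etale_coord K \<mu> \<kappa>"
        using K2_exists[OF 3 mu(1)] by blast
      then show ?thesis using quadratic_conj_class[OF F K i mu(2)] by blast
    qed
    show ?thesis
    proof (intro conjI allI impI)
      show "\<exists>!e. quaternionic_idempotent A e" by (rule unique_quaternionic[OF F])
      show "\<exists>!C. C \<in> conj_class A ` {e. singular_idempotent A e}" by (rule unique_singular_class[OF F])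
    next
      fix K K' :: "('f, 'k) nalg" assume "quadratic_etale K \<and> quadratic_etale K'"
      then show "quadratic_idempotents_of A K = quadratic_idempotents_of A K' \<longleftrightarrow> isomorphic K K'"
        using iso[of K K'] by simp
    qed (rule ex quad, assumption)+
  qed
  have part2: "\<exists>!e. quadratic_idempotent A e \<and> idem_class A e = pair_class K a"
    if "etale_pair K a" "a \<notin> alg_cubes K" "cubic_form A ` carr A = cubes_adjoin (polar K a (unity K))"
    for K :: "('f, 'k) nalg" and a
    by (rule quadratic_idempotent_exists_unique[OF S that])
  have p1: "has_dim_over field_cubes (cubic_form A ` carr A) 8 \<longrightarrow> \<not> (\<exists>e. idempotent A e)"
    using no_idempotent_of_dim_8 by blast
  have p2: "has_dim_over field_cubes (cubic_form A ` carr A) 3 \<longrightarrow>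
        (\<forall>(K :: ('f, 'k) nalg) a.
           etale_pair K a \<and> a \<notin> alg_cubes K \<and>
           cubic_form A ` carr A = cubes_adjoin (polar K a (unity K)) \<longrightarrow>
           (\<exists>!e. quadratic_idempotent A e \<and> idem_class A e = pair_class K a))"
    by (intro impI allI) (elim conjE, rule part2)
  show ?thesis
    by (rule conjI[OF p1], rule conjI[OF p2], rule impI, rule part3)
qed

end
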